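(* Let $1<\alpha<2$ and let $n$ be a positive integer. Suppose that, for fixed $t$, $u(\cdot,t)\in C^{[\alpha]+2n+1}(\mathbb{R})$ and that all derivatives of $u(x,t)$ with respect to $x$ up to order $[\alpha]+2n+2$ exist and belong to $L_1(\mathbb{R})$. Then, as $h\to0^+$, $$\frac{\partial^\alpha u(x,t)}{\partial|x|^\alpha}=\left(\delta_x^0-b_{n-1}\delta_x^{2n-2}\right)^{-1}\left(\sum_{\ell=0}^{n-2}b_\ell\,\delta_x^{2\ell}\right)\left(-\frac{\Delta_h^\alpha u(x,t)}{h^\alpha}\right)+\mathcal{O}(h^{2n}),$$ where for $n=1$ the formula is understood as $\frac{\partial^\alpha u(x,t)}{\partial|x|^\alpha}=-\frac{\Delta_h^\alpha u(x,t)}{h^\alpha}+\mathcal{O}(h^2)$. Here, for $n\ge2$, the coefficients $b_0,\ldots,b_{n-1}$ satisfy the following identity in $\theta=|\omega h|$: $$\sum_{\ell=0}^{n-2}b_\ell\left(2\sum_{s=0}^{\ell-1}\sum_{q=0}^{n-1}\sum_{p=0}^{n-1-q}\frac{(-1)^{s+q}(\ell-s)^{2q}\binom{2\ell}{s}a_p}{(2q)!}\,\theta^{2(p+q)}+(-1)^\ell\binom{2\ell}{\ell}\sum_{p=0}^{n-1}a_p\theta^{2p}\right)$$ $$=1-b_{n-1}\left(\sum_{s=0}^{n-2}(-1)^s\binom{2n-2}{s}\frac{2(n-1-s)^{2n-2}}{(2n-2)!}\right)(-1)^{n-1}\theta^{2n-2},$$ and the numbers $a_p$ ($p=0,1,\ldots$)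 are defined by the power series expansion $$\sum_{p=0}^\infty a_p\theta^{2p}=\left|\frac{2\sin(\theta/2)}{\theta}\right|^\alpha=1-\frac{\alpha}{24}\theta^2+\left(\frac1{1920}+\frac{\alpha-1}{1152}\right)\alpha\,\theta^4-\left(\frac1{322560}+\frac{\alpha-1}{46080}+\frac{(\alpha-1)(\alpha-2)}{82944}\right)\alpha\,\theta^6+\cdots.$$
   Context: $[\alpha]$ is the integer part of $\alpha$; $h>0$ is the spatial step size; the constant in $\mathcal{O}(h^{2n})$ is independent of $h$. The Riesz derivative of order $\alpha\in(1,2)$ in $x$ on the real line is $$\frac{\partial^\alpha u(x,t)}{\partial|x|^\alpha}=-\frac{\kappa_\alpha}{\Gamma(2-\alpha)}\frac{\partial^2}{\partial x^2}\int_{-\infty}^{\infty}\frac{u(\eta,t)}{|x-\eta|^{\alpha-1}}\,d\eta,\qquad \kappa_\alpha=\frac12\sec\left(\frac{\pi\alpha}{2}\right).$$ The fractional centred difference operator is $$\Delta_h^\alpha u(x,t)=\sum_{k=-\infty}^\infty g_k^{(\alpha)}u(x-kh,t),\qquad g_k^{(\alpha)}=\frac{(-1)^k\Gamma(\alpha+1)}{\Gamma\left(\frac\alpha2-k+1\right)\Gamma\left(\frac\alpha2+k+1\right)}.$$ For $\ell\ge0$, $\delta_x^{2\ell}u(x,t)=\sum_{s=0}^{2\ell}(-1)^s\binom{2\ell}{s}u(x+(\ell-s)h,t)$ is the central difference with step $h$; in particular $\delta_x^0$ is the identity. The inverse $\left(\delta_x^0-b_{n-1}\delta_x^{2n-2}\right)^{-1}$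 is the inverse of this operator acting on bounded functions of $x\in\mathbb{R}$. Empty sums are zero and $c^{0}=1$. *)

theory Defs
  imports "HOL-Analysis.Analysis" "HOL-Library.Landau_Symbols"
begin

definition times_differentiable :: "nat \<Rightarrow> (real \<Rightarrow> real) \<Rightarrow> bool" where
  "times_differentiable k f \<longleftrightarrow> (\<forall>j<k. \<forall>x. (deriv ^^ j) f field_differentiable at x)"

definition C_k :: "nat \<Rightarrow> (real \<Rightarrow> real) \<Rightarrow> bool" where
  "C_k k f \<longleftrightarrow> times_differentiable k f \<and> continuous_on UNIV ((deriv ^^ k) f)"

text \<open>For \<open>\<eta> = x\<close> the integrand below evaluates to \<open>0\<close>; this concerns a null set only.\<close>

definition riesz_integrand :: "real \<Rightarrow> (real \<Rightarrow> real) \<Rightarrow> real \<Rightarrow> real \<Rightarrow> real" where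
  "riesz_integrand \<alpha> f x \<eta> = f \<eta> / \<bar>x - \<eta>\<bar> powr (\<alpha> - 1)"

definition riesz_integral :: "real \<Rightarrow> (real \<Rightarrow> real) \<Rightarrow> real \<Rightarrow> real" where
  "riesz_integral \<alpha> f x = integral\<^sup>L lborel (riesz_integrand \<alpha> f x)"

definition kappa :: "real \<Rightarrow> real" where
  "kappa \<alpha> = 1 / 2 * (1 / cos (pi * \<alpha> / 2))"

text \<open>The Riesz derivative of order \<open>\<alpha> \<in> (1,2)\<close>. As \<^const>\<open>deriv\<close> and the Lebesgue integral are
  total, the predicate \<open>riesz_derivative_exists\<close> records that the integrals converge and that the
  second derivative exists at every point.\<close>

definition riesz_derivative :: "real \<Rightarrow> (real \<Rightarrow> real) \<Rightarrow> real \<Rightarrow> real" where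
  "riesz_derivative \<alpha> f x =
     - (kappa \<alpha> / Gamma (2 - \<alpha>)) * (deriv ^^ 2) (riesz_integral \<alpha> f) x"

definition riesz_derivative_exists :: "real \<Rightarrow> (real \<Rightarrow> real) \<Rightarrow> bool" where
  "riesz_derivative_exists \<alpha> f \<longleftrightarrow>
     (\<forall>x. integrable lborel (riesz_integrand \<alpha> f x)) \<and>
     times_differentiable 2 (riesz_integral \<alpha> f)"

definition frac_coeff :: "real \<Rightarrow> int \<Rightarrow> real" where
  "frac_coeff \<alpha> k = (-1) powi k * Gamma (\<alpha> + 1) /
     (Gamma (\<alpha> / 2 - of_int k + 1) * Gamma (\<alpha> / 2 + of_int k + 1))"

definition frac_diff_summable :: "real \<Rightarrow> real \<Rightarrow> (real \<Rightarrow> real) \<Rightarrow> real \<Rightarrow> bool" where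
  "frac_diff_summable \<alpha> h f x \<longleftrightarrow> (\<lambda>k::int. frac_coeff \<alpha> k * f (x - of_int k * h)) summable_on UNIV"

definition frac_diff :: "real \<Rightarrow> real \<Rightarrow> (real \<Rightarrow> real) \<Rightarrow> real \<Rightarrow> real" where
  "frac_diff \<alpha> h f x = (\<Sum>\<^sub>\<infinity>k::int. frac_coeff \<alpha> k * f (x - of_int k * h))"

text \<open>\<open>central_diff h l\<close> is the central difference operator of order \<open>2 * l\<close> with step \<open>h\<close>.\<close>

definition central_diff :: "real \<Rightarrow> nat \<Rightarrow> (real \<Rightarrow> real) \<Rightarrow> real \<Rightarrow> real" where
  "central_diff h l f x =
     (\<Sum>s=0..2*l. (-1) ^ s * real ((2 * l) choose s) * f (x + (real l - real s) * h))"

definition bounded_functions :: "(real \<Rightarrow> real) set" where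
  "bounded_functions = {f. bounded (range f)}"

text \<open>\<open>lhs_op h n c\<close> is \<open>\<delta>\<^sup>0 - c \<delta>\<^sup>2\<^sup>n\<^sup>-\<^sup>2\<close>, and \<open>rhs_op h n b\<close> is the sum of \<open>b l \<delta>\<^sup>2\<^sup>l\<close> over
  \<open>0 \<le> l \<le> n - 2\<close>, which is empty for \<open>n = 1\<close>.\<close>

definition lhs_op :: "real \<Rightarrow> nat \<Rightarrow> real \<Rightarrow> (real \<Rightarrow> real) \<Rightarrow> real \<Rightarrow> real" where
  "lhs_op h n c f x = central_diff h 0 f x - c * central_diff h (n - 1) f x"

definition rhs_op :: "real \<Rightarrow> nat \<Rightarrow> (nat \<Rightarrow> real) \<Rightarrow> (real \<Rightarrow> real) \<Rightarrow> real \<Rightarrow> real" where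
  "rhs_op h n b f x = (\<Sum>l<n-1. b l * central_diff h l f x)"

text \<open>The inverse on bounded functions; meaningful when the operator is a bijection of
  \<^const>\<open>bounded_functions\<close> onto itself.\<close>

definition bounded_inverse :: "((real \<Rightarrow> real) \<Rightarrow> real \<Rightarrow> real) \<Rightarrow> (real \<Rightarrow> real) \<Rightarrow> real \<Rightarrow> real" where
  "bounded_inverse L = inv_into bounded_functions L"

definition basic_approx :: "real \<Rightarrow> real \<Rightarrow> (real \<Rightarrow> real) \<Rightarrow> real \<Rightarrow> real" where
  "basic_approx \<alpha> h f x = - (frac_diff \<alpha> h f x / h powr \<alpha>)"

definition riesz_approx ::
    "real \<Rightarrow> nat \<Rightarrow> (nat \<Rightarrow> real) \<Rightarrow> real \<Rightarrow> (real \<Rightarrow> real) \<Rightarrow> real \<Rightarrow> real" where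
  "riesz_approx \<alpha> n b h f =
     (if n = 1 then basic_approx \<alpha> h f
      else bounded_inverse (lhs_op h n (b (n - 1))) (rhs_op h n b (basic_approx \<alpha> h f)))"

definition is_sinc_powr_expansion :: "real \<Rightarrow> (nat \<Rightarrow> real) \<Rightarrow> bool" where
  "is_sinc_powr_expansion \<alpha> a \<longleftrightarrow>
     (\<forall>\<^sub>F \<theta> in at 0. (\<lambda>p. a p * \<theta> ^ (2 * p)) sums (\<bar>2 * sin (\<theta> / 2) / \<theta>\<bar> powr \<alpha>))"

definition coefficient_identity :: "nat \<Rightarrow> (nat \<Rightarrow> real) \<Rightarrow> (nat \<Rightarrow> real) \<Rightarrow> real \<Rightarrow> bool" where
  "coefficient_identity n a b \<theta> \<longleftrightarrow>
     (\<Sum>l=0..n-2. b l *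
        (2 * (\<Sum>s<l. \<Sum>q=0..n-1. \<Sum>p=0..n-1-q.
               (-1) ^ (s + q) * (real l - real s) ^ (2 * q) * real ((2 * l) choose s) * a p
                 / fact (2 * q) * \<theta> ^ (2 * (p + q)))
         + (-1) ^ l * real ((2 * l) choose l) * (\<Sum>p=0..n-1. a p * \<theta> ^ (2 * p))))
     = 1 - b (n - 1) *
         (\<Sum>s=0..n-2. (-1) ^ s * real ((2 * n - 2) choose s) *
            (2 * (real n - 1 - real s) ^ (2 * n - 2) / fact (2 * n - 2)))
         * (-1) ^ (n - 1) * \<theta> ^ (2 * n - 2)"

end

theory Submission
  imports Defs "HOL-Probability.Probability"
begin

text \<open>
  On \<open>cis (w x)\<close> the Riesz derivative acts as \<open>- \<bar>w\<bar> powr \<alpha>\<close>, the operator \<open>frac_diff\<close> as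
  \<open>\<bar>2 sin (\<theta>/2)\<bar> powr \<alpha>\<close> with \<open>\<theta> = w h\<close>, and \<open>\<delta>\<^sup>2\<^sup>l\<close> as \<open>(- 4 sin\<^sup>2 (\<theta>/2))\<^sup>l\<close>. The coefficient identity makes
  the symbols of the two sides of the scheme agree up to \<open>h\<^sup>2\<^sup>n \<bar>w\<bar> powr (\<alpha> + 2n)\<close>, which is integrable
  against the Fourier transform of \<open>u\<close> since that decays like \<open>\<bar>w\<bar>\<close> to the power \<open>- (2n + 3)\<close> and \<open>\<alpha> < 2\<close>.

  The implicit operator is invertible because the identity forces \<open>b\<^sub>l (- 4)\<^sup>l\<close> to be the coefficient of
  \<open>z\<^sup>l\<close> in \<open>(arcsin (sqrt z) / sqrt z) powr \<alpha>\<close>. These coefficients have modulus below 1 for \<open>l \<ge> 1\<close>, and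
  \<open>\<delta>\<^sup>2\<^sup>n\<^sup>-\<^sup>2\<close> has sup-norm \<open>4\<^sup>n\<^sup>-\<^sup>1\<close>, so \<open>b\<^sub>n\<^sub>-\<^sub>1 \<delta>\<^sup>2\<^sup>n\<^sup>-\<^sup>2\<close> is a contraction, uniformly in \<open>h\<close>.
\<close>

section \<open>Coefficients of powers of arcsin\<close>

text \<open>The arcsine comes from a change of variable. With z = sin^2 (\<theta>/2), the quotient
  (\<theta>/2) / sin (\<theta>/2) is arcsin (sqrt z) / sqrt z, so the \<alpha>-th power of the
  latter is the reciprocal of the function that defines \<open>a\<close>, and -4 z is the symbol of
  the second difference. The \<open>b l\<close> are thus the first Taylor coefficients of this
  reciprocal in -4 z. The bound below 1 has to hold for all n and \<alpha> at once. Real powers are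
  therefore accessed through F G' = \<alpha> F' G, which becomes a recurrence for the coefficients.
  A first-order linear equation also yields the symbol of \<open>frac_diff\<close>, up to a
  constant. The identity matches powers of \<theta> only up to 2n - 2, yet the order is 2n: all
  series are even, and letting the term l = n - 1 act on the exact derivative instead of the
  approximation costs only \<theta>^(2n-2) times \<theta>^2. The Riesz kernel is not integrable on
  the line, so its transform is no convergent integral; Gaussian damping supplies the absolute
  convergence that the exchange of integrals requires.\<close>

lemma fps_X_mult_deriv_nth:
  "fps_nth (fps_X * fps_deriv F) k = of_nat k * fps_nth F k" for F :: "'a :: comm_ring_1 fps"
  by (cases k) simp_all

text \<open>Comparing coefficients in F G' = \<alpha> F' G, the equation of G = F^\<alpha>, gives
  the classical recurrence for powers of a series. Multiplying by X first removes all index shifts,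
  since X d/dX scales coefficient k by k; F(0) = 1 isolates the term j = 0. The recurrence serves
  both the arcsine power and the first coefficients \<open>a p\<close>.\<close>

lemma fps_power_ODE_recurrence:
  fixes F G :: "real fps"
  assumes ode: "F * fps_deriv G = fps_const \<alpha> * fps_deriv F * G"
    and F0: "fps_nth F 0 = 1"
  shows "real k * fps_nth G k
    = (\<Sum>j=1..k. (\<alpha> * real j - real (k - j)) * fps_nth F j * fps_nth G (k - j))"
proof (cases k)
  case (Suc m)
  have "fps_nth (fps_X * (F * fps_deriv G)) k
      = fps_nth (fps_X * (fps_const \<alpha> * fps_deriv F * G)) k"
    by (simp only: ode)
  moreover have "fps_nth (fps_X * (F * fps_deriv G)) k
      = (\<Sum>j=0..k. fps_nth F j * (real (k - j) * fps_nth G (k - j)))"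
  proof -
    have "fps_X * (F * fps_deriv G) = F * (fps_X * fps_deriv G)"
      by (simp add: mult_ac)
    then show ?thesis
      by (simp only: fps_mult_nth[of F] fps_X_mult_deriv_nth)
  qed
  moreover have "fps_nth (fps_X * (fps_const \<alpha> * fps_deriv F * G)) k
      = (\<Sum>j=0..k. (\<alpha> * (real j * fps_nth F j)) * fps_nth G (k - j))"
  proof -
    have "fps_X * (fps_const \<alpha> * fps_deriv F * G) = (fps_const \<alpha> * (fps_X * fps_deriv F)) * G"
      by (simp add: mult_ac)
    then show ?thesis
      by (simp only: fps_mult_nth[of _ G] fps_mult_left_const_nth fps_X_mult_deriv_nth)
  qed
  ultimately have "(\<Sum>j=0..k. fps_nth F j * (real (k - j) * fps_nth G (k - j)))
      = (\<Sum>j=0..k. (\<alpha> * (real j * fps_nth F j)) * fps_nth G (k - j))"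
    by simp
  then have "real k * fps_nth G k + (\<Sum>j=1..k. fps_nth F j * (real (k - j) * fps_nth G (k - j)))
      = (\<Sum>j=1..k. (\<alpha> * (real j * fps_nth F j)) * fps_nth G (k - j))"
    by (simp add: sum.atLeast_Suc_atMost F0)
  moreover have "(\<Sum>j=1..k. (\<alpha> * real j - real (k - j)) * fps_nth F j * fps_nth G (k - j))
      = (\<Sum>j=1..k. (\<alpha> * (real j * fps_nth F j)) * fps_nth G (k - j))
        - (\<Sum>j=1..k. fps_nth F j * (real (k - j) * fps_nth G (k - j)))"
    unfolding sum_subtractf[symmetric] by (intro sum.cong refl) (simp add: algebra_simps)
  ultimately show ?thesis
    by linarith
qed simp

text \<open>The Taylor coefficients of (1 - z)^(-1/2), that is, (2k choose k) / 4^k.\<close>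

definition sqrt_coeff :: "nat \<Rightarrow> real" where
  "sqrt_coeff k = (\<Prod>i<k. (2 * real i + 1) / (2 * real i + 2))"

text \<open>The series of arcsin (sqrt z) / sqrt z.\<close>

definition arcsin_fps :: "real fps" where
  "arcsin_fps = Abs_fps (\<lambda>k. sqrt_coeff k / (2 * real k + 1))"

lemma sqrt_coeff_0 [simp]: "sqrt_coeff 0 = 1"
  by (simp add: sqrt_coeff_def)

lemma sqrt_coeff_Suc:
  "sqrt_coeff (Suc k) = sqrt_coeff k * ((2 * real k + 1) / (2 * real k + 2))"
  by (simp add: sqrt_coeff_def)

lemma sqrt_coeff_pos: "sqrt_coeff k > 0"
  unfolding sqrt_coeff_def by (intro prod_pos) auto

lemma arcsin_fps_nth: "fps_nth arcsin_fps k = sqrt_coeff k / (2 * real k + 1)"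
  by (simp add: arcsin_fps_def)

lemma arcsin_fps_0 [simp]: "fps_nth arcsin_fps 0 = 1"
  by (simp add: arcsin_fps_nth)

text \<open>The equation 2 (1 - z) W' = W makes the derivative of W^2 (1 - z) vanish, and the
  constant term is 1.\<close>

lemma fps_sqrt_coeff_square: "(Abs_fps sqrt_coeff)\<^sup>2 * (1 - fps_X) = 1"
proof -
  define W where "W = Abs_fps sqrt_coeff"
  have ode: "2 * (1 - fps_X) * fps_deriv W = W"
  proof (rule fps_ext)
    fix k
    have "2 * (1 - fps_X) * fps_deriv W = fps_const 2 * (fps_deriv W - fps_X * fps_deriv W)"
      by (simp add: algebra_simps numeral_fps_const)
    then have "fps_nth (2 * (1 - fps_X) * fps_deriv W) k
        = 2 * (fps_nth (fps_deriv W) k - fps_nth (fps_X * fps_deriv W) k)"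
      by (simp only: fps_mult_left_const_nth fps_sub_nth)
    also have "\<dots> = 2 * (real (Suc k) * sqrt_coeff (Suc k) - real k * sqrt_coeff k)"
      by (simp add: fps_X_mult_deriv_nth W_def)
    also have "real (Suc k) * sqrt_coeff (Suc k) = (real k + 1/2) * sqrt_coeff k"
      by (simp add: sqrt_coeff_Suc divide_simps) (simp add: algebra_simps)
    also have "2 * ((real k + 1/2) * sqrt_coeff k - real k * sqrt_coeff k) = sqrt_coeff k"
      by (simp add: algebra_simps)
    finally show "fps_nth (2 * (1 - fps_X) * fps_deriv W) k = fps_nth W k"
      by (simp add: W_def)
  qed
  have "fps_deriv (W\<^sup>2 * (1 - fps_X)) = W * (2 * (1 - fps_X) * fps_deriv W) - W\<^sup>2"
    by (simp add: power2_eq_square algebra_simps)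
  also have "\<dots> = 0"
    unfolding ode by (simp add: power2_eq_square)
  finally have "W\<^sup>2 * (1 - fps_X) = fps_const (fps_nth (W\<^sup>2 * (1 - fps_X)) 0)"
    by (simp only: fps_deriv_eq_0_iff)
  then show ?thesis
    by (simp add: W_def power2_eq_square)
qed

text \<open>The formal version of arcsin (sin (x/2)) = x/2, proved by differentiation. For the
  arcsine series F, F + 2 z F' is the series W of (1 - z)^(-1/2), so F(s^2) s has derivative s'
  W(s^2) with s' = c/2, and it remains to see that c W(s^2) = 1.\<close>

lemma arcsin_fps_compose_sin:
  "(arcsin_fps oo (fps_sin (1/2))\<^sup>2) * fps_sin (1/2) = fps_const (1/2) * fps_X"
proof -
  define s :: "real fps" where "s = fps_sin (1/2)"
  define c :: "real fps" where "c = fps_cos (1/2)"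
  define W where "W = Abs_fps sqrt_coeff"
  have s': "fps_deriv s = fps_const (1/2) * c"
    by (simp add: s_def c_def fps_sin_deriv)
  have s0: "fps_nth (s\<^sup>2) 0 = 0"
    by (simp add: s_def)
  have W: "W = arcsin_fps + 2 * fps_X * fps_deriv arcsin_fps"
  proof (rule fps_ext)
    fix k
    have "fps_nth (arcsin_fps + 2 * fps_X * fps_deriv arcsin_fps) k
        = fps_nth arcsin_fps k + 2 * (real k * fps_nth arcsin_fps k)"
      unfolding fps_X_mult_deriv_nth[symmetric] by (simp add: mult.assoc)
    also have "\<dots> = (1 + 2 * real k) * fps_nth arcsin_fps k"
      by (simp add: algebra_simps)
    also have "\<dots> = sqrt_coeff k"
      by (simp add: arcsin_fps_nth add.commute)
    finally show "fps_nth W k = fps_nth (arcsin_fps + 2 * fps_X * fps_deriv arcsin_fps) k"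
      by (simp add: W_def)
  qed
  have "(c * (W oo s\<^sup>2))\<^sup>2 = (W\<^sup>2 * (1 - fps_X)) oo s\<^sup>2"
  proof -
    have "c\<^sup>2 = 1 - s\<^sup>2"
      using fps_sin_cos_sum_of_squares[of "1/2::real"] by (simp add: s_def c_def algebra_simps)
    then show ?thesis
      using s0 by (simp add: fps_compose_mult_distrib fps_compose_power fps_compose_sub_distrib
          power_mult_distrib mult.commute)
  qed
  then have "(c * (W oo s\<^sup>2))\<^sup>2 = 1"
    by (simp add: fps_sqrt_coeff_square W_def)
  \<comment> \<open>In an integral domain 1 has only the square roots 1 and -1; the constant term
    selects the sign.\<close>
  then have "c * (W oo s\<^sup>2) = 1 \<or> c * (W oo s\<^sup>2) = - 1"
    by (simp add: power2_eq_1_iff)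
  moreover have "fps_nth (c * (W oo s\<^sup>2)) 0 = 1"
    by (simp add: c_def W_def)
  ultimately have cW: "c * (W oo s\<^sup>2) = 1"
    by force
  have "fps_deriv ((arcsin_fps oo s\<^sup>2) * s)
      = ((fps_deriv arcsin_fps oo s\<^sup>2) * fps_deriv (s\<^sup>2)) * s + (arcsin_fps oo s\<^sup>2) * fps_deriv s"
    using s0 by (simp add: fps_compose_deriv algebra_simps)
  also have "\<dots> = fps_const (1/2) * (c * (W oo s\<^sup>2))"
    using s0 by (simp add: W fps_compose_add_distrib fps_compose_mult_distrib s' power2_eq_square
        algebra_simps)
  also have "\<dots> = fps_deriv (fps_const (1/2) * fps_X)"
    by (simp add: cW)
  finally have "(arcsin_fps oo s\<^sup>2) * s
      = fps_const (fps_nth ((arcsin_fps oo s\<^sup>2) * s) 0 - fps_nth (fps_const (1/2) * fps_X) 0)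
        + fps_const (1/2) * fps_X"
    by (simp only: fps_deriv_eq_iff)
  then show ?thesis
    by (simp add: s_def)
qed

text \<open>A real power as the binomial series at F - 1, whose constant term is 0, as substitution
  requires.\<close>

definition arcsin_powr_fps :: "real \<Rightarrow> real fps" where
  "arcsin_powr_fps \<alpha> = fps_binomial \<alpha> oo (arcsin_fps - 1)"

lemma arcsin_powr_fps_0 [simp]: "fps_nth (arcsin_powr_fps \<alpha>) 0 = 1"
  by (simp add: arcsin_powr_fps_def)

lemma arcsin_powr_fps_ODE:
  "arcsin_fps * fps_deriv (arcsin_powr_fps \<alpha>)
    = fps_const \<alpha> * fps_deriv arcsin_fps * arcsin_powr_fps \<alpha>"
proof -
  define B :: "real fps" where "B = fps_binomial \<alpha>"
  have z: "fps_nth (arcsin_fps - 1) 0 = 0"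
    by simp
  have "(1 + fps_X) * fps_deriv B = fps_const \<alpha> * B"
  proof -
    have "(1 + fps_X) * fps_deriv B = fps_const \<alpha> * B * (inverse (1 + fps_X) * (1 + fps_X))"
      by (simp add: B_def fps_binomial_deriv fps_divide_unit mult_ac)
    also have "inverse (1 + fps_X) * (1 + fps_X :: real fps) = 1"
      by (intro inverse_mult_eq_1) simp
    finally show ?thesis by simp
  qed
  then have "((1 + fps_X) * fps_deriv B) oo (arcsin_fps - 1) = (fps_const \<alpha> * B) oo (arcsin_fps - 1)"
    by simp
  then have "arcsin_fps * (fps_deriv B oo (arcsin_fps - 1)) = fps_const \<alpha> * (B oo (arcsin_fps - 1))"
    using z by (simp add: fps_compose_mult_distrib fps_compose_add_distrib)
  then show ?thesis
    using z by (simp add: arcsin_powr_fps_def B_def[symmetric] fps_compose_deriv algebra_simps)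
qed

section \<open>Size of the coefficients of the arcsine power\<close>

lemma arcsin_fps_nonneg: "fps_nth arcsin_fps k \<ge> 0"
  by (simp add: arcsin_fps_nth sqrt_coeff_pos less_imp_le)

text \<open>A telescoping sum: coefficient k + 1 is at most
  \<open>sqrt_coeff k - sqrt_coeff (Suc k)\<close>, which equals \<open>sqrt_coeff k\<close> / (2k +
  2). The constant 3/8 is \<open>sqrt_coeff 2\<close>, where the telescope starts.\<close>

lemma arcsin_fps_tail_bound:
  "(\<Sum>j=3..k. fps_nth arcsin_fps j) \<le> 3/8"
proof -
  have "(\<Sum>j=3..k. fps_nth arcsin_fps j) \<le> 3/8 - sqrt_coeff k" if "k \<ge> 2" for k
    using that
  proof (induction k rule: dec_induct)
    case base
    then show ?case
      by (simp add: eval_nat_numeral sqrt_coeff_Suc)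
  next
    case (step k)
    have "fps_nth arcsin_fps (Suc k) \<le> sqrt_coeff k - sqrt_coeff (Suc k)"
    proof -
      have "(2 * real k + 1) / (2 * real k + 2) / (2 * real (Suc k) + 1)
          \<le> 1 - (2 * real k + 1) / (2 * real k + 2)"
        by (simp add: divide_simps)
      from mult_left_mono[OF this, of "sqrt_coeff k"] show ?thesis
        using sqrt_coeff_pos[of k] by (simp add: arcsin_fps_nth sqrt_coeff_Suc algebra_simps)
    qed
    then show ?case
      using step by simp
  qed
  from this[of k] show ?thesis
    using sqrt_coeff_pos[of k] by (cases "k \<ge> 2") auto
qed

text \<open>Strong induction along the recurrence. Bounding every weight |\<alpha> j - (k - j)| by
  2k is too crude: the coefficients of positive index sum to pi/2 - 1, and pi - 2 exceeds 1. The two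
  largest coefficients, 1/6 and 3/40 at j = 1, 2, therefore get the sharper weight k, which is valid
  from k = 3 on; k = 1 and k = 2 are computed directly.\<close>

lemma arcsin_powr_fps_nth_abs_less:
  assumes "1 < \<alpha>" "\<alpha> < 2" "k \<ge> 1"
  shows "\<bar>fps_nth (arcsin_powr_fps \<alpha>) k\<bar> < 1"
proof -
  let ?w = "\<lambda>j k. if j \<le> 2 then real k else 2 * real k"
  define f g where "f = fps_nth arcsin_fps" and "g = fps_nth (arcsin_powr_fps \<alpha>)"
  have rec: "real k * g k = (\<Sum>j=1..k. (\<alpha> * real j - real (k - j)) * f j * g (k - j))" for k
    unfolding f_def g_def by (rule fps_power_ODE_recurrence[OF arcsin_powr_fps_ODE]) simp
  have f0: "f j \<ge> 0" for j
    by (simp add: f_def arcsin_fps_nonneg)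
  have f1: "f (Suc 0) = 1/6"
    by (simp add: f_def arcsin_fps_nth sqrt_coeff_Suc)
  have f2: "f 2 = 3/40"
    by (simp add: f_def arcsin_fps_nth sqrt_coeff_Suc eval_nat_numeral)
  have g0: "g 0 = 1"
    by (simp add: g_def)
  have g1: "g (Suc 0) = \<alpha> / 6"
    using rec[of 1] by (simp add: f1 g0)
  have g2: "\<bar>g 2\<bar> < 1"
  proof -
    have "2 * g 2 = (\<alpha> - 1) * f 1 * g 1 + 2 * \<alpha> * f 2 * g 0"
      using rec[of 2] by (simp add: eval_nat_numeral)
    then have "g 2 = (\<alpha> - 1) * \<alpha> / 72 + 3 * \<alpha> / 40"
      by (simp add: f1 f2 g1 g0)
    moreover have "0 \<le> (\<alpha> - 1) * \<alpha>" "(\<alpha> - 1) * \<alpha> \<le> 1 * 2"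
      using assms mult_mono[of "\<alpha> - 1" 1 \<alpha> 2] by auto
    ultimately show ?thesis
      using assms by simp
  qed
  \<comment> \<open>The non-strict half covers \<open>g 0 = 1\<close>, which enters the recurrence
    at j = k.\<close>
  have "\<bar>g k\<bar> \<le> 1 \<and> (k \<ge> 1 \<longrightarrow> \<bar>g k\<bar> < 1)" for k
  proof (induction k rule: less_induct)
    case (less k)
    consider "k = 0" | "k = 1" | "k = 2" | "k \<ge> 3"
      by linarith
    then show ?case
    proof cases
      case 1
      then show ?thesis by (simp add: g0)
    next
      case 2
      then show ?thesis using assms by (simp add: g1)
    next
      case 3
      then show ?thesis using g2 by simp
    next
      case 4
      have wt: "\<bar>\<alpha> * real j - real (k - j)\<bar> \<le> ?w j k"
        if "j \<in> {1..k}" for j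
      proof -
        have jk: "1 \<le> real j" "real j \<le> real k" "real (k - j) = real k - real j"
          using that by auto
        have "\<alpha> * real j \<le> 2 * real j" "\<alpha> * real j \<ge> 0"
          using assms jk by (auto intro!: mult_right_mono)
        moreover have "real k \<ge> 3"
          using 4 by simp
        ultimately have "- real k \<le> \<alpha> * real j - real (k - j)"
            "\<alpha> * real j - real (k - j) \<le> 2 * real k"
            "j \<le> 2 \<Longrightarrow> \<alpha> * real j - real (k - j) \<le> real k"
          using jk by linarith+
        then show ?thesis
          using jk by (intro abs_leI) (simp_all del: of_nat_diff, linarith?)
      qed
      have "real k * \<bar>g k\<bar> = \<bar>real k * g k\<bar>"
        by (simp add: abs_mult)
      also have "\<dots> = \<bar>\<Sum>j=1..k. (\<alpha> * real j - real (k - j)) * f j * g (k - j)\<bar>"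
        by (simp only: rec)
      also have "\<dots> \<le> (\<Sum>j=1..k. ?w j k * f j)"
      proof (intro order_trans[OF sum_abs] sum_mono)
        fix j assume j: "j \<in> {1..k}"
        have "\<bar>g (k - j)\<bar> \<le> 1"
          using less.IH[of "k - j"] j by auto
        then have "\<bar>\<alpha> * real j - real (k - j)\<bar> * f j * \<bar>g (k - j)\<bar>
            \<le> ?w j k * f j * 1"
          using f0 wt[OF j] by (intro mult_mono) auto
        then show "\<bar>(\<alpha> * real j - real (k - j)) * f j * g (k - j)\<bar>
            \<le> ?w j k * f j"
          using f0[of j] by (simp add: abs_mult)
      qed
      also have "\<dots> = real k * (f 1 + f 2 + 2 * (\<Sum>j=3..k. f j))"
      proof -
        have "{1..k} = {1, 2} \<union> {3..k}"
          using 4 by auto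
        then have "(\<Sum>j=1..k. ?w j k * f j)
            = (\<Sum>j\<in>{1,2}. ?w j k * f j)
              + (\<Sum>j=3..k. ?w j k * f j)"
          by (simp only:) (rule sum.union_disjoint, auto)
        also have "(\<Sum>j=3..k. ?w j k * f j)
            = (\<Sum>j=3..k. 2 * real k * f j)"
          by (intro sum.cong) auto
        finally show ?thesis
          by (simp add: sum_distrib_left algebra_simps)
      qed
      \<comment> \<open>1/6 + 3/40 + 2 * (3/8) = 119/120.\<close>
      also have "\<dots> < real k * 1"
        using arcsin_fps_tail_bound[of k] 4 f1 f2
        by (intro mult_strict_left_mono) (auto simp: f_def)
      finally have "\<bar>g k\<bar> < 1"
        using 4 by simp
      then show ?thesis by simp
    qed
  qed
  then show ?thesis
    using assms(3) by (simp add: g_def)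
qed

text \<open>Both factors solve \<open>F G' = \<alpha> F' G\<close>, with mutually inverse \<open>F\<close>.\<close>

lemma sinc_powr_fps_inverse:
  fixes A S :: "real fps"
  assumes S: "S * fps_X = fps_const 2 * fps_sin (1/2)"
    and ode: "S * fps_deriv A = fps_const \<alpha> * fps_deriv S * A"
    and A0: "fps_nth A 0 = 1"
  shows "A * (arcsin_powr_fps \<alpha> oo (fps_sin (1/2))\<^sup>2) = 1"
proof -
  define Y :: "real fps" where "Y = (fps_sin (1/2))\<^sup>2"
  define H W where "H = arcsin_powr_fps \<alpha> oo Y" and "W = arcsin_fps oo Y"
  have Y0: "fps_nth Y 0 = 0"
    by (simp add: Y_def)
  have half: "fps_const (1/2) * (fps_const 2 * y) = y" for y :: "real fps"
    by (simp add: mult.assoc[symmetric] fps_const_mult)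
  have "(W * S) * fps_X = fps_X * 1"
  proof -
    have "(W * S) * fps_X = W * (fps_const 2 * fps_sin (1/2))"
      using S by (simp add: mult.assoc)
    also have "\<dots> = fps_const 2 * (W * fps_sin (1/2))"
      by (simp add: mult_ac)
    also have "W * fps_sin (1/2) = fps_const (1/2) * fps_X"
      unfolding W_def Y_def by (rule arcsin_fps_compose_sin)
    finally show ?thesis
      by (simp add: mult.assoc[symmetric] fps_const_mult)
  qed
  then have WS: "W * S = 1"
    by (metis fps_X_neq_zero mult.commute mult_right_cancel)
  have dWS: "fps_deriv W * S + W * fps_deriv S = 0"
    using arg_cong[OF WS, of fps_deriv] by (simp add: algebra_simps)
  have WH: "W * fps_deriv H = fps_const \<alpha> * fps_deriv W * H"
  proof -
    have "(arcsin_fps * fps_deriv (arcsin_powr_fps \<alpha>)) oo Y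
        = (fps_const \<alpha> * fps_deriv arcsin_fps * arcsin_powr_fps \<alpha>) oo Y"
      by (simp add: arcsin_powr_fps_ODE)
    then show ?thesis
      using Y0 by (simp add: H_def W_def fps_compose_deriv fps_compose_mult_distrib algebra_simps)
  qed
  have "fps_deriv (A * H) = (W * S) * fps_deriv (A * H)"
    by (simp add: WS)
  also have "\<dots> = W * H * (S * fps_deriv A) + S * A * (W * fps_deriv H)"
    by (simp add: algebra_simps)
  also have "\<dots> = fps_const \<alpha> * A * H * (fps_deriv W * S + W * fps_deriv S)"
    by (simp add: ode WH algebra_simps)
  also have "\<dots> = 0"
    by (simp add: dWS)
  finally have "A * H = fps_const (fps_nth (A * H) 0)"
    by (simp only: fps_deriv_eq_0_iff)
  then show ?thesis
    by (simp add: H_def Y_def A0)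
qed

text \<open>Let B be the polynomial with coefficients \<open>\<beta>\<close>. Multiplication by
  G(Y), the inverse of A, shows that (B - G)(Y) vanishes below degree 2n. Since Y has order 2, a
  lowest term of B - G in degree d reappears in degree 2d, so d is at least n.\<close>

lemma fps_compose_coeff_unique:
  fixes A Y G :: "real fps" and \<beta> :: "nat \<Rightarrow> real"
  assumes Y0: "subdegree Y = 2"
    and inv: "A * (G oo Y) = 1"
    and id: "\<And>m. m < 2 * n \<Longrightarrow> fps_nth ((\<Sum>l<n. fps_const (\<beta> l) * Y ^ l) * A) m = (if m = 0 then 1 else 0)"
    and l: "l < n"
  shows "\<beta> l = fps_nth G l"
proof -
  define B where "B = Abs_fps (\<lambda>l. if l < n then \<beta> l else 0)"
  have Bpoly: "B = (\<Sum>l<n. fps_const (\<beta> l) * fps_X ^ l)"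
  proof (rule fps_ext)
    fix k
    have "(\<Sum>l<n. fps_nth (fps_const (\<beta> l) * fps_X ^ l) k) = (\<Sum>l<n. if l = k then \<beta> l else 0)"
      by (intro sum.cong) auto
    then show "fps_nth B k = fps_nth (\<Sum>l<n. fps_const (\<beta> l) * fps_X ^ l) k"
      by (simp add: B_def fps_sum_nth)
  qed
  have Y00: "fps_nth Y 0 = 0"
    using Y0 by (intro nth_less_subdegree_zero) simp
  have BY: "B oo Y = (\<Sum>l<n. fps_const (\<beta> l) * Y ^ l)"
    unfolding Bpoly fps_compose_sum_distrib
    by (intro sum.cong refl)
      (simp only: fps_compose_mult_distrib[OF Y00] fps_const_compose fps_X_power_compose[OF Y00])
  define D where "D = B - G"
  have van: "fps_nth ((D oo Y) * A) m = 0" if "m < 2 * n" for m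
  proof -
    have "(D oo Y) * A = (B oo Y) * A - 1"
      using inv by (simp add: D_def fps_compose_sub_distrib algebra_simps)
    then show ?thesis
      using id[OF that] by (simp add: BY)
  qed
  have DY: "fps_nth (D oo Y) m = 0" if "m < 2 * n" for m
  proof -
    have "fps_nth (((D oo Y) * A) * (G oo Y)) m = 0"
      unfolding fps_mult_nth[of "(D oo Y) * A"] using van that by (intro sum.neutral) auto
    then show ?thesis
      using inv by (simp add: mult.assoc)
  qed
  have "fps_nth D l = 0"
  proof (cases "D = 0")
    case False
    have "subdegree (D oo Y) = subdegree D * subdegree Y"
      using Y00 by simp
    moreover have "D oo Y \<noteq> 0"
      using False Y00 Y0 by (auto simp: fps_compose_eq_0_iff)
    ultimately have "fps_nth (D oo Y) (2 * subdegree D) \<noteq> 0"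
      using Y0 nth_subdegree_nonzero[of "D oo Y"] by (simp add: mult.commute)
    then have "subdegree D \<ge> n"
      using DY[of "2 * subdegree D"] by (cases "subdegree D < n") auto
    then show ?thesis
      using l by (intro nth_less_subdegree_zero) simp
  qed simp
  then show ?thesis
    using l by (simp add: D_def B_def)
qed

section \<open>The coefficient identity\<close>

text \<open>Splitting off x^k leaves a continuous factor with known value at 0. Boundedness of that
  factor gives the order estimate; its value gives uniqueness from agreement on a punctured
  neighbourhood alone.\<close>

lemma has_fps_expansion_vanishing:
  fixes f :: "real \<Rightarrow> real"
  assumes f: "f has_fps_expansion F" and zero: "\<And>m. m < k \<Longrightarrow> fps_nth F m = 0"
  shows "\<exists>g. isCont g 0 \<and> g 0 = fps_nth F k \<and> eventually (\<lambda>x. f x = x ^ k * g x) (nhds 0)"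
proof -
  define G where "G = fps_shift k F"
  have r: "fps_conv_radius G > 0"
    using f by (simp add: G_def has_fps_expansion_def)
  have F: "F = fps_X ^ k * G"
    by (rule fps_ext) (simp add: G_def fps_X_power_mult_nth zero)
  have "eval_fps G has_fps_expansion G"
    using r by (rule eval_fps_has_fps_expansion)
  then have "(\<lambda>x. x ^ k * eval_fps G x) has_fps_expansion F"
    unfolding F by (intro has_fps_expansion_mult has_fps_expansion_fps_X_power)
  then have "eventually (\<lambda>x. f x = x ^ k * eval_fps G x) (nhds 0)"
    using f unfolding has_fps_expansion_def by (auto elim: eventually_elim2)
  moreover have "isCont (eval_fps G) 0"
    using r by (intro continuous_eval_fps) (simp add: zero_ereal_def)
  ultimately show ?thesis
    by (intro exI[of _ "eval_fps G"]) (simp add: eval_fps_at_0 G_def)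
qed

lemma has_fps_expansion_bigo:
  fixes f :: "real \<Rightarrow> real"
  assumes "f has_fps_expansion F" and "\<And>m. m < k \<Longrightarrow> fps_nth F m = 0"
  shows "f \<in> O[at 0](\<lambda>x. x ^ k)"
proof -
  obtain g where g: "isCont g 0" "eventually (\<lambda>x. f x = x ^ k * g x) (nhds 0)"
    using has_fps_expansion_vanishing[OF assms] by blast
  have "g \<in> O[at 0](\<lambda>_. 1)"
    using g(1) by (intro bigoI_tendsto[of _ _ "g 0"]) (auto simp: isCont_def)
  then have "(\<lambda>x. x ^ k * g x) \<in> O[at 0](\<lambda>x. x ^ k * 1)"
    by (intro landau_o.big.mult) auto
  moreover have "eventually (\<lambda>x. f x = x ^ k * g x) (at 0)"
    using g(2) by (simp add: eventually_nhds_conv_at)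
  ultimately show ?thesis
    by (subst landau_o.big.in_cong) auto
qed

lemma has_fps_expansion_eq_0:
  fixes f :: "real \<Rightarrow> real"
  assumes f: "f has_fps_expansion F" and ev: "eventually (\<lambda>x. f x = 0) (at 0)"
  shows "F = 0"
proof (rule ccontr)
  assume F: "F \<noteq> 0"
  define k where "k = subdegree F"
  obtain g where g: "isCont g 0" "g 0 = fps_nth F k" "eventually (\<lambda>x. f x = x ^ k * g x) (nhds 0)"
    using has_fps_expansion_vanishing[OF f, of k]
    nth_less_subdegree_zero[of _ F] unfolding k_def by blast
  have "eventually (\<lambda>x. g x = 0) (at 0)"
    using ev g(3)[unfolded eventually_nhds_conv_at, THEN conjunct1] eventually_neq_at_within[of 0]
    by eventually_elim auto
  then have "(g \<longlongrightarrow> 0) (at 0)"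
    by (simp add: tendsto_eventually)
  moreover have "(g \<longlongrightarrow> g 0) (at 0)"
    using g(1) by (simp add: isCont_def)
  ultimately have "fps_nth F k = 0"
    using g(2) LIM_unique by metis
  then show False
    using F by (simp add: k_def)
qed

lemma has_fps_expansion_unique_real:
  fixes f g :: "real \<Rightarrow> real"
  assumes f: "f has_fps_expansion F" and g: "g has_fps_expansion G"
    and ev: "eventually (\<lambda>x. f x = g x) (at 0)"
  shows "F = G"
proof -
  have "F - G = 0"
    using has_fps_expansion_diff[OF f g]
    by (rule has_fps_expansion_eq_0) (use ev in \<open>auto elim: eventually_mono\<close>)
  then show ?thesis by simp
qed

section \<open>Expansion of the sinc power\<close>

definition sinc_fps :: "real fps" where
  "sinc_fps = fps_shift 1 (fps_const 2 * fps_sin (1/2))"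

text \<open>The value 1 fills the removable singularity, because an expansion at 0 includes the
  point 0 itself.\<close>

definition sinc_half :: "real \<Rightarrow> real" where
  "sinc_half t = (if t = 0 then 1 else 2 * sin (t / 2) / t)"

definition sinc_powr :: "real \<Rightarrow> real \<Rightarrow> real" where
  "sinc_powr \<alpha> t = \<bar>sinc_half t\<bar> powr \<alpha>"

definition even_fps :: "(nat \<Rightarrow> real) \<Rightarrow> real fps" where
  "even_fps a = Abs_fps (\<lambda>m. if even m then a (m div 2) else 0)"

lemma sinc_fps_mult_X: "sinc_fps * fps_X = fps_const 2 * fps_sin (1/2)"
proof (rule fps_ext)
  fix k show "fps_nth (sinc_fps * fps_X) k = fps_nth (fps_const 2 * fps_sin (1/2)) k"
    by (cases k) (simp_all add: sinc_fps_def)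
qed

lemma sinc_half_expansion: "sinc_half has_fps_expansion sinc_fps"
proof -
  have "(\<lambda>x. 2 * sin (1/2 * x)) has_fps_expansion fps_const 2 * fps_sin (1/2 :: real)"
    by (intro fps_expansion_intros)
  moreover have "1 \<le> subdegree (fps_const 2 * fps_sin (1/2 :: real))"
  proof (rule subdegree_geI)
    have "fps_nth (fps_const 2 * fps_sin (1/2 :: real)) 1 \<noteq> 0"
      by simp
    then show "fps_const 2 * fps_sin (1/2 :: real) \<noteq> 0"
      by force
  qed simp
  ultimately have "(\<lambda>x. if x = 0 then 1 else 2 * sin (1/2 * x) / x ^ 1) has_fps_expansion sinc_fps"
    unfolding sinc_fps_def by (rule has_fps_expansion_shift) simp
  then show ?thesis
    unfolding sinc_half_def[abs_def] by (simp cong: if_cong)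
qed

lemma sinc_half_continuous: "isCont sinc_half 0"
  using has_fps_expansion_imp_continuous[OF sinc_half_expansion, of UNIV] by simp

lemma sinc_half_pos: "eventually (\<lambda>t. sinc_half t > 0) (nhds 0)"
proof -
  have "(sinc_half \<longlongrightarrow> sinc_half 0) (nhds 0)"
    using sinc_half_continuous by (simp add: continuous_at tendsto_nhds_iff)
  then show ?thesis
    by (rule order_tendstoD) (simp add: sinc_half_def)
qed

lemma sinc_powr_expansion:
  assumes "is_sinc_powr_expansion \<alpha> a"
  shows "sinc_powr \<alpha> has_fps_expansion even_fps a" and "a 0 = 1"
proof -
  \<comment> \<open>\<open>is_sinc_powr_expansion\<close> says nothing at \<theta> = 0. The value
    there is set to the sum of the series, \<open>a 0\<close>; continuity of the sum then forces
    \<open>a 0 = 1\<close> and identifies \<open>f\<close> with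
    \<open>sinc_powr \<alpha>\<close>.\<close>
  define f where "f = (\<lambda>t. if t = 0 then a 0 else sinc_powr \<alpha> t)"
  have ev: "eventually (\<lambda>t. (\<lambda>p. a p * t ^ (2 * p)) sums (\<bar>2 * sin (t / 2) / t\<bar> powr \<alpha>)) (at 0)"
    using assms by (simp add: is_sinc_powr_expansion_def)
  have reindex: "(\<lambda>m. fps_nth (even_fps a) m * t ^ m) sums c \<longleftrightarrow> (\<lambda>p. a p * t ^ (2 * p)) sums c" for t c
  proof -
    have "strict_mono (\<lambda>p::nat. 2 * p)"
      by (simp add: strict_mono_def)
    moreover have "fps_nth (even_fps a) m * t ^ m = 0" if "m \<notin> range (\<lambda>p::nat. 2 * p)" for m
      using that by (auto simp: even_fps_def elim!: evenE)
    ultimately have "(\<lambda>p. fps_nth (even_fps a) (2 * p) * t ^ (2 * p)) sums c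
        \<longleftrightarrow> (\<lambda>m. fps_nth (even_fps a) m * t ^ m) sums c"
      by (rule sums_mono_reindex)
    then show ?thesis
      by (simp add: even_fps_def)
  qed
  have "eventually (\<lambda>t. (\<lambda>m. fps_nth (even_fps a) m * t ^ m) sums f t) (at 0)"
    using ev eventually_neq_at_within[of 0]
    by eventually_elim (simp add: reindex f_def sinc_powr_def sinc_half_def)
  moreover have "(\<lambda>m. fps_nth (even_fps a) m * 0 ^ m) sums f 0"
    using powser_sums_zero[of "fps_nth (even_fps a)"] by (simp add: f_def even_fps_def)
  ultimately have "eventually (\<lambda>t. (\<lambda>m. fps_nth (even_fps a) m * t ^ m) sums f t) (nhds 0)"
    by (simp add: eventually_nhds_conv_at)
  then have f: "f has_fps_expansion even_fps a"
    by (rule has_fps_expansionI)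
  have "(f \<longlongrightarrow> f 0) (at 0)"
    using has_fps_expansion_imp_continuous[OF f, of UNIV] by (simp add: continuous_within)
  moreover have "(f \<longlongrightarrow> 1) (at 0)"
  proof -
    have "((\<lambda>t. \<bar>sinc_half t\<bar> powr \<alpha>) \<longlongrightarrow> \<bar>sinc_half 0\<bar> powr \<alpha>) (at 0)"
      using sinc_half_continuous unfolding isCont_def
      by (intro tendsto_intros) (auto simp: sinc_half_def[of 0])
    then have "(sinc_powr \<alpha> \<longlongrightarrow> 1) (at 0)"
      unfolding sinc_powr_def[abs_def] by (simp add: sinc_half_def[of 0])
    then show ?thesis
    proof (rule Lim_transform_eventually)
      show "eventually (\<lambda>t. sinc_powr \<alpha> t = f t) (at 0)"
        using eventually_neq_at_within[of 0] by eventually_elim (simp add: f_def)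
    qed
  qed
  ultimately show a0: "a 0 = 1"
    using LIM_unique[of f "f 0" 0 1] by (simp add: f_def)
  have "f = sinc_powr \<alpha>"
    by (rule ext) (simp add: f_def a0 sinc_powr_def sinc_half_def)
  then show "sinc_powr \<alpha> has_fps_expansion even_fps a"
    using f by simp
qed

text \<open>Logarithmic differentiation where \<open>sinc_half\<close> is positive, so that the
  absolute value disappears and \<open>powr\<close> is differentiable. Agreement off 0 suffices to
  compare the two series.\<close>

lemma sinc_powr_ODE:
  assumes "is_sinc_powr_expansion \<alpha> a"
  shows "sinc_fps * fps_deriv (even_fps a) = fps_const \<alpha> * fps_deriv sinc_fps * even_fps a"
proof -
  note E = sinc_powr_expansion(1)[OF assms]
  have "eventually (\<lambda>t. sinc_half t * deriv (sinc_powr \<alpha>) t = \<alpha> * deriv sinc_half t * sinc_powr \<alpha> t) (at 0)"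
  proof -
    obtain U where U: "open U" "0 \<in> U" "\<And>x. x \<in> U \<Longrightarrow> sinc_half x > 0"
      using sinc_half_pos by (auto simp: eventually_nhds)
    have "eventually (\<lambda>t. t \<in> U - {0}) (at 0)"
      using U by (intro eventually_at_in_open) auto
    then show ?thesis
    proof eventually_elim
      case (elim x)
      have nz: "eventually (\<lambda>t. t \<in> U - {0}) (nhds x)"
        using elim U by (intro eventually_nhds_in_open) auto
      have "((\<lambda>t. 2 * sin (t / 2) / t) has_real_derivative
              ((cos (x / 2)) * x - 2 * sin (x / 2)) / (x * x)) (at x)"
        using elim by (auto intro!: derivative_eq_intros)
      then have "(sinc_half has_real_derivative ((cos (x / 2)) * x - 2 * sin (x / 2)) / (x * x)) (at x)"
        by (rule DERIV_cong_ev[THEN iffD1, rotated -1])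
          (use nz in \<open>auto simp: sinc_half_def elim: eventually_mono\<close>)
      then have ds: "(sinc_half has_real_derivative deriv sinc_half x) (at x)"
        by (metis DERIV_imp_deriv)
      have "((\<lambda>t. sinc_half t powr \<alpha>) has_real_derivative
              \<alpha> * sinc_half x powr (\<alpha> - 1) * deriv sinc_half x) (at x)"
        using U(3)[of x] elim by (auto intro!: derivative_eq_intros ds)
      then have "(sinc_powr \<alpha> has_real_derivative \<alpha> * sinc_half x powr (\<alpha> - 1) * deriv sinc_half x) (at x)"
        by (rule DERIV_cong_ev[THEN iffD1, rotated -1])
          (use nz in \<open>auto simp: sinc_powr_def abs_of_pos U(3) elim!: eventually_mono\<close>)
      then have "deriv (sinc_powr \<alpha>) x = \<alpha> * sinc_half x powr (\<alpha> - 1) * deriv sinc_half x"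
        by (rule DERIV_imp_deriv)
      moreover have "sinc_half x * sinc_half x powr (\<alpha> - 1) = sinc_powr \<alpha> x"
        using U(3)[of x] elim by (simp add: sinc_powr_def powr_mult_base)
      ultimately show ?case
        by (simp add: mult_ac)
    qed
  qed
  moreover have "(\<lambda>t. sinc_half t * deriv (sinc_powr \<alpha>) t) has_fps_expansion sinc_fps * fps_deriv (even_fps a)"
    by (intro has_fps_expansion_mult has_fps_expansion_deriv sinc_half_expansion E)
  moreover have "(\<lambda>t. \<alpha> * deriv sinc_half t * sinc_powr \<alpha> t) has_fps_expansion
      fps_const \<alpha> * fps_deriv sinc_fps * even_fps a"
    by (intro has_fps_expansion_mult has_fps_expansion_deriv sinc_half_expansion E has_fps_expansion_const)
  ultimately show ?thesis
    by (intro has_fps_expansion_unique_real) auto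
qed

text \<open>The power recurrence at k = 2, 4, 6; the odd coefficients of both series drop
  out.\<close>

lemma sinc_powr_coeffs:
  assumes "is_sinc_powr_expansion \<alpha> a"
  shows "a 1 = - \<alpha> / 24" and "a 2 = (1 / 1920 + (\<alpha> - 1) / 1152) * \<alpha>"
    and "a 3 = - (1 / 322560 + (\<alpha> - 1) / 46080 + (\<alpha> - 1) * (\<alpha> - 2) / 82944) * \<alpha>"
proof -
  have nth: "fps_nth sinc_fps k = 2 * fps_nth (fps_sin (1/2)) (Suc k)" for k
    by (simp add: sinc_fps_def)
  have S0: "fps_nth sinc_fps 0 = 1"
    by (simp add: nth)
  have S: "fps_nth sinc_fps (Suc 0) = 0" "fps_nth sinc_fps 2 = -1/24" "fps_nth sinc_fps 3 = 0"
      "fps_nth sinc_fps 4 = 1/1920" "fps_nth sinc_fps 5 = 0" "fps_nth sinc_fps 6 = -1/322560"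
    by (simp_all add: nth fps_sin_def fact_numeral power_numeral_reduce)
  have A: "fps_nth (even_fps a) 0 = 1" "fps_nth (even_fps a) (Suc 0) = 0" "fps_nth (even_fps a) 2 = a 1"
      "fps_nth (even_fps a) 3 = 0" "fps_nth (even_fps a) 4 = a 2" "fps_nth (even_fps a) 5 = 0"
      "fps_nth (even_fps a) 6 = a 3"
    using sinc_powr_expansion(2)[OF assms] by (simp_all add: even_fps_def)
  note rec = fps_power_ODE_recurrence[OF sinc_powr_ODE[OF assms] S0]
  have I: "{1..2::nat} = {1,2}" "{1..4::nat} = {1,2,3,4}" "{1..6::nat} = {1,2,3,4,5,6}"
    by auto
  show a1: "a 1 = - \<alpha> / 24"
    using rec[of 2] unfolding I by (simp add: S A)
  have "4 * a 2 = (2 * \<alpha> - 2) * (-1/24) * a 1 + 4 * \<alpha> / 1920"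
    using rec[of 4] unfolding I by (simp add: S A)
  then show a2: "a 2 = (1 / 1920 + (\<alpha> - 1) / 1152) * \<alpha>"
    unfolding a1 by (simp add: field_simps)
  have "6 * a 3 = (2 * \<alpha> - 4) * (-1/24) * a 2 + (4 * \<alpha> - 2) * (1/1920) * a 1 - 6 * \<alpha> / 322560"
    using rec[of 6] unfolding I by (simp add: S A mult.commute[of \<alpha>])
  then show "a 3 = - (1 / 322560 + (\<alpha> - 1) / 46080 + (\<alpha> - 1) * (\<alpha> - 2) / 82944) * \<alpha>"
    unfolding a1 a2 by (simp add: field_simps)
qed

section \<open>Symbol of the central difference as a power series\<close>

abbreviation central_symbol :: "nat \<Rightarrow> real \<Rightarrow> real" where
  "central_symbol l t \<equiv> (- 4) ^ l * ((sin (t / 2))\<^sup>2) ^ l"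

abbreviation frac_symbol :: "real \<Rightarrow> real \<Rightarrow> real" where
  "frac_symbol \<alpha> t \<equiv> \<bar>2 * sin (t / 2)\<bar> powr \<alpha>"

text \<open>By the binomial theorem the sum is (1 - e^(-it))^(2l) e^(ilt) = (e^(it) + e^(-it) -
  2)^l, and e^(it) + e^(-it) - 2 = -4 sin^2 (t/2).\<close>

lemma central_diff_symbol:
  "(\<Sum>s=0..2*l. (-1) ^ s * of_nat ((2 * l) choose s) * cis ((real l - real s) * t))
    = complex_of_real (central_symbol l t)"
proof -
  have "(\<Sum>s=0..2*l. (-1) ^ s * of_nat ((2 * l) choose s) * cis ((real l - real s) * t))
      = (\<Sum>s\<le>2*l. of_nat ((2 * l) choose s) * (- cis (- t)) ^ s * 1 ^ (2 * l - s)) * cis t ^ l"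
    unfolding sum_distrib_right atLeast0AtMost
  proof (intro sum.cong refl)
    fix s
    have "cis ((real l - real s) * t) = cis (- t) ^ s * cis t ^ l"
    proof -
      have "cis (- t) ^ s * cis t ^ l = cis (real s * - t + real l * t)"
        by (simp only: Complex.DeMoivre cis_mult)
      also have "real s * - t + real l * t = (real l - real s) * t"
        by (simp add: algebra_simps)
      finally show ?thesis ..
    qed
    then show "(-1) ^ s * of_nat ((2 * l) choose s) * cis ((real l - real s) * t)
        = of_nat ((2 * l) choose s) * (- cis (- t)) ^ s * 1 ^ (2 * l - s) * cis t ^ l"
      by (simp add: power_minus[of "cis (- t)"])
  qed
  also have "\<dots> = (1 - cis (- t)) ^ (2 * l) * cis t ^ l"
    using binomial_ring[of "- cis (- t)" 1 "2 * l"] by simp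
  also have "\<dots> = ((1 - cis (- t))\<^sup>2 * cis t) ^ l"
    by (simp add: power_mult_distrib power_mult)
  also have "(1 - cis (- t))\<^sup>2 * cis t = cis t + cis (- t) - 2"
  proof -
    have "cis (- t) * cis t = 1" by (simp add: cis_mult)
    then show ?thesis
      by (simp add: power2_eq_square algebra_simps flip: mult.assoc)
  qed
  also have "cis t + cis (- t) - 2 = complex_of_real (2 * cos t - 2)"
    by (simp add: complex_eq_iff)
  also have "2 * cos t - 2 = - 4 * (sin (t / 2))\<^sup>2"
    using cos_double_sin[of "t / 2"] by simp
  finally show ?thesis
    by (simp only: power_mult_distrib[symmetric] of_real_power)
qed

definition central_diff_fps :: "nat \<Rightarrow> real fps" where
  "central_diff_fps l = (\<Sum>s=0..2*l. fps_const ((-1) ^ s * real ((2 * l) choose s)) * fps_cos (real l - real s))"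

lemma sin_sq_power_expansion:
  "(\<lambda>t. ((sin (t / 2))\<^sup>2) ^ l) has_fps_expansion ((fps_sin (1/2 :: real))\<^sup>2) ^ l"
proof -
  have "(\<lambda>t. \<Prod>i<l. (sin (1/2 * t) * sin (1/2 * t))) has_fps_expansion
      (\<Prod>i<l. (fps_sin (1/2) * fps_sin (1/2 :: real)))"
    by (intro fps_expansion_intros)
  then show ?thesis
    by (simp add: power2_eq_square)
qed

text \<open>Two forms of one series with separate uses: the cosine sum has the Taylor coefficients
  that occur in \<open>coefficient_identity\<close>, while the power of sin^2 shows the order of
  vanishing at 0 and is the form to which \<open>fps_compose_coeff_unique\<close> applies.\<close>

lemma central_diff_fps_eq:
  "central_diff_fps l = fps_const ((- 4) ^ l) * ((fps_sin (1/2))\<^sup>2) ^ l"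
proof (rule has_fps_expansion_unique_real)
  show "(\<lambda>t. \<Sum>s=0..2*l. ((-1) ^ s * real ((2 * l) choose s)) * cos ((real l - real s) * t))
      has_fps_expansion central_diff_fps l"
    unfolding central_diff_fps_def by (intro fps_expansion_intros)
  show "central_symbol l has_fps_expansion fps_const ((- 4) ^ l) * ((fps_sin (1/2 :: real))\<^sup>2) ^ l"
    by (intro has_fps_expansion_mult has_fps_expansion_const sin_sq_power_expansion)
  have "(\<Sum>s=0..2*l. ((-1) ^ s * real ((2 * l) choose s)) * cos ((real l - real s) * t))
      = (- 4) ^ l * ((sin (t / 2))\<^sup>2) ^ l" for t
  proof -
    have "Re ((-1) ^ s * of_nat ((2 * l) choose s) * cis ((real l - real s) * t))
        = ((-1) ^ s * real ((2 * l) choose s)) * cos ((real l - real s) * t)" for s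
    proof -
      have "(-1) ^ s * of_nat ((2 * l) choose s) = complex_of_real ((-1) ^ s * real ((2 * l) choose s))"
        by simp
      then show ?thesis
        by (simp only: Re_complex_of_real scaleR_conv_of_real[symmetric] scaleR_complex.sel cis.sel)
    qed
    then show ?thesis
      using arg_cong[OF central_diff_symbol[of l t], of Re] by (simp only: Re_sum Re_complex_of_real)
  qed
  then show "eventually (\<lambda>t. (\<Sum>s=0..2*l. ((-1) ^ s * real ((2 * l) choose s)) * cos ((real l - real s) * t))
      = (- 4) ^ l * ((sin (t / 2))\<^sup>2) ^ l) (at 0)"
    by simp
qed

lemma even_fps_conv_compose: "even_fps a = Abs_fps a oo fps_X\<^sup>2"
proof (rule fps_ext)
  fix m
  have "fps_nth (Abs_fps a oo fps_X\<^sup>2) m = (\<Sum>i=0..m. if m = 2 * i then a i else 0)"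
    unfolding fps_compose_nth by (intro sum.cong refl) (simp add: power_mult[symmetric] fps_X_power_nth)
  also have "\<dots> = (\<Sum>i=0..m. if i = m div 2 then if even m then a i else 0 else 0)"
    by (intro sum.cong) auto
  finally show "fps_nth (even_fps a) m = fps_nth (Abs_fps a oo fps_X\<^sup>2) m"
    by (simp add: even_fps_def)
qed

lemma even_fps_mult: "even_fps a * even_fps c = even_fps (\<lambda>m. \<Sum>q=0..m. a q * c (m - q))"
  unfolding even_fps_conv_compose
  by (subst fps_compose_mult_distrib[symmetric]) (simp_all add: fps_times_def)

abbreviation central_diff_coeff :: "nat \<Rightarrow> nat \<Rightarrow> real" where
  "central_diff_coeff l q \<equiv> fps_nth (central_diff_fps l) (2 * q)"

lemma central_diff_fps_even: "central_diff_fps l = even_fps (central_diff_coeff l)"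
  by (rule fps_ext)
    (auto simp: central_diff_fps_def even_fps_def fps_sum_nth fps_cos_def intro!: sum.neutral elim!: evenE)

text \<open>The terms s and 2l - s agree, hence the factor 2. The middle term s = l carries 0^(2q)
  and survives only for q = 0, where 0^0 = 1.\<close>

lemma central_diff_coeff_eq:
  "central_diff_coeff l q
    = 2 * (\<Sum>s<l. (-1) ^ (s + q) * (real l - real s) ^ (2 * q) * real ((2 * l) choose s) / fact (2 * q))
      + (if q = 0 then (-1) ^ l * real ((2 * l) choose l) else 0)"
proof -
  define g where "g s = (-1) ^ (s + q) * (real l - real s) ^ (2 * q) * real ((2 * l) choose s) / fact (2 * q)" for s
  have "central_diff_coeff l q = (\<Sum>s=0..2*l. g s)"
    by (simp add: central_diff_fps_def fps_sum_nth fps_cos_def g_def power_add mult_ac)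
  also have "{0..2*l} = {..<l} \<union> ({l} \<union> {l<..2*l})"
    by auto
  also have "(\<Sum>s\<in>{..<l} \<union> ({l} \<union> {l<..2*l}). g s) = (\<Sum>s<l. g s) + (g l + (\<Sum>s\<in>{l<..2*l}. g s))"
    by (subst sum.union_disjoint; force?)+ 
  also have "(\<Sum>s\<in>{l<..2*l}. g s) = (\<Sum>s<l. g s)"
  proof (rule sum.reindex_bij_witness[where i = "\<lambda>s. 2 * l - s" and j = "\<lambda>s. 2 * l - s"])
    fix s assume s: "s \<in> {l<..2*l}"
    have "(2 * l) choose (2 * l - s) = (2 * l) choose s"
      using s by (intro binomial_symmetric[symmetric]) auto
    moreover have "(real l - real (2 * l - s)) ^ (2 * q) = (real l - real s) ^ (2 * q)"
    proof -
      have "real l - real (2 * l - s) = real s - real l"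
        using s by auto
      then show ?thesis
        by (simp only: power_mult power2_commute[of "real s"])
    qed
    moreover have "(-1 :: real) ^ (2 * l - s) = (-1) ^ s"
      using s by (simp add: minus_one_power_iff)
    ultimately show "g (2 * l - s) = g s"
      by (simp add: g_def power_add)
  qed auto
  also have "g l = (if q = 0 then (-1) ^ l * real ((2 * l) choose l) else 0)"
    by (simp add: g_def)
  finally show ?thesis
    by (simp add: g_def)
qed

section \<open>From the truncated identity to a power series identity\<close>

lemma sum_triangle:
  "(\<Sum>q=0..N. \<Sum>p=0..N-q. f q p) = (\<Sum>m=0..N. \<Sum>q=0..m. f q (m - q))"
  for f :: "nat \<Rightarrow> nat \<Rightarrow> 'a :: comm_monoid_add"
proof (induction N)
  case (Suc N)
  have "(\<Sum>q=0..N. \<Sum>p=0..Suc N-q. f q p) = (\<Sum>q=0..N. (\<Sum>p=0..N-q. f q p) + f q (Suc N - q))"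
    by (intro sum.cong) (auto simp: Suc_diff_le)
  then show ?case
    using Suc by (simp add: sum.distrib add_ac)
qed simp

text \<open>The bracket multiplying \<open>b l\<close> in \<open>coefficient_identity\<close> is the
  Cauchy product of the symbol of the difference of order 2l with the expansion \<open>a\<close>,
  cut off after t^(2N): the triangle p \<le> N - q consists of the pairs of total degree at most N
  in t^2.\<close>

lemma central_diff_truncated_product:
  "2 * (\<Sum>s<l. \<Sum>q=0..N. \<Sum>p=0..N-q. (-1) ^ (s + q) * (real l - real s) ^ (2 * q)
          * real ((2 * l) choose s) * a p / fact (2 * q) * t ^ (2 * (p + q)))
      + (-1) ^ l * real ((2 * l) choose l) * (\<Sum>p=0..N. a p * t ^ (2 * p))
    = (\<Sum>m=0..N. (\<Sum>q=0..m. central_diff_coeff l q * a (m - q)) * (t\<^sup>2) ^ m)"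
proof -
  let ?t = "\<lambda>s q p. (-1) ^ (s + q) * (real l - real s) ^ (2 * q)
          * real ((2 * l) choose s) * a p / fact (2 * q) * t ^ (2 * (p + q))"
  define g where "g q = (\<Sum>s<l. (-1) ^ (s + q) * (real l - real s) ^ (2 * q) * real ((2 * l) choose s) / fact (2 * q))" for q
  define h where "h q = (if q = 0 then (-1) ^ l * real ((2 * l) choose l) else 0)" for q :: nat
  have d: "central_diff_coeff l q = 2 * g q + h q" for q
    by (simp add: central_diff_coeff_eq g_def h_def)
  have "(\<Sum>m=0..N. (\<Sum>q=0..m. central_diff_coeff l q * a (m - q)) * (t\<^sup>2) ^ m)
      = (\<Sum>m=0..N. \<Sum>q=0..m. central_diff_coeff l q * (a (m - q) * (t\<^sup>2) ^ ((m - q) + q)))"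
    by (auto intro!: sum.cong simp: sum_distrib_right mult.assoc)
  also have "\<dots> = (\<Sum>q=0..N. \<Sum>p=0..N-q. central_diff_coeff l q * (a p * (t\<^sup>2) ^ (p + q)))"
    by (rule sum_triangle[symmetric])
  also have "\<dots> = 2 * (\<Sum>q=0..N. \<Sum>p=0..N-q. g q * (a p * (t\<^sup>2) ^ (p + q)))
      + (\<Sum>q=0..N. \<Sum>p=0..N-q. h q * (a p * (t\<^sup>2) ^ (p + q)))"
    by (simp add: d ring_distribs sum.distrib sum_distrib_left mult.assoc)
  also have "(\<Sum>q=0..N. \<Sum>p=0..N-q. h q * (a p * (t\<^sup>2) ^ (p + q)))
      = (-1) ^ l * real ((2 * l) choose l) * (\<Sum>p=0..N. a p * t ^ (2 * p))"
  proof -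
    have "(\<Sum>q=0..N. \<Sum>p=0..N-q. h q * (a p * (t\<^sup>2) ^ (p + q)))
        = (\<Sum>p=0..N. h 0 * (a p * (t\<^sup>2) ^ p)) + (\<Sum>q=1..N. \<Sum>p=0..N-q. h q * (a p * (t\<^sup>2) ^ (p + q)))"
      by (subst sum.atLeast_Suc_atMost) simp_all
    also have "(\<Sum>q=1..N. \<Sum>p=0..N-q. h q * (a p * (t\<^sup>2) ^ (p + q))) = 0"
      by (intro sum.neutral ballI) (simp add: h_def)
    finally show ?thesis
      by (simp add: h_def sum_distrib_left power_mult)
  qed
  also have "(\<Sum>q=0..N. \<Sum>p=0..N-q. g q * (a p * (t\<^sup>2) ^ (p + q)))
      = (\<Sum>q=0..N. \<Sum>p=0..N-q. \<Sum>s<l. ?t s q p)"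
    unfolding g_def sum_distrib_right power_mult[symmetric]
    by (intro sum.cong refl) (simp add: mult_ac)
  also have "\<dots> = (\<Sum>q=0..N. \<Sum>s<l. \<Sum>p=0..N-q. ?t s q p)"
    by (intro sum.cong refl sum.swap)
  also have "\<dots> = (\<Sum>s<l. \<Sum>q=0..N. \<Sum>p=0..N-q. ?t s q p)"
    by (rule sum.swap)
  finally show ?thesis
    by simp
qed

lemma polyfun_zero_on_nonneg:
  fixes c :: "nat \<Rightarrow> real"
  assumes "\<And>z. z \<ge> 0 \<Longrightarrow> (\<Sum>m\<le>N. c m * z ^ m) = 0" and "m \<le> N"
  shows "c m = 0"
proof (rule ccontr)
  assume "c m \<noteq> 0"
  then have "finite {z. (\<Sum>m\<le>N. c m * z ^ m) = 0}"
    using assms(2) polyfun_finite_roots[of c N] by blast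
  moreover have "{0..} \<subseteq> {z. (\<Sum>m\<le>N. c m * z ^ m) = 0}"
    using assms(1) by auto
  ultimately show False
    using infinite_Ici[of "0::real"] finite_subset by blast
qed

text \<open>The term with \<open>b (n - 1)\<close> on the right of the identity is the missing
  summand l = n - 1. The symbol of the difference of order 2n - 2 starts at \<theta>^(2n-2), so its
  product with the expansion, cut off there, is its leading coefficient times
  \<open>a 0 = 1\<close>. Moved to the left, it completes the sum to all l < n. Degree 2n - 1 comes
  for free because every series involved is even.\<close>

lemma coefficient_identity_fps:
  assumes n: "n \<ge> 2" and id: "\<forall>t\<ge>0. coefficient_identity n a b t" and a0: "a 0 = 1"
    and m: "m < 2 * n"
  shows "fps_nth ((\<Sum>l<n. fps_const (b l) * central_diff_fps l) * even_fps a) m = (if m = 0 then 1 else 0)"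
proof -
  define N where "N = n - 1"
  define P where "P l m = (\<Sum>q=0..m. central_diff_coeff l q * a (m - q))" for l m
  have nN: "n = Suc N" "N \<ge> 1" "n - 2 = N - 1" "n - 1 = N" "2 * n - 2 = 2 * N"
    using n by (auto simp: N_def)
  have prod: "(\<Sum>l<n. fps_const (b l) * central_diff_fps l) * even_fps a
      = (\<Sum>l<n. fps_const (b l) * even_fps (P l))"
    unfolding sum_distrib_right
  proof (intro sum.cong refl)
    fix l
    have "central_diff_fps l * even_fps a = even_fps (P l)"
      by (subst central_diff_fps_even) (simp add: even_fps_mult P_def[abs_def])
    then show "fps_const (b l) * central_diff_fps l * even_fps a = fps_const (b l) * even_fps (P l)"
      by (simp add: mult.assoc)
  qed
  \<comment> \<open>With N \<ge> 1 the middle term of \<open>central_diff_coeff_eq\<close> at q = N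
    is absent.\<close>
  have lead: "(\<Sum>s=0..n-2. (-1) ^ s * real ((2 * n - 2) choose s) *
        (2 * (real n - 1 - real s) ^ (2 * n - 2) / fact (2 * n - 2))) * (-1) ^ (n - 1) = central_diff_coeff N N"
  proof -
    have "{0..N-1} = {..<N}"
      using nN(2) by auto
    then show ?thesis
      using nN(2) unfolding nN(3-5) central_diff_coeff_eq
      by (simp add: nN(1) sum_distrib_left sum_distrib_right power_add mult_ac)
  qed
  have low: "central_diff_coeff N q = 0" if "q < N" for q
  proof -
    have "fps_nth ((fps_sin (1/2 :: real)) ^ (2 * N)) (2 * q) = 0"
      using startsby_zero_power_prefix[of "fps_sin (1/2 :: real)"] that by simp
    then show ?thesis
      by (simp add: central_diff_fps_eq power_mult)
  qed
  have PN: "P N m = (if m = N then central_diff_coeff N N else 0)" if "m \<le> N" for m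
  proof (cases "m = N")
    case True
    have "P N N = (\<Sum>q\<in>{N}. central_diff_coeff N q * a (N - q))"
      unfolding P_def by (intro sum.mono_neutral_right) (auto simp: low)
    then show ?thesis
      using True a0 by simp
  next
    case False
    then show ?thesis
      using that unfolding P_def by (auto intro!: sum.neutral simp: low)
  qed
  have coeff: "(\<Sum>l<n. b l * P l m) = (if m = 0 then 1 else 0)" if "m \<le> N" for m
  proof -
    have "(\<Sum>m\<le>N. ((\<Sum>l<n. b l * P l m) - (if m = 0 then 1 else 0)) * z ^ m) = 0" if z: "z \<ge> 0" for z
    proof -
      \<comment> \<open>In z = \<theta>^2 the identity is polynomial, and \<theta> \<ge> 0 supplies
        infinitely many z.\<close>
      have "coefficient_identity n a b (sqrt z)"
        using id z by simp
      then have eq: "(\<Sum>l=0..N-1. b l * (\<Sum>m=0..N. P l m * z ^ m)) = 1 - b N * central_diff_coeff N N * z ^ N"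
        unfolding coefficient_identity_def mult.assoc[of "b (n - 1)"] lead
        unfolding nN(3-5) central_diff_truncated_product
        using z by (simp add: P_def power_mult)
      have "(\<Sum>m\<le>N. (\<Sum>l<n. b l * P l m) * z ^ m) = (\<Sum>l<n. b l * (\<Sum>m\<le>N. P l m * z ^ m))"
        unfolding sum_distrib_left sum_distrib_right
        by (subst sum.swap) (simp add: mult.assoc)
      also have "\<dots> = (\<Sum>l=0..N-1. b l * (\<Sum>m=0..N. P l m * z ^ m)) + b N * (\<Sum>m\<le>N. P N m * z ^ m)"
      proof -
        have "{0..N-1} = {..<N}"
          using nN(2) by auto
        then show ?thesis
          by (simp add: nN(1) atLeast0AtMost)
      qed
      also have "(\<Sum>m\<le>N. P N m * z ^ m) = (\<Sum>m\<le>N. if m = N then central_diff_coeff N N * z ^ N else 0)"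
        by (intro sum.cong) (auto simp: PN)
      also have "\<dots> = central_diff_coeff N N * z ^ N"
        by simp
      finally have "(\<Sum>m\<le>N. (\<Sum>l<n. b l * P l m) * z ^ m) = 1"
        using eq by simp
      moreover have "(\<Sum>m\<le>N. (if m = 0 then 1 else 0) * z ^ m) = 1"
      proof -
        have "(\<Sum>m\<le>N. (if m = 0 then 1 else 0) * z ^ m) = (\<Sum>m\<le>N. if m = 0 then 1 else 0)"
          by (intro sum.cong) auto
        then show ?thesis by simp
      qed
      ultimately show ?thesis
        by (simp add: left_diff_distrib sum_subtractf)
    qed
    from polyfun_zero_on_nonneg[OF this \<open>m \<le> N\<close>] show ?thesis
      by simp
  qed
  show ?thesis
  proof (cases "even m")
    case True
    then obtain k where k: "m = 2 * k" ..
    then show ?thesis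
      using coeff[of k] m nN(1) unfolding prod by (simp add: fps_sum_nth even_fps_def del: sum.lessThan_Suc)
  next
    case False
    then show ?thesis
      unfolding prod by (auto simp: fps_sum_nth even_fps_def odd_pos)
  qed
qed

lemma coefficient_identity_unique:
  assumes "is_sinc_powr_expansion \<alpha> a" and "n \<ge> 2" and "\<forall>t\<ge>0. coefficient_identity n a b t" and "l < n"
  shows "b l * (- 4) ^ l = fps_nth (arcsin_powr_fps \<alpha>) l"
proof (rule fps_compose_coeff_unique)
  have "fps_nth (even_fps a) 0 = 1"
    using sinc_powr_expansion(2)[OF assms(1)] by (simp add: even_fps_def)
  then show "even_fps a * (arcsin_powr_fps \<alpha> oo (fps_sin (1/2))\<^sup>2) = 1"
    by (rule sinc_powr_fps_inverse[OF sinc_fps_mult_X sinc_powr_ODE[OF assms(1)]])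
  have "subdegree (fps_sin (1/2 :: real)) = 1"
    by (rule subdegreeI) auto
  moreover have "fps_sin (1/2 :: real) \<noteq> 0"
    using fps_sin_nth_1[of "1/2 :: real"] by force
  ultimately show "subdegree ((fps_sin (1/2 :: real))\<^sup>2) = 2"
    by simp
  show "l < n" by fact
next
  fix m assume m: "m < 2 * n"
  have "(\<Sum>l<n. fps_const (b l * (- 4) ^ l) * ((fps_sin (1/2))\<^sup>2) ^ l) = (\<Sum>l<n. fps_const (b l) * central_diff_fps l)"
    by (intro sum.cong refl) (simp add: central_diff_fps_eq mult.assoc[symmetric] fps_const_mult)
  then show "fps_nth ((\<Sum>l<n. fps_const (b l * (- 4) ^ l) * ((fps_sin (1/2))\<^sup>2) ^ l) * even_fps a) m = (if m = 0 then 1 else 0)"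
    using coefficient_identity_fps[OF assms(2,3) sinc_powr_expansion(2)[OF assms(1)] m] by simp
qed

lemma contraction_constant_less:
  assumes "1 < \<alpha>" "\<alpha> < 2" "is_sinc_powr_expansion \<alpha> a" and "n \<ge> 2"
    and "\<forall>t\<ge>0. coefficient_identity n a b t"
  shows "\<bar>b (n - 1)\<bar> * 4 ^ (n - 1) < 1"
proof -
  have "\<bar>b (n - 1) * (- 4) ^ (n - 1)\<bar> < 1"
    using coefficient_identity_unique[OF assms(3-5), of "n - 1"]
      arcsin_powr_fps_nth_abs_less[OF assms(1,2), of "n - 1"] assms(4) by simp
  then show ?thesis
    by (simp add: abs_mult power_abs)
qed

section \<open>Symbol error and invertibility\<close>

lemma sinc_powr_eq:
  "frac_symbol \<alpha> t = sinc_powr \<alpha> t * \<bar>t\<bar> powr \<alpha>"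
  by (simp add: sinc_powr_def sinc_half_def abs_divide powr_divide abs_mult powr_mult)

text \<open>The arguments w h fill the whole line, so the local order must become a global bound.
  Near 0 the factor |t|^\<alpha> splits off by \<open>sinc_powr_eq\<close>. For |t| \<ge>
  \<open>\<delta>\<close> both products are at most a constant times |t|^\<alpha>, and (|t| /
  \<open>\<delta>\<close>)^(2n) \<ge> 1 supplies the missing power. \<open>M\<close> adds the
  constants of the two regions.\<close>

lemma symbol_error_bound:
  assumes "\<alpha> > 0"
    and p: "\<And>t. \<bar>p t\<bar> \<le> K" and r: "\<And>t. \<bar>r t\<bar> \<le> K"
    and O: "(\<lambda>t. sinc_powr \<alpha> t * p t - r t) \<in> O[at 0](\<lambda>t. t ^ (2 * n))"
  shows "\<exists>M\<ge>0. \<forall>t. \<bar>frac_symbol \<alpha> t * p t - \<bar>t\<bar> powr \<alpha> * r t\<bar> \<le> M * \<bar>t\<bar> powr (\<alpha> + real (2 * n))"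
proof -
  let ?a = "\<lambda>t. \<bar>t\<bar> powr \<alpha>"
  let ?s = "\<lambda>t. frac_symbol \<alpha> t"
  have K: "K \<ge> 0"
    using p[of 0] by simp
  obtain c where c: "c > 0" "eventually (\<lambda>t. norm (sinc_powr \<alpha> t * p t - r t) \<le> c * norm (t ^ (2 * n))) (at 0)"
    using O by (elim landau_o.bigE)
  then obtain \<delta> where \<delta>: "\<delta> > 0"
      "\<And>t. t \<noteq> 0 \<Longrightarrow> \<bar>t\<bar> < \<delta> \<Longrightarrow> \<bar>sinc_powr \<alpha> t * p t - r t\<bar> \<le> c * \<bar>t\<bar> ^ (2 * n)"
    unfolding eventually_at by (auto simp: dist_real_def power_abs)
  define M where "M = c + (2 powr \<alpha> * K / \<delta> powr \<alpha> + K) / \<delta> ^ (2 * n)"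
  have "M \<ge> 0"
    using c(1) K \<delta>(1) by (simp add: M_def)
  moreover have "\<bar>?s t * p t - ?a t * r t\<bar> \<le> M * \<bar>t\<bar> powr (\<alpha> + real (2 * n))" for t
  proof (cases "t = 0")
    case False
    then have pw: "\<bar>t\<bar> powr (\<alpha> + real (2 * n)) = ?a t * \<bar>t\<bar> ^ (2 * n)"
      by (simp add: powr_add powr_realpow[symmetric])
    show ?thesis
    proof (cases "\<bar>t\<bar> < \<delta>")
      case True
      have "?s t * p t - ?a t * r t
          = ?a t * (sinc_powr \<alpha> t * p t - r t)"
        unfolding sinc_powr_eq by (simp add: algebra_simps)
      then have "\<bar>?s t * p t - ?a t * r t\<bar>
          \<le> ?a t * (c * \<bar>t\<bar> ^ (2 * n))"
        using \<delta>(2)[OF False True] by (simp add: abs_mult mult_left_mono)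
      also have "\<dots> = c * \<bar>t\<bar> powr (\<alpha> + real (2 * n))"
        unfolding pw by simp
      also have "\<dots> \<le> M * \<bar>t\<bar> powr (\<alpha> + real (2 * n))"
        using K \<delta>(1) by (intro mult_right_mono) (auto simp: M_def)
      finally show ?thesis .
    next
      case False
      have "?s t \<le> 2 powr \<alpha>"
        using assms(1) abs_sin_le_one[of "t / 2"] by (intro powr_mono2) (auto simp: abs_mult)
      also have "\<dots> \<le> 2 powr \<alpha> * (?a t / \<delta> powr \<alpha>)"
        using False \<delta>(1) assms(1) powr_mono2[of \<alpha> \<delta> "\<bar>t\<bar>"] by (simp add: field_simps)
      finally have "?s t * \<bar>p t\<bar> \<le> (2 powr \<alpha> * (?a t / \<delta> powr \<alpha>)) * K"
        using p K by (intro mult_mono) auto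
      moreover have "?a t * \<bar>r t\<bar> \<le> ?a t * K"
        using r by (intro mult_left_mono) auto
      moreover have "\<bar>?s t * p t - ?a t * r t\<bar>
          \<le> ?s t * \<bar>p t\<bar> + ?a t * \<bar>r t\<bar>"
        using abs_triangle_ineq4[of "?s t * p t" "?a t * r t"]
        by (simp add: abs_mult)
      ultimately have "\<bar>?s t * p t - ?a t * r t\<bar>
          \<le> (2 powr \<alpha> * K / \<delta> powr \<alpha> + K) * ?a t"
        by (simp add: algebra_simps)
      also have "\<dots> \<le> (2 powr \<alpha> * K / \<delta> powr \<alpha> + K) * (?a t * (\<bar>t\<bar> ^ (2 * n) / \<delta> ^ (2 * n)))"
      proof (rule mult_left_mono)
        have "1 \<le> \<bar>t\<bar> ^ (2 * n) / \<delta> ^ (2 * n)"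
          using False \<delta>(1) power_mono[of \<delta> "\<bar>t\<bar>" "2 * n"] by (simp add: field_simps)
        then show "?a t \<le> ?a t * (\<bar>t\<bar> ^ (2 * n) / \<delta> ^ (2 * n))"
          by (metis mult.right_neutral mult_left_mono powr_ge_zero)
      qed (use K in auto)
      also have "\<dots> \<le> M * \<bar>t\<bar> powr (\<alpha> + real (2 * n))"
        unfolding pw M_def using c(1) by (simp add: algebra_simps add_divide_distrib)
      finally show ?thesis .
    qed
  qed (use assms(1) in simp)
  ultimately show ?thesis
    by blast
qed

lemma sin_sq_half_bigo: "(\<lambda>t::real. ((sin (t / 2))\<^sup>2) ^ k) \<in> O[at 0](\<lambda>t. t ^ (2 * k))"
proof -
  have "\<bar>sin (t / 2)\<bar> ^ (2 * k) \<le> 1 * \<bar>t\<bar> ^ (2 * k)" for t :: real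
    using abs_sin_x_le_abs_x[of "t / 2"] power_mono[of "\<bar>sin (t / 2)\<bar>" "\<bar>t\<bar>" "2 * k"] by simp
  then have "norm (((sin (t / 2))\<^sup>2) ^ k) \<le> 1 * norm (t ^ (2 * k))" for t :: real
    by (simp only: power_mult[symmetric] real_norm_def power_abs)
  then show ?thesis
    by (intro landau_o.bigI[of 1] always_eventually allI) auto
qed

lemma sinc_powr_minus_one_bigo:
  assumes "is_sinc_powr_expansion \<alpha> a"
  shows "(\<lambda>t. sinc_powr \<alpha> t - 1) \<in> O[at 0](\<lambda>t. t ^ 2)"
proof (rule has_fps_expansion_bigo)
  show "(\<lambda>t. sinc_powr \<alpha> t - 1) has_fps_expansion even_fps a - 1"
    by (intro has_fps_expansion_diff sinc_powr_expansion(1)[OF assms] has_fps_expansion_1)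
  fix m :: nat assume "m < 2"
  then have "m = 0 \<or> m = 1" by auto
  then show "fps_nth (even_fps a - 1) m = 0"
    using sinc_powr_expansion(2)[OF assms] by (auto simp: even_fps_def)
qed

text \<open>The identity controls the sum over all l < n times \<open>sinc_powr\<close>, whereas the
  scheme carries the term l = n - 1 without that factor. The discrepancy
  \<open>e (n - 1) t * (sinc_powr \<alpha> t - 1)\<close> has order (2n - 2) + 2.\<close>

lemma coefficient_identity_bigo:
  assumes a: "is_sinc_powr_expansion \<alpha> a" and n: "n \<ge> 2" and id: "\<forall>t\<ge>0. coefficient_identity n a b t"
  shows "(\<lambda>t. sinc_powr \<alpha> t * (\<Sum>l<n-1. b l * central_symbol l t)
      - (1 - b (n - 1) * central_symbol (n - 1) t)) \<in> O[at 0](\<lambda>t. t ^ (2 * n))"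
proof -
  define e where "e l t = b l * central_symbol l t" for l and t :: real
  have "e l has_fps_expansion fps_const (b l) * central_diff_fps l" for l
    unfolding central_diff_fps_eq e_def[abs_def] by (intro has_fps_expansion_mult has_fps_expansion_const sin_sq_power_expansion)
  then have "(\<lambda>t. (\<Sum>l<n. e l t) * sinc_powr \<alpha> t - 1) has_fps_expansion
      (\<Sum>l<n. fps_const (b l) * central_diff_fps l) * even_fps a - 1"
    by (intro has_fps_expansion_diff has_fps_expansion_mult has_fps_expansion_sum
        sinc_powr_expansion(1)[OF a] has_fps_expansion_1)
  then have 1: "(\<lambda>t. (\<Sum>l<n. e l t) * sinc_powr \<alpha> t - 1) \<in> O[at 0](\<lambda>t. t ^ (2 * n))"
    by (rule has_fps_expansion_bigo)
      (simp add: coefficient_identity_fps[OF n id sinc_powr_expansion(2)[OF a]] fps_one_def)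
  have "(\<lambda>t. (b (n - 1) * (- 4) ^ (n - 1)) * (((sin (t / 2))\<^sup>2) ^ (n - 1) * (sinc_powr \<alpha> t - 1)))
      \<in> O[at 0](\<lambda>t. t ^ (2 * (n - 1)) * t ^ 2)"
    using landau_o.big.mult[OF sin_sq_half_bigo sinc_powr_minus_one_bigo[OF a]]
    by (cases "b (n - 1) * (- 4) ^ (n - 1) = 0") (simp_all add: landau_o.big.cmult_in_iff)
  moreover have "(\<lambda>t. t ^ (2 * (n - 1)) * t ^ 2) = (\<lambda>t::real. t ^ (2 * n))"
    using n by (cases n) (auto simp: fun_eq_iff power2_eq_square)
  ultimately have 2: "(\<lambda>t. e (n - 1) t * (sinc_powr \<alpha> t - 1)) \<in> O[at 0](\<lambda>t. t ^ (2 * n))"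
    by (simp add: e_def mult_ac)
  have "(\<lambda>t. sinc_powr \<alpha> t * (\<Sum>l<n-1. e l t) - (1 - e (n - 1) t))
      = (\<lambda>t. ((\<Sum>l<n. e l t) * sinc_powr \<alpha> t - 1) - e (n - 1) t * (sinc_powr \<alpha> t - 1))"
  proof
    fix t
    have "(\<Sum>l<n. e l t) = (\<Sum>l<n-1. e l t) + e (n - 1) t"
      using n by (cases n) auto
    then show "sinc_powr \<alpha> t * (\<Sum>l<n-1. e l t) - (1 - e (n - 1) t)
        = ((\<Sum>l<n. e l t) * sinc_powr \<alpha> t - 1) - e (n - 1) t * (sinc_powr \<alpha> t - 1)"
      by (simp add: algebra_simps)
  qed
  then show ?thesis
    using sum_in_bigo(2)[OF 1 2] by (simp add: e_def)
qed

section \<open>The implicit operator on bounded functions\<close>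

lemma central_diff_bound:
  assumes "\<And>x. \<bar>f x\<bar> \<le> B"
  shows "\<bar>central_diff h l f x\<bar> \<le> 4 ^ l * B"
proof -
  have "\<bar>central_diff h l f x\<bar> \<le> (\<Sum>s=0..2*l. \<bar>(-1) ^ s * real ((2 * l) choose s) * f (x + (real l - real s) * h)\<bar>)"
    unfolding central_diff_def by (rule sum_abs)
  also have "\<dots> \<le> (\<Sum>s=0..2*l. real ((2 * l) choose s) * B)"
    using assms by (intro sum_mono) (auto simp: abs_mult intro!: mult_left_mono)
  also have "\<dots> = 2 ^ (2 * l) * B"
    using choose_row_sum[of "2 * l"]
    by (simp add: sum_distrib_right[symmetric] atLeast0AtMost flip: of_nat_sum)
  finally show ?thesis
    by (simp add: power_mult)
qed

lemma central_diff_0 [simp]: "central_diff h 0 f x = f x"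
  by (simp add: central_diff_def)

lemma central_diff_diff: "central_diff h l (\<lambda>x. f x - g x) x = central_diff h l f x - central_diff h l g x"
  by (simp add: central_diff_def right_diff_distrib sum_subtractf)

text \<open>For S the supremum of |f| one gets S \<le> B + q S, which can be solved because S is
  finite and q < 1. The case B = 0 is injectivity; the general case carries the consistency error
  through the inverse with a factor independent of \<open>h\<close>.\<close>

lemma lhs_op_lower_bound:
  assumes q: "\<bar>c\<bar> * 4 ^ (n - 1) < 1" and bd: "f \<in> bounded_functions"
    and le: "\<And>x. \<bar>lhs_op h n c f x\<bar> \<le> B"
  shows "\<bar>f x\<bar> \<le> B / (1 - \<bar>c\<bar> * 4 ^ (n - 1))"
proof -
  define q where "q = \<bar>c\<bar> * 4 ^ (n - 1)"
  define S where "S = (SUP x. \<bar>f x\<bar>)"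
  have "bdd_above (range (\<lambda>x. \<bar>f x\<bar>))"
    using bd unfolding bounded_functions_def bounded_iff bdd_above_def by auto
  then have fS: "\<bar>f x\<bar> \<le> S" for x
    unfolding S_def by (rule cSUP_upper2) auto
  have "\<bar>f x\<bar> \<le> B + q * S" for x
  proof -
    have "f x = lhs_op h n c f x + c * central_diff h (n - 1) f x"
      by (simp add: lhs_op_def)
    then have "\<bar>f x\<bar> \<le> \<bar>lhs_op h n c f x\<bar> + \<bar>c\<bar> * \<bar>central_diff h (n - 1) f x\<bar>"
      by (metis abs_mult abs_triangle_ineq)
    also have "\<dots> \<le> B + \<bar>c\<bar> * (4 ^ (n - 1) * S)"
      by (intro add_mono le mult_left_mono central_diff_bound fS) auto
    finally show ?thesis
      by (simp add: q_def mult.assoc)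
  qed
  then have "S \<le> B + q * S"
    unfolding S_def by (intro cSUP_least) auto
  then have "S \<le> B / (1 - q)"
    using q by (simp add: q_def field_simps)
  then show ?thesis
    using fS[of x] by (simp add: q_def)
qed

lemma bounded_functionsI: "(\<And>x. \<bar>f x\<bar> \<le> B) \<Longrightarrow> f \<in> bounded_functions"
  unfolding bounded_functions_def bounded_iff by auto

lemma bounded_functionsE:
  assumes "f \<in> bounded_functions"
  obtains B where "B \<ge> 0" "\<And>x. \<bar>f x\<bar> \<le> B"
proof -
  obtain B where "\<And>x. \<bar>f x\<bar> \<le> B"
    using assms unfolding bounded_functions_def bounded_iff by auto
  then show ?thesis
    using that[of B] abs_ge_zero order_trans by blast
qed

lemma lhs_op_bij:
  assumes q: "\<bar>c\<bar> * 4 ^ (n - 1) < 1"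
  shows "bij_betw (lhs_op h n c) bounded_functions bounded_functions"
  unfolding bij_betw_def
proof
  show "inj_on (lhs_op h n c) bounded_functions"
  proof (rule inj_onI)
    fix f g assume f: "f \<in> bounded_functions" and g: "g \<in> bounded_functions"
      and eq: "lhs_op h n c f = lhs_op h n c g"
    obtain B C where B: "\<And>x. \<bar>f x\<bar> \<le> B" and C: "\<And>x. \<bar>g x\<bar> \<le> C"
      using f g by (metis bounded_functionsE)
    have "(\<lambda>x. f x - g x) \<in> bounded_functions"
    proof (rule bounded_functionsI)
      fix x show "\<bar>f x - g x\<bar> \<le> B + C" using B[of x] C[of x] by linarith
    qed
    moreover have "lhs_op h n c (\<lambda>x. f x - g x) x = 0" for x
      using fun_cong[OF eq, of x] by (simp add: lhs_op_def central_diff_diff algebra_simps)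
    ultimately have "\<bar>f x - g x\<bar> \<le> 0 / (1 - \<bar>c\<bar> * 4 ^ (n - 1))" for x
      by (intro lhs_op_lower_bound[OF q, where h = h]) auto
    then show "f = g"
      by (simp add: fun_eq_iff)
  qed
  show "lhs_op h n c ` bounded_functions = bounded_functions"
  proof (intro equalityI subsetI)
    fix g assume "g \<in> lhs_op h n c ` bounded_functions"
    then obtain f where f: "f \<in> bounded_functions" and g: "g = lhs_op h n c f" by auto
    obtain B where B: "\<And>x. \<bar>f x\<bar> \<le> B"
      using f by (metis bounded_functionsE)
    have "\<bar>g x\<bar> \<le> B + \<bar>c\<bar> * (4 ^ (n - 1) * B)" for x
    proof -
      have "\<bar>g x\<bar> \<le> \<bar>f x\<bar> + \<bar>c\<bar> * \<bar>central_diff h (n - 1) f x\<bar>"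
        by (simp add: g lhs_op_def abs_mult[symmetric] abs_triangle_ineq4)
      also have "\<dots> \<le> B + \<bar>c\<bar> * (4 ^ (n - 1) * B)"
        by (intro add_mono B mult_left_mono central_diff_bound) auto
      finally show ?thesis .
    qed
    then show "g \<in> bounded_functions"
      by (rule bounded_functionsI)
  next
    fix g assume "g \<in> bounded_functions"
    then obtain B where B: "B \<ge> 0" "\<And>x. \<bar>g x\<bar> \<le> B"
      by (metis bounded_functionsE)
    define q where "q = \<bar>c\<bar> * 4 ^ (n - 1)"
    have q01: "0 \<le> q" "q < 1"
      using assms by (auto simp: q_def)
    \<comment> \<open>Neumann iteration: the solutions of \<open>lhs_op h n c f = g\<close> are the
      fixed points of \<open>T\<close>, and the increments of its iterates from 0 are bounded by B
      q^k.\<close>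
    define T where "T f = (\<lambda>x. g x + c * central_diff h (n - 1) f x)" for f
    define F where "F k = (T ^^ k) (\<lambda>_. 0)" for k
    have F_Suc: "F (Suc k) x = g x + c * central_diff h (n - 1) (F k) x" for k x
      by (simp add: F_def T_def)
    have step: "\<bar>F (Suc k) x - F k x\<bar> \<le> B * q ^ k" for k x
    proof (induction k arbitrary: x)
      case 0
      have "central_diff h (n - 1) (\<lambda>_. 0) x = 0"
        by (simp add: central_diff_def)
      then show ?case
        using B(2)[of x] by (simp add: F_def T_def)
    next
      case (Suc k)
      have "F (Suc (Suc k)) x - F (Suc k) x = c * central_diff h (n - 1) (\<lambda>x. F (Suc k) x - F k x) x"
        unfolding F_Suc[of "Suc k"] F_Suc[of k x] central_diff_diff by (simp add: algebra_simps)
      then have "\<bar>F (Suc (Suc k)) x - F (Suc k) x\<bar> \<le> \<bar>c\<bar> * (4 ^ (n - 1) * (B * q ^ k))"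
        using central_diff_bound[of "\<lambda>x. F (Suc k) x - F k x" "B * q ^ k" h "n - 1" x] Suc.IH
        by (simp add: abs_mult mult_left_mono)
      then show ?case
        by (simp add: q_def mult_ac)
    qed
    have summ: "summable (\<lambda>k. B * q ^ k)"
      using q01 by (intro summable_mult summable_geometric) auto
    have summF: "summable (\<lambda>k. F (Suc k) x - F k x)" for x
      by (rule summable_comparison_test'[OF summ, of 0]) (use step in auto)
    define f where "f x = (\<Sum>k. F (Suc k) x - F k x)" for x
    have lim: "(\<lambda>k. F k x) \<longlonglongrightarrow> f x" for x
    proof -
      have "(\<lambda>N. \<Sum>k<N. F (Suc k) x - F k x) \<longlonglongrightarrow> f x"
        unfolding f_def by (rule summable_LIMSEQ[OF summF])
      moreover have "(\<Sum>k<N. F (Suc k) x - F k x) = F N x" for N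
        by (subst sum_lessThan_telescope) (simp add: F_def)
      ultimately show ?thesis by simp
    qed
    have "\<bar>f x\<bar> \<le> (\<Sum>k. B * q ^ k)" for x
    proof -
      have "norm (\<Sum>k. F (Suc k) x - F k x) \<le> (\<Sum>k. B * q ^ k)"
        by (rule norm_suminf_le[OF _ summ]) (use step in auto)
      then show ?thesis by (simp add: f_def)
    qed
    then have fb: "f \<in> bounded_functions"
      by (rule bounded_functionsI)
    \<comment> \<open>Pointwise limits suffice because a central difference is a finite combination
      of point values.\<close>
    have "f x = g x + c * central_diff h (n - 1) f x" for x
    proof (rule LIMSEQ_unique)
      show "(\<lambda>k. F (Suc k) x) \<longlonglongrightarrow> f x"
        using lim by (rule LIMSEQ_Suc)
      show "(\<lambda>k. F (Suc k) x) \<longlonglongrightarrow> g x + c * central_diff h (n - 1) f x"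
        unfolding F_Suc central_diff_def by (intro tendsto_intros lim)
    qed
    then have "lhs_op h n c f = g"
      by (intro ext) (simp add: lhs_op_def algebra_simps)
    then show "g \<in> lhs_op h n c ` bounded_functions"
      using fb by blast
  qed
qed

section \<open>Symbol of the fractional centred difference\<close>

text \<open>\<open>rGamma\<close> satisfies its functional equation at the poles of Gamma too, so
  the recurrence derived from this form needs no condition on \<alpha> or k.\<close>

lemma frac_coeff_rGamma:
  "frac_coeff \<alpha> k = (-1) powi k * Gamma (\<alpha> + 1) * (rGamma (\<alpha> / 2 - of_int k + 1) * rGamma (\<alpha> / 2 + of_int k + 1))"
  by (simp only: frac_coeff_def rGamma_inverse_Gamma divide_inverse inverse_mult_distrib)

lemma frac_coeff_minus: "frac_coeff \<alpha> (- k) = frac_coeff \<alpha> k"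
  by (simp add: frac_coeff_def power_int_minus_one_minus mult_ac)

lemma frac_coeff_recurrence:
  "(of_int k + 1 + \<alpha> / 2) * frac_coeff \<alpha> (k + 1) = (of_int k - \<alpha> / 2) * frac_coeff \<alpha> k"
proof -
  have 1: "(of_int k + 1 + \<alpha> / 2) * rGamma (\<alpha> / 2 + of_int (k + 1) + 1) = rGamma (\<alpha> / 2 + of_int k + 1)"
    using rGamma_plus1[of "\<alpha> / 2 + of_int k + 1"] by (simp add: add_ac)
  have 2: "rGamma (\<alpha> / 2 - of_int (k + 1) + 1) = (\<alpha> / 2 - of_int k) * rGamma (\<alpha> / 2 - of_int k + 1)"
    using rGamma_plus1[of "\<alpha> / 2 - of_int k"] by (simp add: algebra_simps)
  have 3: "(-1 :: real) powi (k + 1) = - ((-1) powi k)"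
    by (simp add: power_int_add)
  have "(of_int k + 1 + \<alpha> / 2) * frac_coeff \<alpha> (k + 1)
      = - ((-1) powi k) * Gamma (\<alpha> + 1) * (rGamma (\<alpha> / 2 - of_int (k + 1) + 1)
          * ((of_int k + 1 + \<alpha> / 2) * rGamma (\<alpha> / 2 + of_int (k + 1) + 1)))"
    unfolding frac_coeff_rGamma 3 by (simp only: mult_ac)
  also have "\<dots> = (of_int k - \<alpha> / 2) * frac_coeff \<alpha> k"
    unfolding 1 2 frac_coeff_rGamma by (simp add: algebra_simps)
  finally show ?thesis .
qed

section \<open>A Beta integral and the duplication formula\<close>

text \<open>The substitution y = sin^2 (t/2) in the Beta integral: its Jacobian sin (t/2) cos (t/2)
  cancels the cosine power and raises the sine power from \<alpha> - 1 to \<alpha>. Sine and cosine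
  are positive on the open interval, which makes the substitution injective.\<close>

lemma sin_powr_integral:
  fixes \<alpha> :: real
  assumes "\<alpha> > 0"
  shows "((\<lambda>t. sin (t / 2) powr \<alpha>) has_integral Beta ((\<alpha> + 1) / 2) (1/2)) {0..pi}"
proof -
  define f where "f t = t powr ((\<alpha> + 1) / 2 - 1) * (1 - t) powr (1/2 - 1)" for t :: real
  define q where "q t = (sin (t / 2))\<^sup>2" for t :: real
  define q' where "q' t = sin (t / 2) * cos (t / 2)" for t :: real
  define S where "S = {0<..<pi}"
  have pos: "sin (t / 2) > 0" "cos (t / 2) > 0" if "t \<in> S" for t
    using that by (auto simp: S_def intro!: sin_gt_zero cos_gt_zero)
  have "(f has_integral Beta ((\<alpha> + 1) / 2) (1/2)) {0<..<1}"
    using has_integral_Beta_real[of "(\<alpha> + 1) / 2" "1/2"] assms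
    by (simp add: f_def[abs_def] has_integral_Icc_iff_Ioo)
  moreover have im: "q ` S = {0<..<1}"
  proof (intro equalityI subsetI)
    fix y assume "y \<in> q ` S"
    then obtain t where th: "t \<in> S" "y = q t" by auto
    have "q t > 0" using pos[OF th(1)] by (simp add: q_def)
    moreover have "q t = 1 - (cos (t / 2))\<^sup>2"
      by (simp add: q_def sin_squared_eq)
    moreover have "(cos (t / 2))\<^sup>2 > 0" using pos[OF th(1)] by simp
    ultimately show "y \<in> {0<..<1}" using th by auto
  next
    fix y :: real assume y: "y \<in> {0<..<1}"
    have "sqrt y < 1" "sqrt y > 0" using y by auto
    then have "- 1 < sqrt y" by linarith
    with \<open>sqrt y < 1\<close> \<open>sqrt y > 0\<close> have "arcsin (sqrt y) < pi / 2" "arcsin (sqrt y) > 0"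
      using arcsin_lt_bounded[of "sqrt y"] arcsin_less_arcsin[of 0 "sqrt y"] by auto
    then have "2 * arcsin (sqrt y) \<in> S"
      by (auto simp: S_def)
    moreover have "q (2 * arcsin (sqrt y)) = y"
      using y \<open>- 1 < sqrt y\<close> \<open>sqrt y < 1\<close> by (simp add: q_def sin_arcsin)
    ultimately show "y \<in> q ` S"
      by (metis imageI)
  qed
  ultimately have f_int: "f integrable_on q ` S" "integral (q ` S) f = Beta ((\<alpha> + 1) / 2) (1/2)"
    by (auto simp: has_integral_iff)
  have f_abs: "f absolutely_integrable_on q ` S"
    using f_int(1) by (intro nonnegative_absolutely_integrable_1) (auto simp: f_def)
  have "(\<lambda>x. \<bar>q' x\<bar> * f (q x)) absolutely_integrable_on S \<and>
      integral S (\<lambda>x. \<bar>q' x\<bar> * f (q x)) = Beta ((\<alpha> + 1) / 2) (1/2)"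
  proof (rule has_absolute_integral_change_of_variables_1'[where g = q and g' = q' and f = f and S = S, THEN iffD2])
    show "S \<in> sets lebesgue" by (simp add: S_def)
    show "(q has_field_derivative q' x) (at x within S)" for x
      unfolding q_def[abs_def] q'_def by (auto intro!: derivative_eq_intros)
    show "inj_on q S"
    proof (rule inj_onI)
      fix x y assume xy: "x \<in> S" "y \<in> S" "q x = q y"
      then have "sin (x / 2) = sin (y / 2)"
        using pos(1)[OF xy(1)] pos(1)[OF xy(2)] by (simp add: q_def power2_eq_iff_nonneg)
      then show "x = y"
        using xy(1,2) sin_inj_pi[of "x / 2" "y / 2"] by (simp add: S_def)
    qed
    show "f absolutely_integrable_on q ` S \<and> integral (q ` S) f = Beta ((\<alpha> + 1) / 2) (1/2)"
      using f_int f_abs by simp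
  qed
  then have "((\<lambda>x. \<bar>q' x\<bar> * f (q x)) has_integral Beta ((\<alpha> + 1) / 2) (1/2)) S"
    using absolutely_integrable_on_def has_integral_iff by blast
  moreover have "\<bar>q' x\<bar> * f (q x) = sin (x / 2) powr \<alpha>" if "x \<in> S" for x
  proof -
    note p = pos[OF that]
    have "1 - q x = (cos (x / 2))\<^sup>2"
      by (simp add: q_def cos_squared_eq)
    then have "f (q x) = ((sin (x / 2))\<^sup>2) powr ((\<alpha> - 1) / 2) * ((cos (x / 2))\<^sup>2) powr (- (1 / 2))"
      by (simp add: f_def q_def diff_divide_distrib add_divide_distrib)
    also have "\<dots> = sin (x / 2) powr (\<alpha> - 1) * cos (x / 2) powr (- 1)"
      using p by (simp add: powr_powr diff_divide_distrib flip: powr_numeral)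
    finally show ?thesis
      using p by (simp add: q'_def powr_minus powr_diff field_simps)
  qed
  ultimately have "((\<lambda>t. sin (t / 2) powr \<alpha>) has_integral Beta ((\<alpha> + 1) / 2) (1/2)) S"
    using has_integral_cong[of S "\<lambda>x. \<bar>q' x\<bar> * f (q x)" "\<lambda>t. sin (t / 2) powr \<alpha>"] by blast
  then show ?thesis
    by (simp add: S_def has_integral_Icc_iff_Ioo)
qed

lemma of_real_notin_nonpos_Ints: "x > 0 \<Longrightarrow> complex_of_real x \<notin> \<int>\<^sub>\<le>\<^sub>0"
  by (auto elim!: nonpos_Ints_cases simp: complex_eq_iff)

lemma Gamma_legendre_duplication_real:
  fixes x :: real
  assumes "x > 0"
  shows "Gamma x * Gamma (x + 1/2) = 2 powr (1 - 2 * x) * sqrt pi * Gamma (2 * x)"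
proof -
  define z where "z = complex_of_real x"
  have e: "z + 1/2 = complex_of_real (x + 1/2)" "2 * z = complex_of_real (2 * x)"
      "(1 - complex_of_real (2 * x)) * of_real (ln 2) = complex_of_real ((1 - 2 * x) * ln 2)"
    by (simp_all add: z_def complex_eq_iff)
  have "z \<notin> \<int>\<^sub>\<le>\<^sub>0" "z + 1/2 \<notin> \<int>\<^sub>\<le>\<^sub>0"
    unfolding e(1) unfolding z_def using assms by (auto intro!: of_real_notin_nonpos_Ints simp del: of_real_add)
  from Gamma_legendre_duplication[OF this]
  have "complex_of_real (Gamma x * Gamma (x + 1/2)) = complex_of_real (exp ((1 - 2 * x) * ln 2) * sqrt pi * Gamma (2 * x))"
    unfolding e(1,2) unfolding e(3) z_def Gamma_complex_of_real exp_of_real by (simp only: of_real_mult)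
  then show ?thesis
    unfolding of_real_eq_iff by (simp add: powr_def)
qed

section \<open>The cosine series of the fractional coefficients\<close>

context
  fixes \<alpha> :: real
  assumes \<alpha>: "1 < \<alpha>" "\<alpha> < 2"
begin

private definition g :: "nat \<Rightarrow> real" where "g k = frac_coeff \<alpha> (int k)"

private lemma g_rec: "(real k + 1 + \<alpha> / 2) * g (Suc k) = (real k - \<alpha> / 2) * g k"
  using frac_coeff_recurrence[of "int k" \<alpha>] by (simp add: g_def add.commute)

private lemma g_0: "g 0 = Gamma (\<alpha> + 1) / (Gamma (\<alpha> / 2 + 1))\<^sup>2"
  by (simp add: g_def frac_coeff_def power2_eq_square)

private lemma g_0_pos: "g 0 > 0"
  using \<alpha> unfolding g_0 by (intro divide_pos_pos Gamma_real_pos zero_less_power) auto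

text \<open>A telescoping test: by the recurrence, v k - v (k + 1) equals (\<alpha> - 1) k |g k| +
  (\<alpha>/2) |g k| for k \<ge> 1. Since |g k| decays like k^(-\<alpha>-1), this is where \<alpha>
  > 1 enters; it permits termwise differentiation of the cosine series.\<close>

private lemma summable_k_g: "summable (\<lambda>k. real k * \<bar>g k\<bar>)"
proof -
  define v where "v k = (real k + \<alpha> / 2) * (real k * \<bar>g k\<bar>)" for k
  have v0: "v k \<ge> 0" for k
    using \<alpha> by (simp add: v_def)
  have step: "(\<alpha> - 1) * (real k * \<bar>g k\<bar>) \<le> v k - v (Suc k)" if "k \<ge> 1" for k
  proof -
    have "(real k + 1 + \<alpha> / 2) * \<bar>g (Suc k)\<bar> = (real k - \<alpha> / 2) * \<bar>g k\<bar>"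
    proof -
      have "\<bar>(real k + 1 + \<alpha> / 2) * g (Suc k)\<bar> = \<bar>(real k - \<alpha> / 2) * g k\<bar>"
        by (simp only: g_rec)
      moreover have "real k + 1 + \<alpha> / 2 \<ge> 0" "real k - \<alpha> / 2 \<ge> 0"
        using \<alpha> that by auto
      ultimately show ?thesis
        by (simp only: abs_mult abs_of_nonneg)
    qed
    moreover have "v (Suc k) = (real k + 1) * ((real k + 1 + \<alpha> / 2) * \<bar>g (Suc k)\<bar>)"
      by (simp add: v_def algebra_simps)
    ultimately have "v (Suc k) = (real k + 1) * ((real k - \<alpha> / 2) * \<bar>g k\<bar>)"
      by simp
    then have "v k - v (Suc k) = (\<alpha> - 1) * (real k * \<bar>g k\<bar>) + \<alpha> / 2 * \<bar>g k\<bar>"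
      unfolding v_def[of k] by (simp only:) (simp add: field_simps)
    then show ?thesis
      using \<alpha> by simp
  qed
  have tele: "(\<Sum>k=1..<Suc K. (\<alpha> - 1) * (real k * \<bar>g k\<bar>)) \<le> v 1 - v (Suc K)" for K
  proof (induction K)
    case (Suc K)
    then show ?case using step[of "Suc K"] by simp
  qed simp
  have "(\<Sum>k<K. (\<alpha> - 1) * (real k * \<bar>g k\<bar>)) \<le> v 1" for K
  proof (cases K)
    case (Suc m)
    have "(\<Sum>k<K. (\<alpha> - 1) * (real k * \<bar>g k\<bar>)) = (\<Sum>k=1..<Suc m. (\<alpha> - 1) * (real k * \<bar>g k\<bar>))"
      unfolding Suc by (intro sum.mono_neutral_right) (auto simp: not_le)
    then show ?thesis
      using tele[of m] v0[of "Suc m"] by simp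
  qed (simp add: v0)
  then have "summable (\<lambda>k. (\<alpha> - 1) * (real k * \<bar>g k\<bar>))"
    using \<alpha> by (intro summableI_nonneg_bounded[of _ "v 1"]) auto
  then show ?thesis
    using \<alpha> by (simp add: summable_cmult_iff)
qed

private lemma summable_g: "summable (\<lambda>k. \<bar>g k\<bar>)"
proof (rule summable_comparison_test'[OF summable_k_g, of 1])
  fix k :: nat assume "k \<ge> 1"
  then have "1 * \<bar>g k\<bar> \<le> real k * \<bar>g k\<bar>"
    by (intro mult_right_mono) auto
  then show "norm \<bar>g k\<bar> \<le> real k * \<bar>g k\<bar>" by simp
qed

private lemma summable_k_g_Suc: "summable (\<lambda>k. real (Suc k) * \<bar>g (Suc k)\<bar>)"
  using summable_k_g by (subst summable_Suc_iff)

private lemma summable_g_Suc: "summable (\<lambda>k. \<bar>g (Suc k)\<bar>)"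
  using summable_g by (subst summable_Suc_iff)

private lemma summable_bdd:
  fixes x y :: "nat \<Rightarrow> real"
  assumes "summable (\<lambda>k. \<bar>x k\<bar>)" "\<And>k. \<bar>y k\<bar> \<le> 1"
  shows "summable (\<lambda>k. x k * y k)"
proof (rule summable_comparison_test'[OF assms(1), of 0])
  fix k show "norm (x k * y k) \<le> \<bar>x k\<bar>"
    using mult_left_mono[OF assms(2), of "\<bar>x k\<bar>" k] by (simp add: abs_mult)
qed

text \<open>The Fourier series with coefficients \<open>frac_coeff \<alpha> k\<close> over all
  integers, folded by their evenness in k.\<close>

private definition T :: "real \<Rightarrow> real" where
  "T t = g 0 + 2 * (\<Sum>k. g (Suc k) * cos (real (Suc k) * t))"

private abbreviation g_sin :: "nat \<Rightarrow> real \<Rightarrow> real" where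
  "g_sin k t \<equiv> real (Suc k) * g (Suc k) * sin (real (Suc k) * t)"

private abbreviation g_cos :: "nat \<Rightarrow> real \<Rightarrow> real" where
  "g_cos k t \<equiv> g (Suc k) * cos (real (Suc k) * t)"

private lemma T_deriv:
  "(T has_real_derivative - 2 * (\<Sum>k. g_sin k t)) (at t)"
proof -
  have "((\<lambda>t. \<Sum>k. g_cos k t) has_real_derivative
      (\<Sum>k. - (g_sin k t))) (at t)"
  proof (rule has_field_derivative_series'(2)[of UNIV])
    show "uniformly_convergent_on UNIV (\<lambda>n x. \<Sum>k<n. - (g_sin k x))"
    proof (rule Weierstrass_m_test'[OF _ summable_k_g_Suc])
      fix k and x :: real
      have "\<bar>real (Suc k) * g (Suc k)\<bar> * \<bar>sin (real (Suc k) * x)\<bar> \<le> \<bar>real (Suc k) * g (Suc k)\<bar> * 1"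
        by (intro mult_left_mono) auto
      then show "norm (- (g_sin k x)) \<le> real (Suc k) * \<bar>g (Suc k)\<bar>"
        by (simp add: abs_mult)
    qed
    show "summable (\<lambda>k. g_cos k 0)"
      using summable_rabs_cancel[OF summable_g_Suc] by simp
    fix k and x :: real
    show "((\<lambda>t. g_cos k t) has_field_derivative
        - (g_sin k x)) (at x within UNIV)"
      by (auto intro!: derivative_eq_intros)
  qed auto
  also have "(\<Sum>k. - (g_sin k t))
      = - (\<Sum>k. g_sin k t)"
    by (rule suminf_minus, rule summable_bdd)
      (use summable_k_g_Suc in \<open>auto simp: abs_mult simp del: of_nat_Suc\<close>)
  finally show ?thesis
    unfolding T_def[abs_def] by (auto intro!: derivative_eq_intros simp del: of_nat_Suc)
qed

private lemma T_continuous: "continuous_on A T"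
  using T_deriv DERIV_continuous continuous_at_imp_continuous_on by blast

text \<open>With \<open>c k\<close> = cos ((k + 1/2) t), the factors 2 sin (t/2) and 2 cos (t/2)
  turn the sine and cosine series into differences and sums of neighbouring \<open>c k\<close>.
  After an index shift both sides are multiples of one series with coefficients g k + g (k + 1),
  because the recurrence says (k + 1) g (k + 1) - k g k = -(\<alpha>/2) (g k + g (k + 1)).\<close>

private lemma T_ODE:
  "2 * sin (t / 2) * (- 2 * (\<Sum>k. g_sin k t))
    = \<alpha> * cos (t / 2) * T t"
proof -
  define c where "c k = cos ((real k + 1/2) * t)" for k
  have c1: "\<bar>c k\<bar> \<le> 1" for k by (simp add: c_def)
  have ss: "2 * sin (t / 2) * sin (real (Suc k) * t) = c k - c (Suc k)" for k
  proof -
    have "c k = cos (real (Suc k) * t - t / 2)" "c (Suc k) = cos (real (Suc k) * t + t / 2)"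
      by (simp_all add: c_def algebra_simps)
    then show ?thesis by (simp only: cos_diff cos_add) simp
  qed
  have cc: "2 * cos (t / 2) * cos (real (Suc k) * t) = c k + c (Suc k)" for k
  proof -
    have "c k = cos (real (Suc k) * t - t / 2)" "c (Suc k) = cos (real (Suc k) * t + t / 2)"
      by (simp_all add: c_def algebra_simps)
    then show ?thesis by (simp only: cos_diff cos_add) simp
  qed
  have s1: "summable (\<lambda>k. real (Suc k) * g (Suc k) * c k)"
    and s1': "summable (\<lambda>k. real (Suc k) * g (Suc k) * c (Suc k))"
    and s1s: "summable (\<lambda>k. g_sin k t)"
    using summable_k_g_Suc c1
    by (auto intro!: summable_bdd simp: abs_mult simp del: of_nat_Suc)
  have s2: "summable (\<lambda>k. g (Suc k) * c k)" and s2': "summable (\<lambda>k. g (Suc k) * c (Suc k))"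
    and s2c: "summable (\<lambda>k. g_cos k t)"
    and s3: "summable (\<lambda>k. g k * c k)"
    using summable_g_Suc summable_g c1 by (auto intro!: summable_bdd simp del: of_nat_Suc)
  have s4: "summable (\<lambda>k. real k * g k * c k)"
    using summable_k_g c1 by (auto intro!: summable_bdd simp: abs_mult)
  have "2 * sin (t / 2) * (\<Sum>k. g_sin k t)
      = (\<Sum>k. real (Suc k) * g (Suc k) * c k - real (Suc k) * g (Suc k) * c (Suc k))"
    unfolding suminf_mult[OF s1s, symmetric] right_diff_distrib[symmetric] ss[symmetric] by (simp only: mult_ac)
  also have "\<dots> = (\<Sum>k. real (Suc k) * g (Suc k) * c k) - (\<Sum>k. real (Suc k) * g (Suc k) * c (Suc k))"
    by (rule suminf_diff[OF s1 s1', symmetric])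
  also have "(\<Sum>k. real (Suc k) * g (Suc k) * c (Suc k)) = (\<Sum>k. real k * g k * c k)"
    using suminf_split_head[OF s4] by simp
  also have "(\<Sum>k. real (Suc k) * g (Suc k) * c k) - (\<Sum>k. real k * g k * c k)
      = (\<Sum>k. (real (Suc k) * g (Suc k) - real k * g k) * c k)"
    unfolding suminf_diff[OF s1 s4] by (simp only: left_diff_distrib)
  also have "\<dots> = (\<Sum>k. - (\<alpha> / 2) * (g k * c k + g (Suc k) * c k))"
  proof (rule suminf_cong)
    fix k
    have "real (Suc k) * g (Suc k) - real k * g k = - (\<alpha> / 2) * (g k + g (Suc k))"
      using g_rec[of k] by (simp add: algebra_simps)
    then show "(real (Suc k) * g (Suc k) - real k * g k) * c k = - (\<alpha> / 2) * (g k * c k + g (Suc k) * c k)"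
      by (simp only:) (simp add: algebra_simps)
  qed
  also have "\<dots> = - (\<alpha> / 2) * ((\<Sum>k. g k * c k) + (\<Sum>k. g (Suc k) * c k))"
    using suminf_mult[OF summable_add[OF s3 s2], of "- (\<alpha> / 2)"] suminf_add[OF s3 s2] by simp
  finally have L: "2 * sin (t / 2) * (\<Sum>k. g_sin k t)
      = - (\<alpha> / 2) * ((\<Sum>k. g k * c k) + (\<Sum>k. g (Suc k) * c k))" .
  have "cos (t / 2) * T t = g 0 * c 0 + 2 * cos (t / 2) * (\<Sum>k. g_cos k t)"
    by (simp add: T_def c_def algebra_simps)
  also have "2 * cos (t / 2) * (\<Sum>k. g_cos k t) = (\<Sum>k. g (Suc k) * c k + g (Suc k) * c (Suc k))"
    unfolding suminf_mult[OF s2c, symmetric] distrib_left[symmetric] cc[symmetric] by (simp only: mult_ac)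
  also have "\<dots> = (\<Sum>k. g (Suc k) * c k) + (\<Sum>k. g (Suc k) * c (Suc k))"
    by (rule suminf_add[OF s2 s2', symmetric])
  \<comment> \<open>The shift leaves out \<open>g 0 * c 0\<close>, which is exactly what the
    constant term of \<open>T\<close> contributes.\<close>
  also have "(\<Sum>k. g (Suc k) * c (Suc k)) = (\<Sum>k. g k * c k) - g 0 * c 0"
    using suminf_split_head[OF s3] by simp
  finally have R: "cos (t / 2) * T t = (\<Sum>k. g k * c k) + (\<Sum>k. g (Suc k) * c k)" by simp
  show ?thesis
    using L R by (simp add: mult.assoc)
qed

text \<open>The constant is fixed afterwards by comparing mean values, through the Beta integral.\<close>

private lemma T_proportional:
  "\<exists>C. \<forall>t\<in>{0<..<2*pi}. T t = C * (2 * sin (t / 2)) powr \<alpha>"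
proof -
  have "\<exists>C. \<forall>t\<in>{0<..<2*pi}. T t * (2 * sin (t / 2)) powr (- \<alpha>) = C"
  proof (rule has_field_derivative_zero_constant)
    fix t assume th: "t \<in> {0<..<2*pi}"
    define D where "D = - 2 * (\<Sum>k. g_sin k t)"
    have TD: "(T has_real_derivative D) (at t)"
      unfolding D_def by (rule T_deriv)
    have s: "sin (t / 2) > 0"
      using th by (intro sin_gt_zero) auto
    have "((\<lambda>t. T t * (2 * sin (t / 2)) powr (- \<alpha>)) has_real_derivative
        D * (2 * sin (t / 2)) powr (- \<alpha>)
        + T t * (- \<alpha> * (2 * sin (t / 2)) powr (- \<alpha> - 1) * cos (t / 2))) (at t)"
      using s by (auto intro!: derivative_eq_intros TD)
    also have "D * (2 * sin (t / 2)) powr (- \<alpha>)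
        = (2 * sin (t / 2) * D) * (2 * sin (t / 2)) powr (- \<alpha> - 1)"
      using s by (simp add: powr_diff)
    also have "2 * sin (t / 2) * D = \<alpha> * cos (t / 2) * T t"
      unfolding D_def by (rule T_ODE)
    finally show "((\<lambda>t. T t * (2 * sin (t / 2)) powr (- \<alpha>)) has_field_derivative 0) (at t within {0<..<2*pi})"
      by (simp add: algebra_simps has_field_derivative_at_within)
  qed simp
  then obtain C where C: "\<And>t. t \<in> {0<..<2*pi} \<Longrightarrow> T t * (2 * sin (t / 2)) powr (- \<alpha>) = C"
    by auto
  have "T t = C * (2 * sin (t / 2)) powr \<alpha>" if "t \<in> {0<..<2*pi}" for t
  proof -
    have "sin (t / 2) > 0"
      using that by (intro sin_gt_zero) auto
    then show ?thesis
      unfolding C[OF that, symmetric] by (simp add: powr_minus field_simps)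
  qed
  then show ?thesis by blast
qed

text \<open>Termwise integration: the sines in the antiderivative vanish at 0 and pi, so only the
  constant term remains.\<close>

private lemma T_integral: "(T has_integral pi * g 0) {0..pi}"
proof -
  define P where "P t = g 0 * t + 2 * (\<Sum>k. g (Suc k) / real (Suc k) * sin (real (Suc k) * t))" for t
  have "(P has_real_derivative T t) (at t)" for t
  proof -
    have "((\<lambda>t. \<Sum>k. g (Suc k) / real (Suc k) * sin (real (Suc k) * t)) has_real_derivative
        (\<Sum>k. g_cos k t)) (at t)"
    proof (rule has_field_derivative_series'(2)[of UNIV])
      show "uniformly_convergent_on UNIV (\<lambda>n x. \<Sum>k<n. g_cos k x)"
      proof (rule Weierstrass_m_test'[OF _ summable_g_Suc])
        fix k and x :: real
        have "\<bar>g (Suc k)\<bar> * \<bar>cos (real (Suc k) * x)\<bar> \<le> \<bar>g (Suc k)\<bar> * 1"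
          by (intro mult_left_mono) auto
        then show "norm (g_cos k x) \<le> \<bar>g (Suc k)\<bar>"
          by (simp add: abs_mult)
      qed
      show "summable (\<lambda>k. g (Suc k) / real (Suc k) * sin (real (Suc k) * 0))"
        by simp
      fix k and x :: real
      show "((\<lambda>t. g (Suc k) / real (Suc k) * sin (real (Suc k) * t)) has_field_derivative
          g_cos k x) (at x within UNIV)"
        by (auto intro!: derivative_eq_intros simp del: of_nat_Suc)
    qed auto
    then show ?thesis
      unfolding P_def[abs_def] T_def by (auto intro!: derivative_eq_intros simp del: of_nat_Suc)
  qed
  then have "(T has_integral P pi - P 0) {0..pi}"
    by (intro fundamental_theorem_of_calculus)
      (auto simp: has_real_derivative_iff_has_vector_derivative[symmetric] intro: has_field_derivative_at_within)
  moreover have "P pi - P 0 = pi * g 0"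
    by (simp add: P_def del: of_nat_Suc)
  ultimately show ?thesis by simp
qed

private lemma T_eq_Ioo:
  assumes "t \<in> {0<..<2*pi}"
  shows "T t = (2 * sin (t / 2)) powr \<alpha>"
proof -
  obtain C where C: "\<And>t. t \<in> {0<..<2*pi} \<Longrightarrow> T t = C * (2 * sin (t / 2)) powr \<alpha>"
    using T_proportional by blast
  define B where "B = Beta ((\<alpha> + 1) / 2) (1/2)"
  have "((\<lambda>t. C * 2 powr \<alpha> * sin (t / 2) powr \<alpha>) has_integral C * 2 powr \<alpha> * B) {0<..<pi}"
    using \<alpha> by (intro has_integral_mult_right)
      (use sin_powr_integral[of \<alpha>] in \<open>simp add: B_def has_integral_Icc_iff_Ioo\<close>)
  moreover have "C * 2 powr \<alpha> * sin (t / 2) powr \<alpha> = T t" if "t \<in> {0<..<pi}" for t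
    using that sin_gt_zero[of "t / 2"] by (subst C) (auto simp: powr_mult)
  ultimately have TI: "(T has_integral C * 2 powr \<alpha> * B) {0<..<pi}"
    using has_integral_cong[of "{0<..<pi}" "\<lambda>t. C * 2 powr \<alpha> * sin (t / 2) powr \<alpha>" T] by blast
  then have CB: "C * (2 powr \<alpha> * B) = pi * g 0"
    using has_integral_unique[OF TI T_integral[unfolded has_integral_Icc_iff_Ioo]] by (simp add: mult.assoc)
  \<comment> \<open>The mean value of (2 sin (t/2))^\<alpha> is \<open>g 0\<close> too: with Beta
    written through Gamma, the duplication formula at (\<alpha> + 1) / 2 produces the factor Gamma
    (\<alpha> + 1) of \<open>g 0\<close>.\<close>
  have "2 powr \<alpha> * B = pi * g 0"
  proof -
    have dup: "Gamma ((\<alpha> + 1) / 2) * Gamma (\<alpha> / 2 + 1) = 2 powr (- \<alpha>) * sqrt pi * Gamma (\<alpha> + 1)"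
    proof -
      have "(\<alpha> + 1) / 2 + 1 / 2 = \<alpha> / 2 + 1" "2 * ((\<alpha> + 1) / 2) = \<alpha> + 1" "1 - (\<alpha> + 1) = - \<alpha>"
        by (simp_all add: field_simps)
      then show ?thesis
        using Gamma_legendre_duplication_real[of "(\<alpha> + 1) / 2"] \<alpha> by (simp only:)
    qed
    have nz: "Gamma (\<alpha> / 2 + 1) > 0"
      using \<alpha> by (intro Gamma_real_pos) auto
    have "B = Gamma ((\<alpha> + 1) / 2) * sqrt pi / Gamma (\<alpha> / 2 + 1)"
    proof -
      have "(\<alpha> + 1) / 2 + 1 / 2 = \<alpha> / 2 + 1"
        by (simp add: field_simps)
      then show ?thesis
        by (simp add: B_def Beta_def Gamma_one_half_real)
    qed
    also have "\<dots> = (Gamma ((\<alpha> + 1) / 2) * Gamma (\<alpha> / 2 + 1)) * sqrt pi / (Gamma (\<alpha> / 2 + 1))\<^sup>2"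
      using nz by (simp add: power2_eq_square)
    also have "\<dots> = 2 powr (- \<alpha>) * pi * g 0"
      unfolding dup g_0 by simp
    finally show ?thesis
      by (simp add: powr_minus)
  qed
  then have "C = 1"
    using CB g_0_pos by simp
  then show ?thesis
    using C[OF assms] by simp
qed

private lemma T_0: "T 0 = 0"
proof (rule tendsto_unique)
  show "(T \<longlongrightarrow> T 0) (at_right 0)"
    using T_continuous[of UNIV] by (simp add: continuous_on_eq_continuous_at isCont_def filterlim_at_split)
  have "((\<lambda>t. (2 * sin (t / 2)) powr \<alpha>) \<longlongrightarrow> 0) (at_right 0)"
  proof (rule tendsto_zero_powrI)
    have "((\<lambda>t::real. 2 * sin (t / 2)) \<longlongrightarrow> 2 * sin (0 / 2)) (at_right 0)"
      by (intro tendsto_intros) auto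
    then show "((\<lambda>t::real. 2 * sin (t / 2)) \<longlongrightarrow> 0) (at_right 0)" by simp
    show "eventually (\<lambda>t::real. 0 \<le> 2 * sin (t / 2)) (at_right 0)"
      using eventually_at_right_real[of 0 pi] by (rule eventually_mono) (auto intro!: sin_ge_zero)
  qed (use \<alpha> in auto)
  then show "(T \<longlongrightarrow> 0) (at_right 0)"
  proof (rule Lim_transform_eventually)
    show "eventually (\<lambda>t. (2 * sin (t / 2)) powr \<alpha> = T t) (at_right 0)"
      using eventually_at_right_real[of 0 "2*pi"] by (rule eventually_mono) (auto simp: T_eq_Ioo)
  qed
qed simp

text \<open>Both sides have period 2 pi, as sin (t/2) changes only its sign; on one period the
  formula is known inside, and \<open>T_0\<close> covers the left end.\<close>

private lemma T_eq: "T t = frac_symbol \<alpha> t"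
proof -
  define m where "m = \<lfloor>t / (2 * pi)\<rfloor>"
  define \<phi> where "\<phi> = t - 2 * pi * of_int m"
  have "of_int m \<le> t / (2 * pi)" "t / (2 * pi) < of_int m + 1"
    unfolding m_def by linarith+
  then have \<phi>: "0 \<le> \<phi>" "\<phi> < 2 * pi"
    by (simp_all add: \<phi>_def field_simps)
  have "cos (real (Suc k) * \<phi>) = cos (real (Suc k) * t)" for k
  proof -
    have "real (Suc k) * \<phi> = real (Suc k) * t - 2 * pi * of_int (int (Suc k) * m)"
      by (simp add: \<phi>_def algebra_simps)
    then show ?thesis
      by (simp only: cos_diff cos_integer_2pi sin_integer_2pi Ints_of_int)
  qed
  then have "T t = T \<phi>"
    by (simp add: T_def)
  moreover have "\<bar>2 * sin (\<phi> / 2)\<bar> = \<bar>2 * sin (t / 2)\<bar>"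
  proof -
    have "\<phi> / 2 = t / 2 - pi * of_int m"
      by (simp add: \<phi>_def field_simps)
    then show ?thesis
      by (simp only: sin_diff sin_npi_int cos_npi_int) simp
  qed
  moreover have "T \<phi> = frac_symbol \<alpha> \<phi>"
  proof (cases "\<phi> = 0")
    case True
    then show ?thesis using T_0 \<alpha> by simp
  next
    case False
    then have "\<phi> \<in> {0<..<2*pi}" using \<phi> by auto
    moreover from this have "sin (\<phi> / 2) > 0" by (intro sin_gt_zero) auto
    ultimately show ?thesis by (simp add: T_eq_Ioo)
  qed
  ultimately show ?thesis by simp
qed

private lemma int_split: "(UNIV :: int set) = range int \<union> range (\<lambda>k. - int (Suc k))" "range int \<inter> range (\<lambda>k. - int (Suc k)) = {}"
proof -
  have "x \<in> range int \<union> range (\<lambda>k. - int (Suc k))" for x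
    by (cases x rule: int_cases) auto
  then show "(UNIV :: int set) = range int \<union> range (\<lambda>k. - int (Suc k))" by blast
  show "range int \<inter> range (\<lambda>k. - int (Suc k)) = {}" by auto
qed

private lemma g_neg: "frac_coeff \<alpha> (- int (Suc k)) = g (Suc k)"
  unfolding frac_coeff_minus g_def ..

lemma frac_coeff_abs_summable: "(\<lambda>k. \<bar>frac_coeff \<alpha> k\<bar>) summable_on UNIV"
  unfolding int_split(1)
proof (rule summable_on_Un_disjoint[OF _ _ int_split(2)])
  show "(\<lambda>k. \<bar>frac_coeff \<alpha> k\<bar>) summable_on range int"
    using summable_g by (subst summable_on_reindex) (auto simp: o_def summable_on_UNIV_nonneg_real_iff g_def)
  show "(\<lambda>k. \<bar>frac_coeff \<alpha> k\<bar>) summable_on range (\<lambda>k. - int (Suc k))"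
    using summable_g_Suc
    by (subst summable_on_reindex) (auto simp: o_def summable_on_UNIV_nonneg_real_iff g_neg inj_def simp del: of_nat_Suc)
qed

text \<open>Absolute summability splits the unordered sum into two ordinary series, over k \<ge> 0
  and k < 0, whose terms of opposite index add up to cosines.\<close>

lemma frac_coeff_symbol:
  "((\<lambda>k. of_real (frac_coeff \<alpha> k) * cis (of_int k * t)) has_sum
      complex_of_real (frac_symbol \<alpha> t)) UNIV"
proof -
  define p where "p k = of_real (g k) * cis (real k * t)" for k
  define q where "q k = complex_of_real (g (Suc k)) * cis (- (real (Suc k) * t))" for k
  have p: "summable (\<lambda>k. norm (p k))" and q: "summable (\<lambda>k. norm (q k))"
    using summable_g summable_g_Suc by (simp_all add: p_def q_def norm_mult)
  have "((\<lambda>k. of_real (frac_coeff \<alpha> k) * cis (of_int k * t)) has_sum suminf p) (range int)"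
    using norm_summable_imp_has_sum[OF p summable_sums[OF summable_norm_cancel[OF p]]]
    by (subst has_sum_reindex) (auto simp: o_def p_def[abs_def] g_def)
  moreover have "((\<lambda>k. of_real (frac_coeff \<alpha> k) * cis (of_int k * t)) has_sum suminf q) (range (\<lambda>k. - int (Suc k)))"
    using norm_summable_imp_has_sum[OF q summable_sums[OF summable_norm_cancel[OF q]]]
    by (subst has_sum_reindex) (auto simp: o_def q_def[abs_def] g_neg inj_def simp del: of_nat_Suc)
  ultimately have "((\<lambda>k. of_real (frac_coeff \<alpha> k) * cis (of_int k * t)) has_sum (suminf p + suminf q)) UNIV"
    unfolding int_split(1) by (rule has_sum_Un_disjoint[OF _ _ int_split(2)])
  moreover have "suminf p + suminf q = complex_of_real (T t)"
  proof -
    have "suminf p = p 0 + (\<Sum>k. p (Suc k))"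
      using suminf_split_head[OF summable_norm_cancel[OF p]] by simp
    moreover have "summable (\<lambda>k. p (Suc k))"
      using summable_norm_cancel[OF p] by (subst summable_Suc_iff)
    ultimately have "suminf p + suminf q = p 0 + (\<Sum>k. p (Suc k) + q k)"
      using suminf_add[OF _ summable_norm_cancel[OF q]] by simp
    also have "(\<lambda>k. p (Suc k) + q k) = (\<lambda>k. complex_of_real (2 * (g (Suc k) * cos (real (Suc k) * t))))"
      by (rule ext) (simp add: p_def q_def complex_eq_iff del: of_nat_Suc)
    also have "(\<Sum>k. complex_of_real (2 * (g (Suc k) * cos (real (Suc k) * t))))
        = complex_of_real (\<Sum>k. 2 * (g (Suc k) * cos (real (Suc k) * t)))"
      by (rule suminf_of_real[symmetric], rule summable_mult, rule summable_bdd[OF summable_g_Suc]) simp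
    also have "(\<Sum>k. 2 * (g (Suc k) * cos (real (Suc k) * t))) = 2 * (\<Sum>k. g (Suc k) * cos (real (Suc k) * t))"
      by (rule suminf_mult, rule summable_bdd[OF summable_g_Suc]) simp
    finally show ?thesis
      by (simp add: T_def p_def[of 0])
  qed
  ultimately show ?thesis
    by (simp add: T_eq)
qed

end

section \<open>Fourier transform and the Riesz potential\<close>

text \<open>The explicit integrals are gauge integrals, whereas Fubini and dominated convergence act
  on Bochner integrals; nonnegativity is the bridge.\<close>

lemma has_bochner_integral_nonneg_has_integral:
  fixes f :: "real \<Rightarrow> real"
  assumes [measurable]: "f \<in> borel_measurable borel" "S \<in> sets borel"
    and nn: "\<And>x. x \<in> S \<Longrightarrow> f x \<ge> 0" and I: "(f has_integral I) S"
  shows "has_bochner_integral lborel (\<lambda>x. if x \<in> S then f x else 0) I"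
proof (rule has_bochner_integral_nn_integral)
  have "((\<lambda>x. if x \<in> S then f x else 0) has_integral I) UNIV"
    using I by (simp add: has_integral_restrict_UNIV)
  then show "(\<integral>\<^sup>+ x. ennreal (if x \<in> S then f x else 0) \<partial>lborel) = ennreal I"
    using nn by (intro nn_integral_has_integral_lborel) auto
  show "0 \<le> I"
    using I nn by (rule has_integral_nonneg)
qed (use nn in auto)

lemma has_bochner_integral_Gamma:
  fixes p s :: real
  assumes "p > 0" "s > 0"
  shows "has_bochner_integral lborel (\<lambda>\<tau>. if \<tau> \<in> {0<..} then \<tau> powr (p - 1) * exp (- (\<tau> * s)) else 0) (Gamma p * s powr (- p))"
proof -
  define g where "g \<tau> = (if \<tau> \<in> {0<..} then \<tau> powr (p - 1) / exp \<tau> else 0)" for \<tau> :: real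
  have "((\<lambda>t. t powr (p - 1) / exp t) has_integral Gamma p) {0<..}"
  proof (rule has_integral_spike_set_eq[THEN iffD1, OF _ _ Gamma_integral_real[OF assms(1)]])
    have "{x \<in> {0..} - {0<..}. x powr (p - 1) / exp x \<noteq> 0} = {}"
      "{x \<in> {0<..} - {0..}. x powr (p - 1) / exp x \<noteq> 0} = {}" by auto
    then show "negligible {x \<in> {0..} - {0<..}. x powr (p - 1) / exp x \<noteq> 0}"
      "negligible {x \<in> {0<..} - {0..}. x powr (p - 1) / exp x \<noteq> 0}"
      by (simp_all only: negligible_empty)
  qed
  then have "has_bochner_integral lborel g (Gamma p)"
    unfolding g_def[abs_def] by (intro has_bochner_integral_nonneg_has_integral) auto
  then have "has_bochner_integral lborel (\<lambda>\<tau>. g (0 + s * \<tau>)) (Gamma p /\<^sub>R \<bar>s\<bar>)"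
    using assms(2) by (subst (asm) lborel_has_bochner_integral_real_affine_iff[of s _ _ 0]) auto
  then have "has_bochner_integral lborel (\<lambda>\<tau>. s powr (1 - p) * g (0 + s * \<tau>)) (s powr (1 - p) * (Gamma p /\<^sub>R \<bar>s\<bar>))"
    by (rule has_bochner_integral_mult_right)
  moreover have "(\<lambda>\<tau>. s powr (1 - p) * g (0 + s * \<tau>))
      = (\<lambda>\<tau>. if \<tau> \<in> {0<..} then \<tau> powr (p - 1) * exp (- (\<tau> * s)) else 0)"
  proof
    fix \<tau>
    have "s powr (1 - p) * s powr (p - 1) = 1"
      using assms by (simp flip: powr_add)
    then show "s powr (1 - p) * g (0 + s * \<tau>) = (if \<tau> \<in> {0<..} then \<tau> powr (p - 1) * exp (- (\<tau> * s)) else 0)"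
      using assms by (auto simp: g_def zero_less_mult_iff powr_mult exp_minus field_simps)
  qed
  moreover have "s powr (1 - p) * (Gamma p /\<^sub>R \<bar>s\<bar>) = Gamma p * s powr (- p)"
    using assms by (simp add: powr_diff powr_minus field_simps)
  ultimately show ?thesis
    by (simp only:)
qed

text \<open>The substitution \<tau> -> 1/\<tau> in the Gamma integral. It is needed because the
  transform turns a Gaussian with parameter \<tau> into one with parameter 1/(4 \<tau>), so this is
  the integral that arises on the frequency side.\<close>

lemma has_bochner_integral_Gamma_inverse:
  fixes p s :: real
  assumes "p > 0" "s > 0"
  shows "has_bochner_integral lborel (\<lambda>\<tau>. if \<tau> \<in> {0<..} then \<tau> powr (- p - 1) * exp (- (s / \<tau>)) else 0) (Gamma p * s powr (- p))"
proof -
  define f where "f t = t powr (p - 1) * exp (- (t * s))" for t :: real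
  define q where "q \<tau> = 1 / \<tau>" for \<tau> :: real
  define S where "S = {0::real<..}"
  have hb: "has_bochner_integral lborel (\<lambda>\<tau>. if \<tau> \<in> S then f \<tau> else 0) (Gamma p * s powr (- p))"
    using has_bochner_integral_Gamma[OF assms] by (simp add: f_def S_def cong: if_cong)
  have "((\<lambda>\<tau>. if \<tau> \<in> S then f \<tau> else 0) has_integral (Gamma p * s powr (- p))) UNIV"
    using has_integral_integral_lborel[of "\<lambda>\<tau>. if \<tau> \<in> S then f \<tau> else 0"] hb
    by (simp add: has_bochner_integral_iff)
  then have fI: "(f has_integral (Gamma p * s powr (- p))) S"
    by (simp add: has_integral_restrict_UNIV)
  have im: "q ` S = S"
  proof (intro equalityI subsetI)
    fix y assume "y \<in> S"
    then have "y = q (1 / y)" "1 / y \<in> S" by (auto simp: q_def S_def)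
    then show "y \<in> q ` S" by blast
  qed (auto simp: q_def S_def)
  have f_abs: "f absolutely_integrable_on S"
    using fI by (intro nonnegative_absolutely_integrable_1) (auto simp: f_def)
  have "(\<lambda>x. \<bar>- (1 / x\<^sup>2)\<bar> * f (q x)) absolutely_integrable_on S \<and>
      integral S (\<lambda>x. \<bar>- (1 / x\<^sup>2)\<bar> * f (q x)) = Gamma p * s powr (- p)"
  proof (rule has_absolute_integral_change_of_variables_1'[where g = q and g' = "\<lambda>x. - (1 / x\<^sup>2)" and f = f and S = S, THEN iffD2])
    show "S \<in> sets lebesgue" by (simp add: S_def)
    show "(q has_field_derivative - (1 / x\<^sup>2)) (at x within S)" if "x \<in> S" for x
      using that unfolding q_def[abs_def] S_def by (auto intro!: derivative_eq_intros simp: power2_eq_square)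
    show "inj_on q S"
      by (auto simp: inj_on_def q_def)
    show "f absolutely_integrable_on q ` S \<and> integral (q ` S) f = Gamma p * s powr (- p)"
      using fI f_abs by (simp add: im integral_unique)
  qed
  then have "((\<lambda>x. \<bar>- (1 / x\<^sup>2)\<bar> * f (q x)) has_integral (Gamma p * s powr (- p))) S"
    using absolutely_integrable_on_def has_integral_iff by blast
  moreover have "\<bar>- (1 / x\<^sup>2)\<bar> * f (q x) = x powr (- p - 1) * exp (- (s / x))" if "x \<in> S" for x
  proof -
    have "x > 0" using that by (simp add: S_def)
    then show ?thesis
      by (simp add: f_def q_def powr_divide powr_diff powr_minus power2_eq_square field_simps)
  qed
  ultimately have "((\<lambda>x. x powr (- p - 1) * exp (- (s / x))) has_integral (Gamma p * s powr (- p))) S"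
    by (rule has_integral_eq[rotated])
  then show ?thesis
    using has_bochner_integral_nonneg_has_integral[of "\<lambda>x. x powr (- p - 1) * exp (- (s / x))" S]
    by (simp add: S_def)
qed

section \<open>The Fourier transform of integrable functions\<close>

lemma measurable_cis [measurable]: "cis \<in> borel_measurable borel"
  by (intro borel_measurable_continuous_onI continuous_on_cis continuous_on_id)

lemma integrable_mult_cis:
  assumes f: "integrable M f" and [measurable]: "\<phi> \<in> borel_measurable M"
  shows "integrable M (\<lambda>x. f x * cis (\<phi> x))"
proof (rule Bochner_Integration.integrable_bound[OF f])
  show "(\<lambda>x. f x * cis (\<phi> x)) \<in> borel_measurable M"
    using borel_measurable_integrable[OF f] by measurable
qed (simp add: norm_mult)

text \<open>Normalised without 1 / (2 pi); that factor appears in the inversion formula and in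
  \<open>multiplier_op\<close>.\<close>

definition fourier :: "(real \<Rightarrow> real) \<Rightarrow> real \<Rightarrow> complex" where
  "fourier f w = (LBINT x. of_real (f x) * cis (- (w * x)))"

lemma fourier_integrable:
  "integrable lborel f \<Longrightarrow> integrable lborel (\<lambda>x. of_real (f x) * cis (w * x + c))"
  by (intro integrable_mult_cis) auto

lemma fourier_measurable [measurable (raw)]:
  assumes "integrable lborel f"
  shows "fourier f \<in> borel_measurable borel"
proof -
  have [measurable]: "f \<in> borel_measurable borel"
    using borel_measurable_integrable[OF assms] by simp
  show ?thesis
    unfolding fourier_def[abs_def] by measurable
qed

lemma fourier_norm_le:
  assumes "integrable lborel f"
  shows "norm (fourier f w) \<le> (LBINT x. \<bar>f x\<bar>)"
proof -
  have "norm (fourier f w) \<le> (LBINT x. norm (of_real (f x) * cis (- (w * x))))"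
    unfolding fourier_def by (rule integral_norm_bound)
  then show ?thesis by (simp add: norm_mult)
qed

lemma integrable_limit_zero:
  fixes \<psi> :: "real \<Rightarrow> 'a :: {banach, second_countable_topology}"
  assumes \<psi>: "integrable lborel \<psi>" and lim: "(\<psi> \<longlongrightarrow> L) at_top"
  shows "L = 0"
proof (rule ccontr)
  assume L: "L \<noteq> 0"
  define c where "c = norm L / 2"
  have c: "c > 0" using L by (simp add: c_def)
  have "((\<lambda>x. norm (\<psi> x)) \<longlongrightarrow> norm L) at_top"
    using lim by (rule tendsto_norm)
  moreover have "c < norm L"
    using L by (simp add: c_def)
  ultimately have "eventually (\<lambda>x. norm (\<psi> x) > c) at_top"
    by (rule order_tendstoD)
  then obtain a where a: "\<And>x. x \<ge> a \<Longrightarrow> norm (\<psi> x) > c"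
    by (auto simp: eventually_at_top_linorder)
  have "c * real n \<le> (LBINT x. norm (\<psi> x))" for n
  proof -
    have "(LBINT x. c * indicator {a..a + real n} x) \<le> (LBINT x. norm (\<psi> x))"
      using \<psi> c a by (intro integral_mono) (auto split: split_indicator intro: less_imp_le)
    then show ?thesis by simp
  qed
  moreover obtain n where "real n > (LBINT x. norm (\<psi> x)) / c"
    using reals_Archimedean2 by blast
  ultimately show False
    using c by (metis mult.commute not_less pos_divide_less_eq)
qed

lemma integral_deriv_interval:
  fixes f f' :: "real \<Rightarrow> 'a :: euclidean_space"
  assumes d: "\<And>x. (f has_vector_derivative f' x) (at x)" and f': "integrable lborel f'" and "a \<le> b"
  shows "(LBINT x. indicator {a..b} x *\<^sub>R f' x) = f b - f a"
proof -
  have si: "set_integrable lborel {a..b} f'"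
    unfolding set_integrable_def using f' by (intro integrable_mult_indicator) auto
  have "(f' has_integral f b - f a) {a..b}"
    using assms(3) d by (intro fundamental_theorem_of_calculus) (auto intro: has_vector_derivative_at_within)
  then show ?thesis
    using set_borel_integral_eq_integral(2)[OF si] by (simp add: set_lebesgue_integral_def integral_unique)
qed

text \<open>No separate limits of f at the two ends are needed: R \<mapsto> f R - f (-R) is
  integrable and tends to the integral of f', and an integrable function can only tend to 0.\<close>

lemma integral_deriv_zero:
  fixes f f' :: "real \<Rightarrow> 'a :: euclidean_space"
  assumes d: "\<And>x. (f has_vector_derivative f' x) (at x)"
    and f: "integrable lborel f" and f': "integrable lborel f'"
  shows "(LBINT x. f' x) = 0"
proof (rule integrable_limit_zero)
  show "integrable lborel (\<lambda>R. f R - f (0 + (-1) * R))"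
    using f by (intro Bochner_Integration.integrable_diff lborel_integrable_real_affine) auto
  have [measurable]: "f' \<in> borel_measurable borel"
    using borel_measurable_integrable[OF f'] by simp
  have "((\<lambda>R. LBINT x. indicator {-R..R} x *\<^sub>R f' x) \<longlongrightarrow> (LBINT x. f' x)) at_top"
  proof (rule integral_dominated_convergence_at_top[where w = "\<lambda>x. norm (f' x)"])
    show "AE x in lborel. ((\<lambda>R. indicator {-R..R} x *\<^sub>R f' x) \<longlongrightarrow> f' x) at_top"
    proof (rule AE_I2)
      fix x
      have "eventually (\<lambda>R. f' x = indicator {-R..R} x *\<^sub>R f' x) at_top"
        using eventually_ge_at_top[of "\<bar>x\<bar>"] by eventually_elim (auto simp: indicator_def)
      then show "((\<lambda>R. indicator {-R..R} x *\<^sub>R f' x) \<longlongrightarrow> f' x) at_top"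
        by (rule tendsto_eventually[OF eventually_mono]) auto
    qed
    show "\<forall>\<^sub>F R in at_top. AE x in lborel. norm (indicator {-R..R} x *\<^sub>R f' x) \<le> norm (f' x)"
      by (intro always_eventually allI AE_I2) (auto split: split_indicator)
  qed (use f' in auto)
  moreover have "eventually (\<lambda>R. (LBINT x. indicator {-R..R} x *\<^sub>R f' x) = f R - f (0 + (-1) * R)) at_top"
    using eventually_ge_at_top[of 0] by eventually_elim (simp add: integral_deriv_interval[OF d f'])
  ultimately show "((\<lambda>R. f R - f (0 + (-1) * R)) \<longlongrightarrow> (LBINT x. f' x)) at_top"
    by (rule Lim_transform_eventually)
qed

lemma bounded_of_integrable_deriv:
  fixes f f' :: "real \<Rightarrow> real"
  assumes d: "\<And>x. (f has_real_derivative f' x) (at x)" and f': "integrable lborel f'"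
  shows "\<bar>f x\<bar> \<le> \<bar>f 0\<bar> + (LBINT x. \<bar>f' x\<bar>)"
proof -
  have d': "(f has_vector_derivative f' x) (at x)" for x
    using d by (simp add: has_real_derivative_iff_has_vector_derivative)
  have "\<bar>f b - f a\<bar> \<le> (LBINT x. \<bar>f' x\<bar>)" if "a \<le> b" for a b
  proof -
    have "\<bar>f b - f a\<bar> \<le> (LBINT x. norm (indicator {a..b} x *\<^sub>R f' x))"
      unfolding integral_deriv_interval[OF d' f' that, symmetric] real_norm_def[symmetric] by (rule integral_norm_bound)
    also have "\<dots> \<le> (LBINT x. \<bar>f' x\<bar>)"
      using f' by (intro integral_mono integrable_norm integrable_mult_indicator) (auto split: split_indicator)
    finally show ?thesis .
  qed
  from this[of 0 x] this[of x 0] show ?thesis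
    by (cases "0 \<le> x") auto
qed

text \<open>Integration by parts without boundary terms: the derivative of f(x) e^(-iwx) is
  integrable, so its integral is 0.\<close>

lemma fourier_deriv:
  fixes f f' :: "real \<Rightarrow> real"
  assumes d: "\<And>x. (f has_real_derivative f' x) (at x)" and f: "integrable lborel f" and f': "integrable lborel f'"
  shows "fourier f' w = \<i> * of_real w * fourier f w"
proof -
  have i1: "integrable lborel (\<lambda>x. of_real (f x) * cis (- (w * x)))"
    using fourier_integrable[OF f, of "- w" 0] by simp
  have i2: "integrable lborel (\<lambda>x. of_real (f' x) * cis (- (w * x)))"
    using fourier_integrable[OF f', of "- w" 0] by simp
  have "(LBINT x. of_real (f' x) * cis (- (w * x)) + (- \<i> * of_real w) * (of_real (f x) * cis (- (w * x)))) = 0"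
  proof (rule integral_deriv_zero[OF _ i1])
    show "((\<lambda>x. of_real (f x) * cis (- (w * x))) has_vector_derivative
        of_real (f' x) * cis (- (w * x)) + (- \<i> * of_real w) * (of_real (f x) * cis (- (w * x)))) (at x)" for x
    proof -
      have "((\<lambda>x. complex_of_real (f x)) has_vector_derivative complex_of_real (f' x)) (at x)"
        using d[of x] by (intro has_vector_derivative_of_real) (simp add: has_real_derivative_iff_has_vector_derivative)
      moreover have "((\<lambda>x. cis (- (w * x))) has_vector_derivative (- w) *\<^sub>R (\<i> * cis (- (w * x)))) (at x)"
        by (auto intro!: derivative_eq_intros simp: has_vector_derivative_def)
      ultimately show ?thesis
        by (rule has_vector_derivative_eq_rhs[OF has_vector_derivative_mult]) (simp add: scaleR_conv_of_real algebra_simps)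
    qed
    show "integrable lborel (\<lambda>x. of_real (f' x) * cis (- (w * x)) + (- \<i> * of_real w) * (of_real (f x) * cis (- (w * x))))"
      using i1 i2 by (intro Bochner_Integration.integrable_add integrable_mult_right) auto
  qed
  then show ?thesis
    using i1 i2 by (simp add: fourier_def)
qed

text \<open>Within distance 1 of the singularity B |x - y|^(-\<beta>) dominates, beyond it |f| does.
  The estimate is applied twice: to f with \<beta> = \<alpha> - 1, and on the frequency side to
  |\<open>fourier f\<close>| with \<beta> = 2 - \<alpha>.\<close>

lemma integrable_riesz_kernel:
  fixes f :: "real \<Rightarrow> real"
  assumes f: "integrable lborel f" and B: "\<And>x. \<bar>f x\<bar> \<le> B" and \<beta>: "0 < \<beta>" "\<beta> < 1"
  shows "integrable lborel (\<lambda>y. f y / \<bar>x - y\<bar> powr \<beta>)"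
proof -
  define w where "w s = (if s \<in> {0..1} then s powr (- \<beta>) else 0)" for s :: real
  have [measurable]: "f \<in> borel_measurable borel"
    using borel_measurable_integrable[OF f] by simp
  have "has_bochner_integral lborel w (1 powr (- \<beta> + 1) / (- \<beta> + 1))"
    unfolding w_def[abs_def] using \<beta>
    by (intro has_bochner_integral_nonneg_has_integral has_integral_powr_from_0) auto
  then have w: "integrable lborel w"
    by (simp add: has_bochner_integral_iff)
  have B0: "B \<ge> 0" using B[of 0] by simp
  let ?D = "\<lambda>y. \<bar>f y\<bar> + B * (w (x + (-1) * y) + w (- x + 1 * y))"
  show ?thesis
  proof (rule Bochner_Integration.integrable_bound)
    show "integrable lborel (\<lambda>y. ?D y)"
      using f w by (intro Bochner_Integration.integrable_add integrable_mult_right integrable_abs lborel_integrable_real_affine) auto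
    show "AE y in lborel. norm (f y / \<bar>x - y\<bar> powr \<beta>) \<le> norm (?D y)"
    proof (rule AE_I2)
      fix y
      have w0: "w s \<ge> 0" for s by (simp add: w_def)
      have "\<bar>f y\<bar> / \<bar>x - y\<bar> powr \<beta> \<le> ?D y"
      proof (cases "\<bar>x - y\<bar> \<le> 1")
        case True
        have "\<bar>x - y\<bar> powr (- \<beta>) \<le> w (x + (-1) * y) + w (- x + 1 * y)"
          using True by (auto simp: w_def abs_if)
        then have "\<bar>f y\<bar> * \<bar>x - y\<bar> powr (- \<beta>) \<le> B * (w (x + (-1) * y) + w (- x + 1 * y))"
          using B B0 by (intro mult_mono) auto
        then show ?thesis by (simp add: powr_minus divide_inverse)
      next
        case False
        then have "1 \<le> \<bar>x - y\<bar> powr \<beta>"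
          using \<beta> by (intro ge_one_powr_ge_zero) auto
        then have "\<bar>f y\<bar> / \<bar>x - y\<bar> powr \<beta> \<le> \<bar>f y\<bar> / 1"
          by (intro divide_left_mono) auto
        then show ?thesis
          using mult_nonneg_nonneg[OF B0 add_nonneg_nonneg[OF w0 w0]] by (simp add: add_increasing2)
      qed
      then show "norm (f y / \<bar>x - y\<bar> powr \<beta>) \<le> norm (?D y)"
        by simp
    qed
  qed measurable
qed

section \<open>Gaussian damping and Fourier inversion\<close>

abbreviation gauss :: "real \<Rightarrow> real \<Rightarrow> real" where
  "gauss \<tau> w \<equiv> exp (- (w\<^sup>2 / (4 * \<tau>)))"

lemma gaussian_integrable:
  fixes \<tau> :: real
  assumes "\<tau> > 0"
  shows "integrable lborel (\<lambda>w. gauss \<tau> w)"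
proof -
  have "integrable lborel (\<lambda>z. sqrt (2 * pi) * std_normal_density z)"
    using integrable_std_normal_moment[of 0] by (intro integrable_mult_right) simp
  then have 1: "integrable lborel (\<lambda>z::real. exp (- z\<^sup>2 / 2))"
    by (simp add: std_normal_density_def)
  have "integrable lborel (\<lambda>z::real. exp (- (0 + 1 / sqrt (2 * \<tau>) * z)\<^sup>2 / 2))"
    using assms by (intro lborel_integrable_real_affine[OF 1]) auto
  moreover have "- (0 + 1 / sqrt (2 * \<tau>) * z)\<^sup>2 / 2 = - (z\<^sup>2 / (4 * \<tau>))" for z
    using assms by (simp add: power_divide)
  ultimately show ?thesis by simp
qed

text \<open>Scaling by sqrt (2 \<tau>) reduces the integral to the characteristic function of the
  standard normal distribution.\<close>

lemma gaussian_fourier: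
  assumes "\<tau> > 0"
  shows "(LBINT w. cis (w * s) * of_real (gauss \<tau> w))
    = complex_of_real (sqrt (4 * pi * \<tau>) * exp (- (\<tau> * s\<^sup>2)))"
proof -
  define c where "c = sqrt (2 * \<tau>)"
  have c: "c > 0" "c\<^sup>2 = 2 * \<tau>" using assms by (simp_all add: c_def)
  have "(LBINT w. cis (w * s) * of_real (gauss \<tau> w))
      = c *\<^sub>R (LBINT z. cis ((0 + c * z) * s) * of_real (exp (- ((0 + c * z)\<^sup>2 / (4 * \<tau>)))))"
    using c by (subst lborel_integral_real_affine[of c _ 0]) auto
  also have "(\<lambda>z. cis ((0 + c * z) * s) * of_real (exp (- ((0 + c * z)\<^sup>2 / (4 * \<tau>)))))
      = (\<lambda>z. complex_of_real (sqrt (2 * pi)) * (std_normal_density z *\<^sub>R iexp (c * s * z)))"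
  proof
    fix z
    have "(0 + c * z)\<^sup>2 / (4 * \<tau>) = z\<^sup>2 / 2"
      using assms by (simp add: power_mult_distrib c(2))
    then have "cis ((0 + c * z) * s) * of_real (exp (- ((0 + c * z)\<^sup>2 / (4 * \<tau>))))
        = exp (\<i> * of_real (c * s * z)) * of_real (exp (- (z\<^sup>2) / 2))"
      by (simp add: cis_conv_exp mult_ac)
    moreover have "complex_of_real (exp (- (z\<^sup>2) / 2)) = complex_of_real (sqrt (2 * pi) * std_normal_density z)"
      by (simp add: std_normal_density_def)
    ultimately show "cis ((0 + c * z) * s) * of_real (exp (- ((0 + c * z)\<^sup>2 / (4 * \<tau>))))
        = complex_of_real (sqrt (2 * pi)) * (std_normal_density z *\<^sub>R iexp (c * s * z))"
      by (simp only: scaleR_conv_of_real of_real_mult mult_ac)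
  qed
  also have "(LBINT z. complex_of_real (sqrt (2 * pi)) * (std_normal_density z *\<^sub>R iexp (c * s * z)))
      = complex_of_real (sqrt (2 * pi)) * char std_normal_distribution (c * s)"
  proof -
    have "char std_normal_distribution (c * s) = (LBINT z. std_normal_density z *\<^sub>R iexp (c * s * z))"
      unfolding char_def by (subst integral_density) auto
    then show ?thesis by (simp only: integral_mult_right_zero)
  qed
  also have "c *\<^sub>R (complex_of_real (sqrt (2 * pi)) * char std_normal_distribution (c * s))
      = complex_of_real (c * sqrt (2 * pi) * exp (- ((c * s)\<^sup>2) / 2))"
    by (simp add: char_std_normal_distribution scaleR_conv_of_real)
  also have "c * sqrt (2 * pi) * exp (- ((c * s)\<^sup>2) / 2) = sqrt (4 * pi * \<tau>) * exp (- (\<tau> * s\<^sup>2))"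
  proof -
    have "c * sqrt (2 * pi) = sqrt (2 * \<tau> * (2 * pi))"
      by (simp only: c_def real_sqrt_mult)
    then show ?thesis
      by (simp add: power_mult_distrib c(2) mult_ac)
  qed
  finally show ?thesis .
qed

text \<open>The damping factor makes the double integral absolutely convergent for every integrable
  f, whether or not its transform is integrable. Letting \<tau> grow gives Fourier inversion;
  integrating over \<tau> gives the Riesz potential.\<close>

lemma fourier_gaussian:
  assumes f: "integrable lborel f" and \<tau>: "\<tau> > 0"
  shows "(LBINT w. fourier f w * cis (w * x) * of_real (gauss \<tau> w))
    = complex_of_real (sqrt (4 * pi * \<tau>) * (LBINT y. f y * exp (- (\<tau> * (x - y)\<^sup>2))))"
proof -
  have [measurable]: "f \<in> borel_measurable borel"
    using borel_measurable_integrable[OF f] by simp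
  define F where "F y w = of_real (f y) * cis (w * (x - y)) * of_real (gauss \<tau> w)" for y w
  have nF: "norm (F y w) = \<bar>f y\<bar> * gauss \<tau> w" for y w
    by (simp add: F_def norm_mult)
  have int: "integrable (lborel \<Otimes>\<^sub>M lborel) (\<lambda>(y, w). F y w)"
  proof (rule lborel_pair.Fubini_integrable)
    show "(\<lambda>(y, w). F y w) \<in> borel_measurable (lborel \<Otimes>\<^sub>M lborel)"
      unfolding F_def by measurable
    show "integrable lborel (\<lambda>y. LBINT w. norm (case (y, w) of (y, w) \<Rightarrow> F y w))"
      using f by (simp add: nF)
    have "integrable lborel (\<lambda>w. F y w)" for y
    proof (rule Bochner_Integration.integrable_bound)
      show "integrable lborel (\<lambda>w. \<bar>f y\<bar> * gauss \<tau> w)"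
        by (intro integrable_mult_right gaussian_integrable \<tau>)
      show "(\<lambda>w. F y w) \<in> borel_measurable lborel"
        unfolding F_def by measurable
    qed (simp add: nF)
    then show "AE y in lborel. integrable lborel (\<lambda>w. case (y, w) of (y, w) \<Rightarrow> F y w)"
      by simp
  qed
  have "(LBINT w. fourier f w * cis (w * x) * of_real (gauss \<tau> w))
      = (LBINT w. (LBINT y. F y w))"
  proof (intro Bochner_Integration.integral_cong refl)
    fix w
    have "(LBINT y. F y w)
        = (LBINT y. of_real (f y) * cis (- (w * y)) * (cis (w * x) * of_real (gauss \<tau> w)))"
      proof (intro Bochner_Integration.integral_cong refl)
      fix y
      have "cis (w * (x - y)) = cis (- (w * y)) * cis (w * x)"
        by (simp add: cis_mult algebra_simps)
      then show "F y w = of_real (f y) * cis (- (w * y)) * (cis (w * x) * of_real (gauss \<tau> w))"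
        by (simp add: F_def mult_ac)
    qed
    then show "fourier f w * cis (w * x) * of_real (gauss \<tau> w) = (LBINT y. F y w)"
      unfolding fourier_def integral_mult_left_zero by (simp only: mult.assoc)
  qed
  also have "\<dots> = (LBINT y. (LBINT w. F y w))"
    by (rule lborel_pair.Fubini_integral[OF int])
  also have "\<dots> = (LBINT y. complex_of_real (sqrt (4 * pi * \<tau>) * (f y * exp (- (\<tau> * (x - y)\<^sup>2)))))"
  proof (intro Bochner_Integration.integral_cong refl)
    fix y
    have "(LBINT w. F y w) = complex_of_real (f y) * (LBINT w. cis (w * (x - y)) * of_real (gauss \<tau> w))"
      unfolding F_def mult.assoc by simp
    then show "(LBINT w. F y w) = complex_of_real (sqrt (4 * pi * \<tau>) * (f y * exp (- (\<tau> * (x - y)\<^sup>2))))"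
      unfolding gaussian_fourier[OF \<tau>] by simp
  qed
  also have "\<dots> = complex_of_real (sqrt (4 * pi * \<tau>) * (LBINT y. f y * exp (- (\<tau> * (x - y)\<^sup>2))))"
    by (simp only: integral_complex_of_real integral_mult_right_zero)
  finally show ?thesis .
qed

text \<open>Both sides of \<open>fourier_gaussian\<close> are followed as \<tau> tends to infinity:
  the damping factor tends to 1 on the left, and the Gaussians concentrate at x on the
  right.\<close>

lemma fourier_inversion:
  assumes f: "integrable lborel f" and B: "\<And>x. \<bar>f x\<bar> \<le> B" and cont: "continuous_on UNIV f"
    and F: "integrable lborel (fourier f)"
  shows "(LBINT w. fourier f w * cis (w * x)) = complex_of_real (2 * pi * f x)"
proof (rule LIMSEQ_unique)
  have [measurable]: "f \<in> borel_measurable borel"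
    using borel_measurable_integrable[OF f] by simp
  have [measurable]: "fourier f \<in> borel_measurable borel"
    using f by (rule fourier_measurable)
  have inverse_Suc: "(\<lambda>n. 1 / real (Suc n)) \<longlonglongrightarrow> 0"
    using LIMSEQ_inverse_real_of_nat by (simp add: inverse_eq_divide)
  \<comment> \<open>With this choice the substitution y = x + z / (n + 1) turns the Gaussian into
    exp (- z^2 / 2), independent of n.\<close>
  define \<tau> where "\<tau> n = (real (Suc n))\<^sup>2 / 2" for n
  have \<tau>: "\<tau> n > 0" for n by (simp add: \<tau>_def)
  define L where "L n = (LBINT w. fourier f w * cis (w * x) * of_real (gauss (\<tau> n) w))" for n
  show "L \<longlonglongrightarrow> (LBINT w. fourier f w * cis (w * x))"
    unfolding L_def
  proof (rule integral_dominated_convergence[where w = "\<lambda>w. norm (fourier f w)"])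
    show "AE w in lborel. (\<lambda>n. fourier f w * cis (w * x) * of_real (gauss (\<tau> n) w)) \<longlonglongrightarrow> fourier f w * cis (w * x)"
    proof (rule AE_I2)
      fix w :: real
      have "(\<lambda>n. - (w\<^sup>2 / 2 * (1 / real (Suc n))\<^sup>2)) \<longlonglongrightarrow> - (w\<^sup>2 / 2 * 0\<^sup>2)"
        by (intro tendsto_intros inverse_Suc)
      then have "(\<lambda>n. - (w\<^sup>2 / (4 * \<tau> n))) \<longlonglongrightarrow> 0"
        by (simp add: \<tau>_def power_divide)
      then have "(\<lambda>n. fourier f w * cis (w * x) * of_real (gauss (\<tau> n) w)) \<longlonglongrightarrow>
          fourier f w * cis (w * x) * of_real (exp 0)"
        by (intro tendsto_intros)
      then show "(\<lambda>n. fourier f w * cis (w * x) * of_real (gauss (\<tau> n) w)) \<longlonglongrightarrow> fourier f w * cis (w * x)"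
        by simp
    qed
    show "AE w in lborel. norm (fourier f w * cis (w * x) * of_real (gauss (\<tau> n) w)) \<le> norm (fourier f w)" for n
      using \<tau>[of n] by (intro AE_I2) (auto simp: norm_mult intro!: mult_left_le)
  qed (use F in auto)
  have R: "L n = complex_of_real (sqrt (2 * pi) * (LBINT z. f (x + 1 / real (Suc n) * z) * exp (- (z\<^sup>2 / 2))))" for n
  proof -
    define c where "c = 1 / real (Suc n)"
    have c: "c > 0" by (simp add: c_def)
    have A: "(LBINT y. f y * exp (- (\<tau> n * (x - y)\<^sup>2)))
        = c *\<^sub>R (LBINT z. f (x + c * z) * exp (- (\<tau> n * (x - (x + c * z))\<^sup>2)))"
      using c by (subst lborel_integral_real_affine[of c _ x]) auto
    have E: "\<tau> n * (x - (x + c * z))\<^sup>2 = z\<^sup>2 / 2" for z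
      by (simp add: \<tau>_def c_def power_mult_distrib power_divide del: of_nat_Suc)
    have I: "(LBINT y. f y * exp (- (\<tau> n * (x - y)\<^sup>2))) = c * (LBINT z. f (x + c * z) * exp (- (z\<^sup>2 / 2)))"
      using A unfolding E by simp
    have "sqrt (4 * pi * \<tau> n) * c = sqrt (2 * pi)"
    proof -
      have "4 * pi * \<tau> n = 2 * pi * (real (Suc n))\<^sup>2" by (simp add: \<tau>_def)
      then have "sqrt (4 * pi * \<tau> n) = sqrt (2 * pi) * real (Suc n)"
        by (simp only: real_sqrt_mult real_sqrt_abs abs_of_nat)
      then show ?thesis by (simp add: c_def del: of_nat_Suc)
    qed
    then show ?thesis
      unfolding L_def fourier_gaussian[OF f \<tau>] I mult.assoc[symmetric] by (simp only: c_def)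
  qed
  have G: "has_bochner_integral lborel (\<lambda>z::real. exp (- (z\<^sup>2 / 2))) (sqrt (2 * pi))"
  proof -
    have "has_bochner_integral lborel (\<lambda>z. sqrt (2 * pi) * std_normal_density z) (sqrt (2 * pi) * 1)"
      using integrable_std_normal_moment[of 0] integral_std_normal_moment_even[of 0]
      by (intro has_bochner_integral_mult_right) (simp add: has_bochner_integral_iff)
    then show ?thesis by (simp add: std_normal_density_def)
  qed
  have lim: "(\<lambda>n. LBINT z. f (x + 1 / real (Suc n) * z) * exp (- (z\<^sup>2 / 2))) \<longlonglongrightarrow> (LBINT z. f x * exp (- (z\<^sup>2 / 2)))"
  proof (rule integral_dominated_convergence[where w = "\<lambda>z. B * exp (- (z\<^sup>2 / 2))"])
    show "integrable lborel (\<lambda>z. B * exp (- (z\<^sup>2 / 2)))"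
      using G by (intro integrable_mult_right) (simp add: has_bochner_integral_iff)
    show "AE z in lborel. (\<lambda>n. f (x + 1 / real (Suc n) * z) * exp (- (z\<^sup>2 / 2))) \<longlonglongrightarrow> f x * exp (- (z\<^sup>2 / 2))"
    proof (rule AE_I2)
      fix z :: real
      have "(\<lambda>n. x + 1 / real (Suc n) * z) \<longlonglongrightarrow> x + 0 * z"
        by (intro tendsto_intros inverse_Suc)
      then have "(\<lambda>n. x + 1 / real (Suc n) * z) \<longlonglongrightarrow> x"
        by simp
      moreover have "isCont f x"
        using cont by (simp add: continuous_on_eq_continuous_at)
      ultimately have "(\<lambda>n. f (x + 1 / real (Suc n) * z)) \<longlonglongrightarrow> f x"
        by (rule isCont_tendsto_compose[rotated])
      then show "(\<lambda>n. f (x + 1 / real (Suc n) * z) * exp (- (z\<^sup>2 / 2))) \<longlonglongrightarrow> f x * exp (- (z\<^sup>2 / 2))"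
        by (rule tendsto_mult_right)
    qed
    show "AE z in lborel. norm (f (x + 1 / real (Suc n) * z) * exp (- (z\<^sup>2 / 2))) \<le> B * exp (- (z\<^sup>2 / 2))" for n
      using B by (intro AE_I2) (auto simp: abs_mult intro!: mult_right_mono)
  qed measurable
  have val: "(LBINT z. f x * exp (- (z\<^sup>2 / 2))) = f x * sqrt (2 * pi)"
    using G by (simp add: has_bochner_integral_iff)
  have "(\<lambda>n. complex_of_real (sqrt (2 * pi) * (LBINT z. f (x + 1 / real (Suc n) * z) * exp (- (z\<^sup>2 / 2)))))
      \<longlonglongrightarrow> complex_of_real (sqrt (2 * pi) * (f x * sqrt (2 * pi)))"
    by (intro tendsto_of_real tendsto_mult_left lim[unfolded val])
  moreover have "sqrt (2 * pi) * (f x * sqrt (2 * pi)) = 2 * pi * f x"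
    by simp
  ultimately show "L \<longlonglongrightarrow> complex_of_real (2 * pi * f x)"
    unfolding R by (simp only:)
qed

text \<open>The kernel is a superposition of Gaussians, \<open>\<Gamma>(p) \<bar>s\<bar> powr (- 2p) = \<integral> \<tau> powr (p - 1) exp (- \<tau> s\<^sup>2) d\<tau>\<close>,
  so \<open>fourier_gaussian\<close> is integrated against a power of \<open>\<tau>\<close>.\<close>

lemma riesz_integral_fourier:
  assumes \<alpha>: "1 < \<alpha>" "\<alpha> < 2" and f: "integrable lborel f" and B: "\<And>x. \<bar>f x\<bar> \<le> B"
    and F: "integrable lborel (fourier f)"
  shows "complex_of_real (riesz_integral \<alpha> f x)
    = complex_of_real (- 2 * Gamma (2 - \<alpha>) * cos (pi * \<alpha> / 2) / (2 * pi))
      * (LBINT w. fourier f w * of_real (abs w powr (\<alpha> - 2)) * cis (w * x))"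
    and "integrable lborel (\<lambda>w. fourier f w * of_real (abs w powr (\<alpha> - 2)))"
proof -
  have [measurable]: "f \<in> borel_measurable borel"
    using borel_measurable_integrable[OF f] by simp
  have [measurable]: "fourier f \<in> borel_measurable borel"
    using f by (rule fourier_measurable)
  \<comment> \<open>The kernel is |x - y|^(-2p) and the multiplier |w|^(-2r). The relation p + r =
    1/2 makes the powers of \<tau> on the two sides differ exactly by the sqrt \<tau> from the
    transform of the Gaussian.\<close>
  define p where "p = (\<alpha> - 1) / 2"
  define r where "r = 1 - \<alpha> / 2"
  have p: "p > 0" and r: "r > 0" using \<alpha> by (simp_all add: p_def r_def)
  have G: "Gamma p > 0" "Gamma r > 0"
    using p r by (auto intro: Gamma_real_pos)
  have norm_F: "integrable lborel (\<lambda>w. norm (fourier f w) / \<bar>0 - w\<bar> powr (2 - \<alpha>))"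
    using \<alpha> F fourier_norm_le[OF f] by (intro integrable_riesz_kernel) auto
  have conv: "norm (fourier f w) / \<bar>0 - w\<bar> powr (2 - \<alpha>) = norm (fourier f w) * abs w powr (\<alpha> - 2)" for w
    using powr_minus_divide[of "abs w" "2 - \<alpha>"] by simp
  show int_F: "integrable lborel (\<lambda>w. fourier f w * of_real (abs w powr (\<alpha> - 2)))"
  proof (rule Bochner_Integration.integrable_bound[OF norm_F])
    show "AE w in lborel. norm (fourier f w * of_real (abs w powr (\<alpha> - 2)))
        \<le> norm (norm (fourier f w) / \<bar>0 - w\<bar> powr (2 - \<alpha>))"
      unfolding conv by (simp add: norm_mult)
  qed measurable
  have int_f: "integrable lborel (\<lambda>y. f y / \<bar>x - y\<bar> powr (\<alpha> - 1))"
    using \<alpha> by (intro integrable_riesz_kernel[OF f B]) auto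
  define k where "k s \<tau> = (if \<tau> \<in> {0<..} then \<tau> powr (p - 1) * exp (- (\<tau> * s)) else 0)" for s \<tau> :: real
  define m where "m s \<tau> = (if \<tau> \<in> {0<..} then \<tau> powr (- r - 1) * exp (- (s / \<tau>)) else 0)" for s \<tau> :: real
  have k0: "k s \<tau> \<ge> 0" and m0: "m s \<tau> \<ge> 0" for s \<tau>
    by (auto simp: k_def m_def)
  let ?A = "\<lambda>w \<tau>. fourier f w * cis (w * x) * of_real (m (w\<^sup>2 / 4) \<tau>)"
  let ?B = "\<lambda>y \<tau>. f y * k ((x - y)\<^sup>2) \<tau>"
  let ?C = "\<lambda>w. fourier f w * of_real (abs w powr (\<alpha> - 2))"
  have k_int: "has_bochner_integral lborel (k ((x - y)\<^sup>2)) (Gamma p / \<bar>x - y\<bar> powr (\<alpha> - 1))" if "y \<noteq> x" for y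
  proof -
    have "((x - y)\<^sup>2) powr (- p) = (\<bar>x - y\<bar> powr 2) powr (- p)"
      using that by (simp add: powr_numeral)
    also have "\<dots> = 1 / \<bar>x - y\<bar> powr (\<alpha> - 1)"
    proof -
      have e: "2 * - p = - (\<alpha> - 1)" by (simp add: p_def field_simps)
      show ?thesis
        unfolding powr_powr e by (rule powr_minus_divide)
    qed
    finally show ?thesis
      using has_bochner_integral_Gamma[OF p, of "(x - y)\<^sup>2"] that by (simp add: k_def[abs_def])
  qed
  have m_int: "has_bochner_integral lborel (m (w\<^sup>2 / 4)) (Gamma r * 2 powr (2 - \<alpha>) * abs w powr (\<alpha> - 2))" if "w \<noteq> 0" for w
  proof -
    have "(w\<^sup>2 / 4) powr (- r) = ((abs w / 2) powr 2) powr (- r)"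
      using that by (simp add: powr_numeral power_divide)
    also have "\<dots> = (abs w / 2) powr (\<alpha> - 2)"
      unfolding powr_powr by (simp add: r_def)
    also have "\<dots> = 2 powr (2 - \<alpha>) * abs w powr (\<alpha> - 2)"
      using powr_minus_divide[of 2 "2 - \<alpha>"] powr_minus_divide[of 2 "\<alpha> - 2"] by (simp add: powr_divide)
    finally show ?thesis
      using has_bochner_integral_Gamma_inverse[OF r, of "w\<^sup>2 / 4"] that by (simp add: m_def[abs_def] mult.assoc)
  qed
  have ne: "AE y in lborel. y \<noteq> c" for c :: real
    by (rule AE_lborel_singleton)
  have int1: "integrable (lborel \<Otimes>\<^sub>M lborel) (\<lambda>(y, \<tau>). ?B y \<tau>)"
  proof (rule lborel_pair.Fubini_integrable)
    show "(\<lambda>(y, \<tau>). ?B y \<tau>) \<in> borel_measurable (lborel \<Otimes>\<^sub>M lborel)"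
      unfolding k_def by measurable
    have "integrable lborel (\<lambda>y. Gamma p * \<bar>f y / \<bar>x - y\<bar> powr (\<alpha> - 1)\<bar>)"
      using int_f by (intro integrable_mult_right integrable_abs)
    moreover have "AE y in lborel. (LBINT \<tau>. norm (case (y, \<tau>) of (y, \<tau>) \<Rightarrow> ?B y \<tau>))
        = Gamma p * \<bar>f y / \<bar>x - y\<bar> powr (\<alpha> - 1)\<bar>"
      using ne[of x]
    proof eventually_elim
      case (elim y)
      then show ?case
        using k_int[OF elim] k0 by (simp add: abs_mult has_bochner_integral_iff)
    qed
    ultimately show "integrable lborel (\<lambda>y. LBINT \<tau>. norm (case (y, \<tau>) of (y, \<tau>) \<Rightarrow> ?B y \<tau>))"
      by (subst integrable_cong_AE) (auto simp: k_def)
    show "AE y in lborel. integrable lborel (\<lambda>\<tau>. case (y, \<tau>) of (y, \<tau>) \<Rightarrow> ?B y \<tau>)"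
      using ne[of x] by eventually_elim (use k_int in \<open>auto simp: has_bochner_integral_iff\<close>)
  qed
  have int2: "integrable (lborel \<Otimes>\<^sub>M lborel) (\<lambda>(w, \<tau>). ?A w \<tau>)"
  proof (rule lborel_pair.Fubini_integrable)
    show "(\<lambda>(w, \<tau>). ?A w \<tau>) \<in> borel_measurable (lborel \<Otimes>\<^sub>M lborel)"
      unfolding m_def by measurable
    have "integrable lborel (\<lambda>w. Gamma r * 2 powr (2 - \<alpha>) * norm (?C w))"
      using int_F by (intro integrable_mult_right integrable_norm)
    moreover have "AE w in lborel. (LBINT \<tau>. norm (case (w, \<tau>) of (w, \<tau>) \<Rightarrow> ?A w \<tau>))
        = Gamma r * 2 powr (2 - \<alpha>) * norm (?C w)"
      using ne[of 0]
    proof eventually_elim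
      case (elim w)
      then show ?case
        using m_int[OF elim] m0 by (simp add: norm_mult has_bochner_integral_iff)
    qed
    ultimately show "integrable lborel (\<lambda>w. LBINT \<tau>. norm (case (w, \<tau>) of (w, \<tau>) \<Rightarrow> ?A w \<tau>))"
      by (subst integrable_cong_AE) (auto simp: m_def)
    show "AE w in lborel. integrable lborel (\<lambda>\<tau>. case (w, \<tau>) of (w, \<tau>) \<Rightarrow> ?A w \<tau>)"
      using ne[of 0] by eventually_elim (use m_int in \<open>auto simp: has_bochner_integral_iff\<close>)
  qed
  have inner: "(LBINT w. ?A w \<tau>)
      = complex_of_real (sqrt (4 * pi) * (LBINT y. ?B y \<tau>))" for \<tau>
  proof (cases "\<tau> > 0")
    case True
    have "(LBINT w. ?A w \<tau>)
        = (LBINT w. complex_of_real (\<tau> powr (- r - 1)) * (fourier f w * cis (w * x) * of_real (gauss \<tau> w)))"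
      using True by (intro Bochner_Integration.integral_cong refl) (simp add: m_def mult_ac)
    also have "\<dots> = complex_of_real (\<tau> powr (- r - 1) * (sqrt (4 * pi * \<tau>) * (LBINT y. f y * exp (- (\<tau> * (x - y)\<^sup>2)))))"
      unfolding integral_mult_right_zero fourier_gaussian[OF f True] of_real_mult ..
    also have "\<tau> powr (- r - 1) * (sqrt (4 * pi * \<tau>) * (LBINT y. f y * exp (- (\<tau> * (x - y)\<^sup>2))))
        = sqrt (4 * pi) * (\<tau> powr (p - 1) * (LBINT y. f y * exp (- (\<tau> * (x - y)\<^sup>2))))"
    proof -
      have "\<tau> powr (p - 1) = \<tau> powr (- r - 1) * \<tau> powr (1/2)"
        unfolding powr_add[symmetric] by (simp add: p_def r_def field_simps)
      then have "\<tau> powr (- r - 1) * sqrt (4 * pi * \<tau>) = sqrt (4 * pi) * \<tau> powr (p - 1)"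
        using True by (simp add: powr_half_sqrt real_sqrt_mult)
      then show ?thesis by (simp only: mult.assoc[symmetric])
    qed
    also have "\<tau> powr (p - 1) * (LBINT y. f y * exp (- (\<tau> * (x - y)\<^sup>2))) = (LBINT y. \<tau> powr (p - 1) * (f y * exp (- (\<tau> * (x - y)\<^sup>2))))"
      by (rule integral_mult_right_zero[symmetric])
    also have "\<dots> = (LBINT y. ?B y \<tau>)"
      using True by (intro Bochner_Integration.integral_cong refl) (simp add: k_def mult_ac)
    finally show ?thesis .
  qed (simp add: k_def m_def)
  have "(LBINT \<tau>. (LBINT y. ?B y \<tau>)) = (LBINT y. (LBINT \<tau>. ?B y \<tau>))"
    by (rule lborel_pair.Fubini_integral[OF int1])
  also have "\<dots> = (LBINT y. Gamma p * riesz_integrand \<alpha> f x y)"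
  proof (rule integral_cong_AE)
    show "AE y in lborel. (LBINT \<tau>. ?B y \<tau>) = Gamma p * riesz_integrand \<alpha> f x y"
      using ne[of x] by eventually_elim (use k_int in \<open>auto simp: has_bochner_integral_iff riesz_integrand_def\<close>)
  qed (simp_all add: k_def riesz_integrand_def)
  also have "\<dots> = Gamma p * riesz_integral \<alpha> f x"
    by (simp add: riesz_integral_def)
  finally have L: "(LBINT \<tau>. (LBINT y. ?B y \<tau>)) = Gamma p * riesz_integral \<alpha> f x" .
  have "(LBINT \<tau>. (LBINT w. ?A w \<tau>))
      = (LBINT w. (LBINT \<tau>. ?A w \<tau>))"
    by (rule lborel_pair.Fubini_integral[OF int2])
  also have "\<dots> = (LBINT w. complex_of_real (Gamma r * 2 powr (2 - \<alpha>)) * (?C w * cis (w * x)))"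
  proof (rule integral_cong_AE)
    show "AE w in lborel. (LBINT \<tau>. ?A w \<tau>)
        = complex_of_real (Gamma r * 2 powr (2 - \<alpha>)) * (?C w * cis (w * x))"
      using ne[of 0]
    proof eventually_elim
      case (elim w)
      have "(LBINT \<tau>. complex_of_real (m (w\<^sup>2 / 4) \<tau>)) = complex_of_real (Gamma r * 2 powr (2 - \<alpha>) * abs w powr (\<alpha> - 2))"
        using m_int[OF elim] by (simp add: has_bochner_integral_iff)
      then show ?case
        by (simp only: integral_mult_right_zero of_real_mult mult_ac)
    qed
  qed (simp_all add: m_def)
  also have "\<dots> = complex_of_real (Gamma r * 2 powr (2 - \<alpha>)) * (LBINT w. ?C w * cis (w * x))"
    by (rule integral_mult_right_zero)
  finally have R: "complex_of_real (sqrt (4 * pi) * (Gamma p * riesz_integral \<alpha> f x))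
      = complex_of_real (Gamma r * 2 powr (2 - \<alpha>)) * (LBINT w. ?C w * cis (w * x))"
    unfolding inner integral_complex_of_real integral_mult_right_zero L .
  \<comment> \<open>Since 1 - p = r + 1/2, the duplication formula at r and the reflection formula
    at p share the factor Gamma (r + 1/2), which cancels and leaves the cosine.\<close>
  have K: "Gamma r * 2 powr (2 - \<alpha>) = sqrt (4 * pi) * Gamma p * (- 2 * Gamma (2 - \<alpha>) * cos (pi * \<alpha> / 2) / (2 * pi))"
  proof -
    have dup: "Gamma r * Gamma (r + 1/2) = 2 powr (\<alpha> - 1) * sqrt pi * Gamma (2 - \<alpha>)"
    proof -
      have "1 - 2 * r = \<alpha> - 1" "2 * r = 2 - \<alpha>" by (simp_all add: r_def)
      then show ?thesis
        using Gamma_legendre_duplication_real[OF r] by (simp only:)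
    qed
    have refl: "Gamma p * Gamma (r + 1/2) = - pi / cos (pi * \<alpha> / 2)"
    proof -
      have "1 - p = r + 1/2" by (simp add: p_def r_def field_simps)
      moreover have "complex_of_real (Gamma p * Gamma (1 - p)) = complex_of_real (pi / sin (pi * p))"
        using Gamma_reflection_complex[of "complex_of_real p"]
        by (simp add: sin_of_real[symmetric] Gamma_complex_of_real[symmetric])
      moreover have "sin (pi * p) = - cos (pi * \<alpha> / 2)"
      proof -
        have "pi * p = pi * \<alpha> / 2 - pi / 2" by (simp add: p_def field_simps)
        then show ?thesis by (simp add: sin_diff)
      qed
      ultimately show ?thesis
        unfolding of_real_eq_iff by simp
    qed
    have G3: "Gamma (r + 1/2) > 0"
      using r by (intro Gamma_real_pos) simp
    have c0: "cos (pi * \<alpha> / 2) \<noteq> 0"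
    proof
      assume "cos (pi * \<alpha> / 2) = 0"
      then have "Gamma p * Gamma (r + 1/2) = 0" using refl by simp
      then show False using G G3 by simp
    qed
    have "Gamma r * 2 powr (2 - \<alpha>) * (Gamma p * Gamma (r + 1/2))
        = Gamma p * 2 powr (2 - \<alpha>) * (2 powr (\<alpha> - 1) * sqrt pi * Gamma (2 - \<alpha>))"
      using dup by (simp add: mult_ac)
    also have "\<dots> = Gamma p * (2 powr (2 - \<alpha>) * 2 powr (\<alpha> - 1)) * sqrt pi * Gamma (2 - \<alpha>)"
      by (simp only: mult_ac)
    also have "2 powr (2 - \<alpha>) * 2 powr (\<alpha> - 1) = 2"
      unfolding powr_add[symmetric] by simp
    finally have "Gamma r * 2 powr (2 - \<alpha>) * (- pi / cos (pi * \<alpha> / 2)) = Gamma p * 2 * sqrt pi * Gamma (2 - \<alpha>)"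
      unfolding refl .
    moreover have "sqrt (4 * pi) = 2 * sqrt pi"
      by (simp add: real_sqrt_mult)
    ultimately show ?thesis
      using c0 by (simp add: field_simps)
  qed
  have "complex_of_real (sqrt (4 * pi) * Gamma p) * of_real (riesz_integral \<alpha> f x)
      = complex_of_real (sqrt (4 * pi) * Gamma p) * (complex_of_real (- 2 * Gamma (2 - \<alpha>) * cos (pi * \<alpha> / 2) / (2 * pi))
        * (LBINT w. ?C w * cis (w * x)))"
    using R unfolding K by (simp only: of_real_mult mult.assoc)
  moreover have "complex_of_real (sqrt (4 * pi) * Gamma p) \<noteq> 0"
    using G by simp
  ultimately show "complex_of_real (riesz_integral \<alpha> f x)
    = complex_of_real (- 2 * Gamma (2 - \<alpha>) * cos (pi * \<alpha> / 2) / (2 * pi))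
      * (LBINT w. ?C w * cis (w * x))"
    using mult_left_cancel by blast
qed

section \<open>Fourier multipliers and the error estimate\<close>

text \<open>Dominated convergence of difference quotients along sequences; the mean value inequality
  bounds each quotient by \<open>B w\<close>.\<close>

lemma integral_has_real_derivative:
  fixes G G' :: "real \<Rightarrow> real \<Rightarrow> real"
  assumes G: "\<And>x. integrable lborel (G x)" and G': "\<And>x. G' x \<in> borel_measurable borel"
    and d: "\<And>x w. ((\<lambda>x. G x w) has_real_derivative G' x w) (at x)"
    and w: "integrable lborel B" and le: "\<And>x w. \<bar>G' x w\<bar> \<le> B w"
  shows "((\<lambda>x. LBINT w. G x w) has_real_derivative (LBINT w. G' x w)) (at x)"
  unfolding DERIV_def tendsto_at_iff_sequentially comp_def
proof (intro allI impI)
  fix X :: "nat \<Rightarrow> real" assume X: "\<forall>i. X i \<in> UNIV - {0}" "X \<longlonglongrightarrow> 0"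
  have "(\<lambda>i. LBINT w. (G (x + X i) w - G x w) / X i) \<longlonglongrightarrow> (LBINT w. G' x w)"
  proof (rule integral_dominated_convergence[OF _ _ w])
    show "G' x \<in> borel_measurable lborel"
      using G' by simp
    show "(\<lambda>w. (G (x + X i) w - G x w) / X i) \<in> borel_measurable lborel" for i
      using G by (intro borel_measurable_divide borel_measurable_diff) (auto dest: borel_measurable_integrable)
    show "AE w in lborel. (\<lambda>i. (G (x + X i) w - G x w) / X i) \<longlonglongrightarrow> G' x w"
    proof (rule AE_I2)
      fix w
      have "((\<lambda>h. (G (x + h) w - G x w) / h) \<longlongrightarrow> G' x w) (at 0)"
        using d[of w x] by (simp add: DERIV_def)
      then show "(\<lambda>i. (G (x + X i) w - G x w) / X i) \<longlonglongrightarrow> G' x w"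
        using X unfolding tendsto_at_iff_sequentially comp_def by blast
    qed
    show "AE w in lborel. norm ((G (x + X i) w - G x w) / X i) \<le> B w" for i
    proof (rule AE_I2)
      fix w
      have "norm (G (x + X i) w - G x w) \<le> B w * norm (x + X i - x)"
        by (rule field_differentiable_bound[where S = UNIV and f' = "\<lambda>x. G' x w"])
          (use d le in auto)
      then show "norm ((G (x + X i) w - G x w) / X i) \<le> B w"
        using X(1) by (simp add: field_simps)
    qed
  qed
  moreover have "(LBINT w. (G (x + X i) w - G x w) / X i)
      = ((LBINT w. G (x + X i) w) - (LBINT w. G x w)) / X i" for i
    using G by simp
  ultimately show "(\<lambda>i. ((LBINT w. G (x + X i) w) - (LBINT w. G x w)) / X i) \<longlonglongrightarrow> (LBINT w. G' x w)"
    by (simp only:)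
qed

lemma fourier_integral_deriv:
  fixes H :: "real \<Rightarrow> complex"
  assumes H: "integrable lborel H" and H': "integrable lborel (\<lambda>w. \<i> * of_real w * H w)"
  shows "((\<lambda>x. Re (LBINT w. H w * cis (w * x))) has_real_derivative
      Re (LBINT w. \<i> * of_real w * H w * cis (w * x))) (at x)"
proof -
  have i: "integrable lborel (\<lambda>w. H w * cis (w * x))" for x
    by (rule integrable_mult_cis[OF H]) simp
  have i': "integrable lborel (\<lambda>w. \<i> * of_real w * H w * cis (w * x))" for x
    by (rule integrable_mult_cis[OF H']) simp
  have "((\<lambda>x. LBINT w. Re (H w * cis (w * x))) has_real_derivative
      (LBINT w. Re (\<i> * of_real w * H w * cis (w * x)))) (at x)"
  proof (rule integral_has_real_derivative)
    show "integrable lborel (\<lambda>w. Re (H w * cis (w * x)))" for x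
      using i by (rule integrable_Re)
    show "(\<lambda>w. Re (\<i> * of_real w * H w * cis (w * x))) \<in> borel_measurable borel" for x
      using borel_measurable_integrable[OF integrable_Re[OF i']] by simp
    show "((\<lambda>x. Re (H w * cis (w * x))) has_real_derivative Re (\<i> * of_real w * H w * cis (w * x))) (at x)" for x w
      by (auto intro!: derivative_eq_intros simp: algebra_simps)
    show "integrable lborel (\<lambda>w. norm (\<i> * of_real w * H w))"
      using H' by (rule integrable_norm)
    show "\<bar>Re (\<i> * of_real w * H w * cis (w * x))\<bar> \<le> norm (\<i> * of_real w * H w)" for x w
      using abs_Re_le_cmod[of "\<i> * of_real w * H w * cis (w * x)"] by (simp add: norm_mult)
  qed
  then show ?thesis
    unfolding integral_Re[OF i] integral_Re[OF i'] .
qed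

text \<open>On [-1, 1] the product is bounded by A; outside, it is at most A |w|^(s - N), with
  exponent below -1.\<close>

lemma decay_integrable:
  fixes U :: "real \<Rightarrow> complex"
  assumes [measurable]: "U \<in> borel_measurable borel"
    and A: "\<And>w. norm (U w) \<le> A" and AN: "\<And>w. norm (U w) * abs w ^ N \<le> A"
    and s: "0 \<le> s" "s < real N - 1"
  shows "integrable lborel (\<lambda>w. U w * of_real (abs w powr s))"
proof -
  define v where "v w = (if w \<in> {1..} then w powr (s - real N) else 0)" for w :: real
  have "has_bochner_integral lborel v (- (1 powr (s - real N + 1)) / (s - real N + 1))"
    unfolding v_def[abs_def] using s
    by (intro has_bochner_integral_nonneg_has_integral has_integral_powr_to_inf) auto
  then have v: "integrable lborel v"
    by (simp add: has_bochner_integral_iff)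
  have v0: "v w \<ge> 0" for w by (simp add: v_def)
  have A0: "A \<ge> 0" using order_trans[OF norm_ge_zero A] .
  let ?D = "\<lambda>w. A * (indicator {-1..1} w + v (0 + 1 * w) + v (0 + (-1) * w))"
  show ?thesis
  proof (rule Bochner_Integration.integrable_bound)
    show "integrable lborel (\<lambda>w. ?D w)"
      using v by (intro integrable_mult_right Bochner_Integration.integrable_add lborel_integrable_real_affine) auto
    show "AE w in lborel. norm (U w * of_real (abs w powr s))
        \<le> norm (?D w)"
    proof (rule AE_I2)
      fix w :: real
      have "norm (U w) * abs w powr s \<le> ?D w"
      proof (cases "abs w \<le> 1")
        case True
        have "norm (U w) * abs w powr s \<le> A * 1"
          using A A0 True s by (intro mult_mono powr_le1) auto
        also have "\<dots> \<le> ?D w"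
          using True A0 v0[of w] v0[of "- w"] by (intro mult_left_mono) (auto simp: indicator_def)
        finally show ?thesis .
      next
        case False
        then have pos: "abs w > 0" by linarith
        have "norm (U w) * abs w powr s = (norm (U w) * abs w ^ N) * abs w powr (s - real N)"
          using pos by (simp add: powr_diff powr_realpow)
        also have "\<dots> \<le> A * abs w powr (s - real N)"
          using AN by (intro mult_right_mono) auto
        also have "abs w powr (s - real N) \<le> indicator {-1..1} w + v (0 + 1 * w) + v (0 + (-1) * w)"
          using False by (auto simp: v_def indicator_def abs_if)
        then have "A * abs w powr (s - real N) \<le> ?D w"
          using A0 by (rule mult_left_mono)
        finally show ?thesis .
      qed
      then show "norm (U w * of_real (abs w powr s))
          \<le> norm (?D w)"
        by (simp add: norm_mult)
    qed
  qed measurable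
qed

section \<open>Calculus of Fourier multipliers\<close>

text \<open>The real part keeps all functions real-valued. Nothing is lost when U is the transform
  of a real function and m is even, since the integral is then real.\<close>

definition multiplier_op :: "(real \<Rightarrow> complex) \<Rightarrow> (real \<Rightarrow> real) \<Rightarrow> real \<Rightarrow> real" where
  "multiplier_op U m x = Re (LBINT w. U w * of_real (m w) * cis (w * x)) / (2 * pi)"

definition admissible :: "(real \<Rightarrow> complex) \<Rightarrow> (real \<Rightarrow> real) \<Rightarrow> bool" where
  "admissible U m \<longleftrightarrow> integrable lborel (\<lambda>w. U w * of_real (m w))"

lemma admissible_integrable:
  "admissible U m \<Longrightarrow> integrable lborel (\<lambda>w. U w * of_real (m w) * cis (w * x))"
  unfolding admissible_def by (rule integrable_mult_cis) (assumption, measurable)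

lemma admissible_mult_bounded:
  assumes m: "admissible U m" and [measurable]: "k \<in> borel_measurable borel" and k: "\<And>w. \<bar>k w\<bar> \<le> C"
  shows "admissible U (\<lambda>w. m w * k w)"
  unfolding admissible_def
proof (rule Bochner_Integration.integrable_bound)
  have i: "integrable lborel (\<lambda>w. U w * of_real (m w))"
    using m by (simp add: admissible_def)
  then show "integrable lborel (\<lambda>w. C * norm (U w * of_real (m w)))"
    by (intro integrable_mult_right integrable_norm)
  have "(\<lambda>w. U w * of_real (m w) * of_real (k w)) \<in> borel_measurable lborel"
    using borel_measurable_integrable[OF i] by measurable
  then show "(\<lambda>w. U w * of_real (m w * k w)) \<in> borel_measurable lborel"
    by (simp add: mult.assoc)
  have "norm (U w * of_real (m w * k w)) \<le> C * norm (U w * of_real (m w))" for w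
    using mult_left_mono[OF k[of w], of "norm (U w) * \<bar>m w\<bar>"] by (simp add: norm_mult abs_mult mult_ac)
  moreover have "C \<ge> 0" using k[of 0] by simp
  ultimately show "AE w in lborel. norm (U w * of_real (m w * k w)) \<le> norm (C * norm (U w * of_real (m w)))"
    by (simp add: abs_mult norm_mult)
qed

lemma admissible_cmult: "admissible U m \<Longrightarrow> admissible U (\<lambda>w. c * m w)"
  using admissible_mult_bounded[of U m "\<lambda>_. c" "\<bar>c\<bar>"] by (simp add: mult.commute)

lemma admissible_diff: "admissible U m \<Longrightarrow> admissible U k \<Longrightarrow> admissible U (\<lambda>w. m w - k w)"
  unfolding admissible_def by (drule (1) Bochner_Integration.integrable_diff) (simp add: algebra_simps)

lemma admissible_sum:
  "(\<And>i. i \<in> A \<Longrightarrow> admissible U (m i)) \<Longrightarrow> admissible U (\<lambda>w. \<Sum>i\<in>A. m i w)"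
  unfolding admissible_def of_real_sum sum_distrib_left by (rule Bochner_Integration.integrable_sum)

lemma multiplier_op_cmult: "multiplier_op U (\<lambda>w. c * m w) x = c * multiplier_op U m x"
proof -
  have "(LBINT w. U w * of_real (c * m w) * cis (w * x))
      = (LBINT w. complex_of_real c * (U w * of_real (m w) * cis (w * x)))"
    by (intro Bochner_Integration.integral_cong refl) simp
  also have "\<dots> = complex_of_real c * (LBINT w. U w * of_real (m w) * cis (w * x))"
    by (rule integral_mult_right_zero)
  finally show ?thesis
    by (simp add: multiplier_op_def)
qed

lemma multiplier_op_diff:
  assumes "admissible U m" "admissible U k"
  shows "multiplier_op U (\<lambda>w. m w - k w) x = multiplier_op U m x - multiplier_op U k x"
proof -
  have "(LBINT w. U w * of_real (m w - k w) * cis (w * x))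
      = (LBINT w. U w * of_real (m w) * cis (w * x) - U w * of_real (k w) * cis (w * x))"
    by (intro Bochner_Integration.integral_cong refl) (simp add: algebra_simps)
  also have "\<dots> = (LBINT w. U w * of_real (m w) * cis (w * x)) - (LBINT w. U w * of_real (k w) * cis (w * x))"
    by (rule Bochner_Integration.integral_diff[OF admissible_integrable[OF assms(1)] admissible_integrable[OF assms(2)]])
  finally show ?thesis
    by (simp add: multiplier_op_def diff_divide_distrib)
qed

lemma multiplier_op_sum:
  assumes "\<And>i. i \<in> A \<Longrightarrow> admissible U (m i)"
  shows "multiplier_op U (\<lambda>w. \<Sum>i\<in>A. m i w) x = (\<Sum>i\<in>A. multiplier_op U (m i) x)"
  unfolding multiplier_op_def of_real_sum sum_distrib_left sum_distrib_right
  using assms by (subst Bochner_Integration.integral_sum) (auto simp: admissible_integrable sum_divide_distrib)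

lemma multiplier_op_bound:
  assumes m: "admissible U m" and k: "admissible U k" and le: "\<And>w. \<bar>m w\<bar> \<le> C * \<bar>k w\<bar>"
  shows "\<bar>multiplier_op U m x\<bar> \<le> C * (LBINT w. norm (U w * of_real (k w))) / (2 * pi)"
proof -
  have "\<bar>Re (LBINT w. U w * of_real (m w) * cis (w * x))\<bar>
      \<le> norm (LBINT w. U w * of_real (m w) * cis (w * x))"
    by (rule abs_Re_le_cmod)
  also have "\<dots> \<le> (LBINT w. norm (U w * of_real (m w) * cis (w * x)))"
    by (rule integral_norm_bound)
  also have "\<dots> \<le> (LBINT w. C * norm (U w * of_real (k w)))"
  proof (rule integral_mono)
    show "integrable lborel (\<lambda>w. norm (U w * of_real (m w) * cis (w * x)))"
      using admissible_integrable[OF m] by (rule integrable_norm)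
    show "integrable lborel (\<lambda>w. C * norm (U w * of_real (k w)))"
      using k unfolding admissible_def by (intro integrable_mult_right integrable_norm)
    show "norm (U w * of_real (m w) * cis (w * x)) \<le> C * norm (U w * of_real (k w))" for w
      using mult_left_mono[OF le[of w], of "norm (U w)"] by (simp add: norm_mult mult_ac)
  qed
  finally show ?thesis
    by (simp add: multiplier_op_def divide_right_mono)
qed

lemma central_diff_multiplier_op:
  assumes m: "admissible U m"
  shows "central_diff h l (multiplier_op U m) x
    = multiplier_op U (\<lambda>w. m w * central_symbol l (w * h)) x"
proof -
  define c where "c s = (-1) ^ s * real ((2 * l) choose s)" for s
  have "complex_of_real (m w * central_symbol l (w * h)) * cis (w * x)
      = (\<Sum>s=0..2*l. complex_of_real (c s) * (of_real (m w) * cis (w * (x + (real l - real s) * h))))" for w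
  proof -
    have "cis (w * (x + (real l - real s) * h)) = cis ((real l - real s) * (w * h)) * cis (w * x)" for s
      by (simp add: cis_mult algebra_simps)
    then show ?thesis
      unfolding of_real_mult[of "m w"] central_diff_symbol[of l "w * h", symmetric] sum_distrib_left sum_distrib_right
      by (intro sum.cong refl) (simp add: c_def mult_ac)
  qed
  then have "(LBINT w. U w * of_real (m w * central_symbol l (w * h)) * cis (w * x))
      = (LBINT w. (\<Sum>s=0..2*l. complex_of_real (c s) * (U w * of_real (m w) * cis (w * (x + (real l - real s) * h)))))"
    by (intro Bochner_Integration.integral_cong refl) (simp only: mult.assoc[of "U _"] sum_distrib_left mult.left_commute)
  also have "\<dots> = (\<Sum>s=0..2*l. complex_of_real (c s) * (LBINT w. U w * of_real (m w) * cis (w * (x + (real l - real s) * h))))"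
    using admissible_integrable[OF m] by (subst Bochner_Integration.integral_sum) auto
  finally have eq: "(LBINT w. U w * of_real (m w * central_symbol l (w * h)) * cis (w * x))
      = (\<Sum>s=0..2*l. complex_of_real (c s) * (LBINT w. U w * of_real (m w) * cis (w * (x + (real l - real s) * h))))" .
  show ?thesis
    unfolding multiplier_op_def[abs_def] central_diff_def eq Re_sum sum_divide_distrib c_def[symmetric]
    by (intro sum.cong refl) simp
qed

text \<open>Finite partial sums are multipliers directly. Absolute summability of the coefficients
  makes their symbols converge uniformly, and integrability of U carries this through the
  integral.\<close>

lemma frac_diff_multiplier_op:
  assumes \<alpha>: "1 < \<alpha>" "\<alpha> < 2" and U: "admissible U (\<lambda>_. 1)" and f: "\<And>x. f x = multiplier_op U (\<lambda>_. 1) x"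
  shows "((\<lambda>k. frac_coeff \<alpha> k * f (x - of_int k * h)) has_sum
      multiplier_op U (\<lambda>w. frac_symbol \<alpha> (w * h)) x) UNIV"
proof -
  define P where "P F t = (\<Sum>k\<in>F. of_real (frac_coeff \<alpha> k) * cis (of_int k * t))" for F t
  define T where "T t = frac_symbol \<alpha> t" for t
  define J where "J = (LBINT w. norm (U w))"
  let ?Q = "\<lambda>F w. U w * P F (- (w * h)) * cis (w * x)"
  let ?R = "\<lambda>w. U w * of_real (T (w * h)) * cis (w * x)"
  have Ui: "integrable lborel U"
    using U by (simp add: admissible_def)
  have Tm: "T \<in> borel_measurable borel"
    unfolding T_def[abs_def] by measurable
  have J0: "J \<ge> 0" unfolding J_def by simp
  have lim: "uniform_limit UNIV P (\<lambda>t. \<Sum>\<^sub>\<infinity>k. of_real (frac_coeff \<alpha> k) * cis (of_int k * t)) (finite_subsets_at_top UNIV)"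
    unfolding P_def[abs_def]
    by (rule Weierstrass_m_test_general[OF _ frac_coeff_abs_summable[OF \<alpha>]]) (simp add: norm_mult)
  have lim: "uniform_limit UNIV P (\<lambda>t. complex_of_real (T t)) (finite_subsets_at_top UNIV)"
    using lim unfolding infsumI[OF frac_coeff_symbol[OF \<alpha>]] T_def .
  have adT: "admissible U (\<lambda>w. T (w * h))"
  proof -
    have "admissible U (\<lambda>w. 1 * T (w * h))"
    proof (rule admissible_mult_bounded[OF U])
      show "(\<lambda>w. T (w * h)) \<in> borel_measurable borel" using Tm by measurable
      show "\<bar>T (w * h)\<bar> \<le> 2 powr \<alpha>" for w
        using \<alpha> abs_sin_le_one[of "w * h / 2"] unfolding T_def abs_of_nonneg[OF powr_ge_zero]
        by (intro powr_mono2) (auto simp: abs_mult)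
    qed
    then show ?thesis by simp
  qed
  have part: "(\<Sum>k\<in>F. frac_coeff \<alpha> k * f (x - of_int k * h))
      = Re (LBINT w. ?Q F w) / (2 * pi)" (is "?l F = ?r F") for F
  proof -
    have "(LBINT w. ?Q F w)
        = (LBINT w. (\<Sum>k\<in>F. complex_of_real (frac_coeff \<alpha> k) * (U w * cis (w * (x - of_int k * h)))))"
    proof (intro Bochner_Integration.integral_cong refl)
      fix w
      have "cis (w * (x - of_int k * h)) = cis (of_int k * - (w * h)) * cis (w * x)" for k
        by (simp add: cis_mult algebra_simps)
      then show "?Q F w
          = (\<Sum>k\<in>F. complex_of_real (frac_coeff \<alpha> k) * (U w * cis (w * (x - of_int k * h))))"
        unfolding P_def sum_distrib_left sum_distrib_right by (intro sum.cong refl) (simp only: mult_ac)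
    qed
    also have "\<dots> = (\<Sum>k\<in>F. complex_of_real (frac_coeff \<alpha> k) * (LBINT w. U w * cis (w * (x - of_int k * h))))"
      using admissible_integrable[OF U] by (subst Bochner_Integration.integral_sum) auto
    finally show ?thesis
      by (simp add: f multiplier_op_def Re_sum sum_divide_distrib)
  qed
  have PU: "integrable lborel (\<lambda>w. ?Q F w)" for F
  proof (rule integrable_mult_cis)
    show "integrable lborel (\<lambda>w. U w * P F (- (w * h)))"
      unfolding P_def sum_distrib_left
    proof (rule Bochner_Integration.integrable_sum)
      fix k
      have "integrable lborel (\<lambda>w. complex_of_real (frac_coeff \<alpha> k) * (U w * cis (of_int k * - (w * h))))"
        by (intro integrable_mult_right integrable_mult_cis Ui) measurable
      then show "integrable lborel (\<lambda>w. U w * (of_real (frac_coeff \<alpha> k) * cis (of_int k * - (w * h))))"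
        by (simp only: mult.left_commute)
    qed
  qed measurable
  show ?thesis
    unfolding has_sum_def
  proof (rule tendstoI)
    fix e :: real assume e: "e > 0"
    define d where "d = e / (J + 1)"
    have d: "d > 0" using e J0 by (simp add: d_def)
    have "eventually (\<lambda>F. \<forall>t\<in>UNIV. dist (P F t) (complex_of_real (T t)) < d) (finite_subsets_at_top UNIV)"
      using uniform_limitD[OF lim d] .
    then show "eventually (\<lambda>F. dist (?l F) (multiplier_op U (\<lambda>w. frac_symbol \<alpha> (w * h)) x) < e) (finite_subsets_at_top UNIV)"
    proof eventually_elim
      case (elim F)
      \<comment> \<open>The shift x - k h yields cis (- k w h), so the partial sums are evaluated at
        - (w h), where the even limit symbol has the same value.\<close>
      have Teven: "T (- (w * h)) = T (w * h)" for w by (simp add: T_def)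
      have mT: "multiplier_op U (\<lambda>w. frac_symbol \<alpha> (w * h)) x = multiplier_op U (\<lambda>w. T (w * h)) x"
        by (simp add: T_def)
      have D: "dist (?l F) (multiplier_op U (\<lambda>w. T (w * h)) x)
          = \<bar>Re (LBINT w. ?Q F w - ?R w)\<bar> / (2 * pi)"
        unfolding part multiplier_op_def dist_real_def diff_divide_distrib[symmetric]
        using PU admissible_integrable[OF adT] by (subst Bochner_Integration.integral_diff) auto
      have "\<bar>Re (LBINT w. ?Q F w - ?R w)\<bar>
          \<le> (LBINT w. norm (?Q F w - ?R w))"
        by (rule order_trans[OF abs_Re_le_cmod integral_norm_bound])
      also have "\<dots> \<le> (LBINT w. d * norm (U w))"
      proof (rule integral_mono)
        show "integrable lborel (\<lambda>w. norm (?Q F w - ?R w))"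
          by (rule integrable_norm, rule Bochner_Integration.integrable_diff[OF PU admissible_integrable[OF adT]])
        show "integrable lborel (\<lambda>w. d * norm (U w))"
          using Ui by (intro integrable_mult_right integrable_norm)
        fix w
        have "?Q F w - ?R w
            = U w * (P F (- (w * h)) - complex_of_real (T (w * h))) * cis (w * x)"
          by (simp add: algebra_simps)
        then have "norm (?Q F w - ?R w)
            = norm (U w) * norm (P F (- (w * h)) - complex_of_real (T (w * h)))"
          by (simp only: norm_mult norm_cis mult_1_right)
        also have "\<dots> \<le> norm (U w) * d"
          using elim[rule_format, of "- (w * h)"] unfolding Teven dist_norm
          by (intro mult_left_mono) auto
        finally show "norm (?Q F w - ?R w) \<le> d * norm (U w)"
          by (simp add: mult.commute)
      qed
      also have "\<dots> = d * J" by (simp add: J_def)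
      finally have "dist (?l F) (multiplier_op U (\<lambda>w. T (w * h)) x) \<le> d * J / (2 * pi)"
        unfolding D by (intro divide_right_mono) auto
      also have "\<dots> \<le> d * J / 1"
        using d J0 pi_gt3 by (intro divide_left_mono) auto
      also have "\<dots> < e"
        using e J0 by (simp add: d_def field_simps)
      finally show ?case unfolding mT .
    qed
  qed
qed

lemma fourier_higher_deriv:
  assumes d: "times_differentiable N f" and i: "\<And>k. k \<le> N \<Longrightarrow> integrable lborel ((deriv ^^ k) f)" and k: "k \<le> N"
  shows "fourier ((deriv ^^ k) f) w = (\<i> * of_real w) ^ k * fourier f w"
  using k
proof (induction k)
  case (Suc k)
  have "((deriv ^^ k) f has_real_derivative (deriv ^^ Suc k) f x) (at x)" for x
    using d Suc.prems by (simp add: times_differentiable_def DERIV_deriv_iff_field_differentiable)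
  then have "fourier ((deriv ^^ Suc k) f) w = \<i> * of_real w * fourier ((deriv ^^ k) f) w"
    using i[of k] i[of "Suc k"] Suc.prems by (intro fourier_deriv) auto
  then show ?case
    using Suc by (simp add: mult.assoc)
qed simp

text \<open>Two derivatives contribute (i w)^2 and raise |w|^(\<alpha>-2) to -|w|^\<alpha>. The
  factor \<open>kappa \<alpha> / Gamma (2 - \<alpha>)\<close> is what cancels the cosine and the
  Gamma value in the transform of the kernel.\<close>

lemma riesz_derivative_multiplier_op:
  assumes \<alpha>: "1 < \<alpha>" "\<alpha> < 2" and f: "integrable lborel f" and B: "\<And>x. \<bar>f x\<bar> \<le> B"
    and F: "integrable lborel (fourier f)" and F\<alpha>: "admissible (fourier f) (\<lambda>w. abs w powr \<alpha>)"
  shows "riesz_derivative \<alpha> f x = multiplier_op (fourier f) (\<lambda>w. - (abs w powr \<alpha>)) x"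
    and "riesz_derivative_exists \<alpha> f"
proof -
  define U where "U = fourier f"
  have [measurable]: "U \<in> borel_measurable borel"
    unfolding U_def using f by (rule fourier_measurable)
  define K where "K = - 2 * Gamma (2 - \<alpha>) * cos (pi * \<alpha> / 2) / (2 * pi)"
  define H where "H w = U w * of_real (abs w powr (\<alpha> - 2))" for w
  define D1 where "D1 x = K * Re (LBINT w. \<i> * of_real w * H w * cis (w * x))" for x
  define D2 where "D2 x = K * Re (LBINT w. \<i> * of_real w * (\<i> * of_real w * H w) * cis (w * x))" for x
  have H: "integrable lborel H"
    unfolding H_def[abs_def] U_def by (rule riesz_integral_fourier(2)[OF \<alpha> f B F])
  have I: "riesz_integral \<alpha> f = (\<lambda>x. K * Re (LBINT w. H w * cis (w * x)))"
  proof
    fix x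
    have "riesz_integral \<alpha> f x = Re (complex_of_real K * (LBINT w. H w * cis (w * x)))"
      unfolding H_def U_def K_def riesz_integral_fourier(1)[OF \<alpha> f B F, symmetric] by simp
    then show "riesz_integral \<alpha> f x = K * Re (LBINT w. H w * cis (w * x))"
      by simp
  qed
  \<comment> \<open>At w = 0 both sides are 0, as \<open>0 powr \<alpha> = 0\<close>.\<close>
  have H2: "\<i> * of_real w * (\<i> * of_real w * H w) = - (U w * of_real (abs w powr \<alpha>))" for w
  proof (cases "w = 0")
    case False
    have "abs w powr \<alpha> = abs w powr (\<alpha> - 2) * w\<^sup>2"
      using False by (simp add: powr_diff powr_numeral)
    then show ?thesis
      by (simp add: H_def power2_eq_square mult_ac)
  qed (use \<alpha> in simp)
  have iH2: "integrable lborel (\<lambda>w. \<i> * of_real w * (\<i> * of_real w * H w))"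
    unfolding H2 using F\<alpha> by (simp add: admissible_def U_def)
  have iH1: "integrable lborel (\<lambda>w. \<i> * of_real w * H w)"
  proof (rule Bochner_Integration.integrable_bound)
    show "integrable lborel (\<lambda>w. norm (H w) + norm (\<i> * of_real w * (\<i> * of_real w * H w)))"
      using H iH2 by (intro Bochner_Integration.integrable_add integrable_norm)
    \<comment> \<open>The intermediate moment lies between the moments of order 0 and 2.\<close>
    have "abs w \<le> 1 + abs w * abs w" for w :: real
    proof (cases "abs w \<le> 1")
      case False
      then have "abs w * 1 \<le> abs w * abs w" by (intro mult_left_mono) auto
      then show ?thesis by simp
    next
      case True
      then show ?thesis using zero_le_mult_iff[of "abs w" "abs w"] by linarith
    qed
    then have "abs w * norm (H w) \<le> (1 + abs w * abs w) * norm (H w)" for w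
      by (intro mult_right_mono) auto
    then show "AE w in lborel. norm (\<i> * of_real w * H w)
        \<le> norm (norm (H w) + norm (\<i> * of_real w * (\<i> * of_real w * H w)))"
      unfolding real_norm_def by (intro AE_I2 order_trans[OF _ abs_ge_self]) (simp add: norm_mult algebra_simps)
  qed (use H in measurable)
  have d1: "(riesz_integral \<alpha> f has_real_derivative D1 x) (at x)" for x
    unfolding I D1_def by (rule DERIV_cmult[OF fourier_integral_deriv[OF H iH1]])
  have d2: "(D1 has_real_derivative D2 x) (at x)" for x
    unfolding D1_def[abs_def] D2_def by (rule DERIV_cmult[OF fourier_integral_deriv[OF iH1 iH2]])
  have deriv1: "deriv (riesz_integral \<alpha> f) = D1"
    using d1 by (intro ext DERIV_imp_deriv)
  have deriv2: "deriv D1 = D2"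
    using d2 by (intro ext DERIV_imp_deriv)
  show "riesz_derivative_exists \<alpha> f"
    unfolding riesz_derivative_exists_def
  proof (intro conjI allI)
    show "integrable lborel (riesz_integrand \<alpha> f x)" for x
      unfolding riesz_integrand_def[abs_def] using \<alpha> by (intro integrable_riesz_kernel[OF f B]) auto
    have "(deriv ^^ j) (riesz_integral \<alpha> f) field_differentiable at x" if "j < 2" for j x
    proof -
      have "j = 0 \<or> j = 1" using that by auto
      then show ?thesis
        using d1[of x] d2[of x] deriv1 by (auto simp: field_differentiable_def)
    qed
    then show "times_differentiable 2 (riesz_integral \<alpha> f)"
      by (simp add: times_differentiable_def)
  qed
  have c: "cos (pi * \<alpha> / 2) < 0"
  proof -
    have "cos (pi * \<alpha> / 2) < cos (pi / 2)"
      using \<alpha> by (intro cos_monotone_0_pi) auto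
    then show ?thesis by simp
  qed
  have G: "Gamma (2 - \<alpha>) > 0"
    using \<alpha> by (intro Gamma_real_pos) auto
  have "D2 x = - (K * Re (LBINT w. U w * of_real (abs w powr \<alpha>) * cis (w * x)))"
    unfolding D2_def H2 by simp
  moreover have "kappa \<alpha> / Gamma (2 - \<alpha>) * K = - 1 / (2 * pi)"
    using c G by (simp add: kappa_def K_def)
  ultimately have "riesz_derivative \<alpha> f x = - Re (LBINT w. U w * of_real (abs w powr \<alpha>) * cis (w * x)) / (2 * pi)"
    unfolding riesz_derivative_def using deriv1 deriv2
    by (simp add: numeral_2_eq_2 mult.assoc[symmetric])
  then show "riesz_derivative \<alpha> f x = multiplier_op (fourier f) (\<lambda>w. - (abs w powr \<alpha>)) x"
    by (simp add: multiplier_op_def U_def)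
qed

text \<open>With t = w h the power of \<open>h\<close> separates: |w h|^(\<alpha>+2n) / h^\<alpha> =
  |w|^(\<alpha>+2n) h^(2n). Here p is the symbol of the explicit and r that of the implicit
  operator; p = r = 1 is the case n = 1.\<close>

lemma scheme_multiplier_error:
  assumes h: "h > 0"
    and le: "\<And>t. \<bar>frac_symbol \<alpha> t * p t - \<bar>t\<bar> powr \<alpha> * r t\<bar> \<le> M * \<bar>t\<bar> powr (\<alpha> + real (2 * n))"
    and a1: "admissible U (\<lambda>w. - (abs w powr \<alpha>) * r (w * h))"
    and a2: "admissible U (\<lambda>w. - (1 / h powr \<alpha>) * (frac_symbol \<alpha> (w * h) * p (w * h)))"
    and a3: "admissible U (\<lambda>w. abs w powr (\<alpha> + real (2 * n)))"
  shows "\<bar>multiplier_op U (\<lambda>w. - (abs w powr \<alpha>) * r (w * h)) x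
      - multiplier_op U (\<lambda>w. - (1 / h powr \<alpha>) * (frac_symbol \<alpha> (w * h) * p (w * h))) x\<bar>
    \<le> (M * (LBINT w. norm (U w * of_real (abs w powr (\<alpha> + real (2 * n))))) / (2 * pi)) * h ^ (2 * n)"
proof -
  let ?a = "\<lambda>w. - (abs w powr \<alpha>) * r (w * h)"
  let ?b = "\<lambda>w. - (1 / h powr \<alpha>) * (frac_symbol \<alpha> (w * h) * p (w * h))"
  have "\<bar>multiplier_op U (\<lambda>w. ?a w - ?b w) x\<bar>
      \<le> (M * h ^ (2 * n)) * (LBINT w. norm (U w * of_real (abs w powr (\<alpha> + real (2 * n))))) / (2 * pi)"
  proof (rule multiplier_op_bound[where k = "\<lambda>w. abs w powr (\<alpha> + real (2 * n))"])
    show "admissible U (\<lambda>w. ?a w - ?b w)"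
      by (rule admissible_diff[OF a1 a2])
    show "admissible U (\<lambda>w. abs w powr (\<alpha> + real (2 * n)))"
      by (rule a3)
    fix w
    have e: "\<bar>w * h\<bar> powr \<beta> = abs w powr \<beta> * h powr \<beta>" for \<beta>
      using h by (simp add: abs_mult powr_mult)
    have hp: "h powr \<alpha> > 0" using h by simp
    have "?a w - ?b w
        = (frac_symbol \<alpha> (w * h) * p (w * h) - \<bar>w * h\<bar> powr \<alpha> * r (w * h)) / h powr \<alpha>"
      unfolding e using hp by (simp add: field_simps)
    then have "\<bar>?a w - ?b w\<bar>
        \<le> (M * \<bar>w * h\<bar> powr (\<alpha> + real (2 * n))) / h powr \<alpha>"
      using le[of "w * h"] hp by (simp add: abs_divide divide_right_mono)
    also have "\<dots> = M * h ^ (2 * n) * \<bar>abs w powr (\<alpha> + real (2 * n))\<bar>"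
    proof -
      have "h powr (\<alpha> + real (2 * n)) = h powr \<alpha> * h ^ (2 * n)"
        using h unfolding powr_add by (simp only: powr_realpow)
      then show ?thesis
        unfolding e using hp by (simp add: field_simps)
    qed
    finally show "\<bar>?a w - ?b w\<bar>
        \<le> M * h ^ (2 * n) * \<bar>abs w powr (\<alpha> + real (2 * n))\<bar>" .
  qed
  then show ?thesis
    unfolding multiplier_op_diff[OF a1 a2] by (simp add: mult_ac)
qed

section \<open>The scheme for a fixed function\<close>

text \<open>The number 2n + 3 is \<open>nat \<lfloor>\<alpha>\<rfloor> + 2 * n + 2\<close>, since
  the integer part of \<alpha> is 1.\<close>

locale riesz_scheme =
  fixes \<alpha> :: real and f :: "real \<Rightarrow> real" and n :: nat
  assumes \<alpha>: "1 < \<alpha>" "\<alpha> < 2" and n: "n \<ge> 1"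
    and diff: "times_differentiable (2 * n + 3) f"
    and int: "\<And>k. k \<le> 2 * n + 3 \<Longrightarrow> integrable lborel ((deriv ^^ k) f)"
begin

abbreviation U :: "real \<Rightarrow> complex" where "U \<equiv> fourier f"

lemma f_integrable: "integrable lborel f"
  using int[of 0] by simp

lemma f_deriv: "(f has_real_derivative deriv f x) (at x)"
  using diff by (auto simp: times_differentiable_def DERIV_deriv_iff_field_differentiable dest: spec[of _ 0])

lemma f_bounded: "\<bar>f x\<bar> \<le> \<bar>f 0\<bar> + (LBINT x. \<bar>deriv f x\<bar>)"
  using int[of 1] by (intro bounded_of_integrable_deriv f_deriv) simp

text \<open>The transform of the derivative of order 2n + 3 is bounded, which bounds |w|^(2n+3)
  times |U w|; the two L1 norms in \<open>A\<close> control low and high frequencies.\<close>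

lemma fourier_decay:
  assumes "0 \<le> s" "s < 2 * real n + 2"
  shows "admissible U (\<lambda>w. abs w powr s)"
proof -
  define A where "A = max (LBINT x. \<bar>f x\<bar>) (LBINT x. \<bar>(deriv ^^ (2 * n + 3)) f x\<bar>)"
  have "norm (U w) * abs w ^ (2 * n + 3) = norm (fourier ((deriv ^^ (2 * n + 3)) f) w)" for w
    by (subst fourier_higher_deriv[OF diff int]) (simp_all add: norm_mult norm_power mult.commute)
  moreover have "norm (fourier ((deriv ^^ (2 * n + 3)) f) w) \<le> A" for w
    unfolding A_def by (rule order_trans[OF fourier_norm_le[OF int] max.cobounded2]) simp
  moreover have "norm (U w) \<le> A" for w
    unfolding A_def by (rule order_trans[OF fourier_norm_le[OF f_integrable] max.cobounded1])
  ultimately show ?thesis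
    unfolding admissible_def using assms f_integrable
    by (intro decay_integrable[where N = "2 * n + 3" and A = A] fourier_measurable) auto
qed

lemma fourier_integrable_f: "integrable lborel U"
proof (rule integrable_cong_AE[THEN iffD1])
  show "integrable lborel (\<lambda>w. U w * of_real (abs w powr 0))"
    using fourier_decay[of 0] by (simp only: admissible_def)
  \<comment> \<open>The exceptional point is w = 0, where \<open>0 powr 0 = 0\<close>.\<close>
  show "AE w in lborel. U w * of_real (abs w powr 0) = U w"
    using AE_lborel_singleton[of "0::real"] by eventually_elim simp
qed (use fourier_measurable[OF f_integrable] in measurable)

lemma admissible_1: "admissible U (\<lambda>_. 1)"
  using fourier_integrable_f by (simp add: admissible_def)

lemma f_eq_multiplier_op: "f x = multiplier_op U (\<lambda>_. 1) x"
proof -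
  have "isCont f x" for x
    using f_deriv DERIV_isCont by blast
  then have "continuous_on UNIV f"
    by (simp add: continuous_on_eq_continuous_at)
  then show ?thesis
    using fourier_inversion[OF f_integrable f_bounded _ fourier_integrable_f, of x]
    by (simp add: multiplier_op_def)
qed

lemma riesz_derivative_eq: "riesz_derivative \<alpha> f = multiplier_op U (\<lambda>w. - (abs w powr \<alpha>))"
  and riesz_exists: "riesz_derivative_exists \<alpha> f"
proof -
  have "admissible U (\<lambda>w. abs w powr \<alpha>)"
    using \<alpha> n by (intro fourier_decay) auto
  note * = riesz_derivative_multiplier_op[OF \<alpha> f_integrable f_bounded fourier_integrable_f this]
  show "riesz_derivative \<alpha> f = multiplier_op U (\<lambda>w. - (abs w powr \<alpha>))"
    by (rule ext) (rule *(1))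
  show "riesz_derivative_exists \<alpha> f" by (rule *(2))
qed

lemma admissible_riesz: "admissible U (\<lambda>w. - (abs w powr \<alpha>))"
  using admissible_cmult[OF fourier_decay[of \<alpha>], of "-1"] \<alpha> n by simp

lemma frac_diff_has_sum:
  "((\<lambda>k. frac_coeff \<alpha> k * f (x - of_int k * h)) has_sum
      multiplier_op U (\<lambda>w. frac_symbol \<alpha> (w * h)) x) UNIV"
  by (rule frac_diff_multiplier_op[OF \<alpha> admissible_1 f_eq_multiplier_op])

lemma frac_summable: "frac_diff_summable \<alpha> h f x"
  unfolding frac_diff_summable_def by (rule has_sum_imp_summable[OF frac_diff_has_sum])

definition basic_symbol :: "real \<Rightarrow> real \<Rightarrow> real" where
  "basic_symbol h w = - (1 / h powr \<alpha>) * frac_symbol \<alpha> (w * h)"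

lemma basic_approx_eq: "basic_approx \<alpha> h f = multiplier_op U (basic_symbol h)"
  unfolding basic_approx_def basic_symbol_def[abs_def] multiplier_op_cmult frac_diff_def infsumI[OF frac_diff_has_sum]
  by simp

lemma admissible_basic: "admissible U (basic_symbol h)"
proof -
  have "admissible U (\<lambda>w. 1 * frac_symbol \<alpha> (w * h))"
  proof (rule admissible_mult_bounded[OF admissible_1])
    show "\<bar>frac_symbol \<alpha> (w * h)\<bar> \<le> 2 powr \<alpha>" for w
      using \<alpha> abs_sin_le_one[of "w * h / 2"] unfolding abs_of_nonneg[OF powr_ge_zero]
      by (intro powr_mono2) (auto simp: abs_mult)
  qed measurable
  then show ?thesis
    unfolding basic_symbol_def[abs_def] by (intro admissible_cmult) simp
qed

lemma multiplier_op_bounded: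
  assumes "admissible U m"
  shows "multiplier_op U m \<in> bounded_functions"
  by (rule bounded_functionsI, rule multiplier_op_bound[OF assms assms, of 1]) simp

lemma sin_sq_power_le: "\<bar>central_symbol l t\<bar> \<le> (4 :: real) ^ l"
proof -
  have "((sin (t / 2))\<^sup>2) ^ l \<le> 1"
    by (rule power_le_one) (auto simp: abs_square_le_1)
  then show ?thesis
    by (simp add: abs_mult power_abs mult_left_le)
qed

lemma admissible_central:
  assumes "admissible U m"
  shows "admissible U (\<lambda>w. m w * central_symbol l (w * h))"
proof (rule admissible_mult_bounded[OF assms])
  show "\<bar>central_symbol l (w * h)\<bar> \<le> 4 ^ l" for w
    by (rule sin_sq_power_le)
qed measurable

lemma lhs_op_multiplier_op:
  assumes "admissible U m"
  shows "lhs_op h n c (multiplier_op U m) x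
    = multiplier_op U (\<lambda>w. m w * (1 - c * central_symbol (n - 1) (w * h))) x"
proof -
  have "multiplier_op U (\<lambda>w. m w * (1 - c * central_symbol (n - 1) (w * h))) x
      = multiplier_op U (\<lambda>w. m w - c * (m w * central_symbol (n - 1) (w * h))) x"
    by (simp add: algebra_simps)
  then show ?thesis
    using assms by (simp only: lhs_op_def central_diff_0 multiplier_op_diff[OF assms admissible_cmult[OF admissible_central[OF assms]]]
        multiplier_op_cmult central_diff_multiplier_op)
qed

lemma rhs_op_multiplier_op:
  assumes "admissible U m"
  shows "rhs_op h n b (multiplier_op U m)
    = multiplier_op U (\<lambda>w. \<Sum>l<n-1. b l * (m w * central_symbol l (w * h)))"
  by (rule ext)
    (simp only: rhs_op_def multiplier_op_sum[OF admissible_cmult[OF admissible_central[OF assms]]]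
      multiplier_op_cmult central_diff_multiplier_op[OF assms])

lemma admissible_rhs:
  assumes "admissible U m"
  shows "admissible U (\<lambda>w. \<Sum>l<n-1. b l * (m w * central_symbol l (w * h)))"
  by (intro admissible_sum admissible_cmult admissible_central assms)

lemma rhs_bounded: "rhs_op h n b (basic_approx \<alpha> h f) \<in> bounded_functions"
  unfolding basic_approx_eq rhs_op_multiplier_op[OF admissible_basic]
  by (rule multiplier_op_bounded[OF admissible_rhs[OF admissible_basic]])

lemma admissible_top: "admissible U (\<lambda>w. abs w powr (\<alpha> + real (2 * n)))"
  using \<alpha> by (intro fourier_decay) auto

lemma basic_error:
  assumes a: "is_sinc_powr_expansion \<alpha> a" and n1: "n = 1"
  shows "\<exists>C. \<forall>h>0. \<forall>x. \<bar>riesz_derivative \<alpha> f x - basic_approx \<alpha> h f x\<bar> \<le> C * h ^ (2 * n)"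
proof -
  have "(\<lambda>t. sinc_powr \<alpha> t * 1 - 1) \<in> O[at 0](\<lambda>t. t ^ (2 * n))"
    using sinc_powr_minus_one_bigo[OF a] n1 by simp
  then obtain M where M: "\<And>t. \<bar>frac_symbol \<alpha> t * 1 - \<bar>t\<bar> powr \<alpha> * 1\<bar> \<le> M * \<bar>t\<bar> powr (\<alpha> + real (2 * n))"
    using symbol_error_bound[of \<alpha> "\<lambda>_. 1" 1 "\<lambda>_. 1" n] \<alpha> by auto
  have "\<bar>riesz_derivative \<alpha> f x - basic_approx \<alpha> h f x\<bar>
      \<le> (M * (LBINT w. norm (U w * of_real (abs w powr (\<alpha> + real (2 * n))))) / (2 * pi)) * h ^ (2 * n)" if h: "h > 0" for h x
  proof -
    have e: "(\<lambda>w. - (abs w powr \<alpha>) * 1) = (\<lambda>w. - (abs w powr \<alpha>))"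
      "(\<lambda>w. - (1 / h powr \<alpha>) * (frac_symbol \<alpha> (w * h) * 1)) = basic_symbol h"
      by (auto simp: basic_symbol_def fun_eq_iff)
    show ?thesis
      using scheme_multiplier_error[where p = "\<lambda>_. 1" and r = "\<lambda>_. 1" and U = U and x = x, OF h M] admissible_riesz admissible_basic admissible_top
      unfolding e riesz_derivative_eq basic_approx_eq by blast
  qed
  then show ?thesis by blast
qed

text \<open>Consistency is measured before the inversion, where both sides are Fourier multipliers
  with explicit symbols; the inverse enters only in \<open>riesz_approx_error\<close>.\<close>

lemma compact_error:
  assumes a: "is_sinc_powr_expansion \<alpha> a" and n2: "n \<ge> 2" and id: "\<forall>t\<ge>0. coefficient_identity n a b t"
  shows "\<exists>C. \<forall>h>0. \<forall>x. \<bar>lhs_op h n (b (n - 1)) (riesz_derivative \<alpha> f) x - rhs_op h n b (basic_approx \<alpha> h f) x\<bar> \<le> C * h ^ (2 * n)"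
proof -
  define p where "p t = (\<Sum>l<n-1. b l * central_symbol l t)" for t
  define r where "r t = 1 - b (n - 1) * central_symbol (n - 1) t" for t
  \<comment> \<open>A common bound for \<open>p\<close> and \<open>r\<close>, as
    \<open>symbol_error_bound\<close> requires; each central symbol is at most 4^l in
    modulus.\<close>
  define K where "K = (\<Sum>l<n-1. \<bar>b l\<bar> * 4 ^ l) + (1 + \<bar>b (n - 1)\<bar> * 4 ^ (n - 1))"
  have sum0: "(\<Sum>l<n-1. \<bar>b l\<bar> * 4 ^ l) \<ge> 0"
    by (intro sum_nonneg) auto
  have pK: "\<bar>p t\<bar> \<le> K" for t
  proof -
    have "\<bar>p t\<bar> \<le> (\<Sum>l<n-1. \<bar>b l * central_symbol l t\<bar>)"
      unfolding p_def by (rule sum_abs)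
    also have "\<dots> \<le> (\<Sum>l<n-1. \<bar>b l\<bar> * 4 ^ l)"
      unfolding abs_mult[of "b _"] by (intro sum_mono mult_left_mono sin_sq_power_le) auto
    also have "\<dots> \<le> K" by (simp add: K_def)
    finally show ?thesis .
  qed
  have rK: "\<bar>r t\<bar> \<le> K" for t
  proof -
    have "\<bar>b (n - 1) * central_symbol (n - 1) t\<bar> \<le> \<bar>b (n - 1)\<bar> * 4 ^ (n - 1)"
      unfolding abs_mult[of "b _"] by (intro mult_left_mono sin_sq_power_le) auto
    then have "\<bar>r t\<bar> \<le> 1 + \<bar>b (n - 1)\<bar> * 4 ^ (n - 1)"
      unfolding r_def by linarith
    then show ?thesis using sum0 by (simp add: K_def)
  qed
  have "(\<lambda>t. sinc_powr \<alpha> t * p t - r t) \<in> O[at 0](\<lambda>t. t ^ (2 * n))"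
    unfolding p_def r_def by (rule coefficient_identity_bigo[OF a n2 id])
  then obtain M where M: "\<And>t. \<bar>frac_symbol \<alpha> t * p t - \<bar>t\<bar> powr \<alpha> * r t\<bar> \<le> M * \<bar>t\<bar> powr (\<alpha> + real (2 * n))"
    using symbol_error_bound[of \<alpha> p K r n] \<alpha> pK rK by auto
  have "\<bar>lhs_op h n (b (n - 1)) (riesz_derivative \<alpha> f) x - rhs_op h n b (basic_approx \<alpha> h f) x\<bar>
      \<le> (M * (LBINT w. norm (U w * of_real (abs w powr (\<alpha> + real (2 * n))))) / (2 * pi)) * h ^ (2 * n)" if h: "h > 0" for h x
  proof -
    have l: "lhs_op h n (b (n - 1)) (riesz_derivative \<alpha> f) x = multiplier_op U (\<lambda>w. - (abs w powr \<alpha>) * r (w * h)) x"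
      unfolding riesz_derivative_eq lhs_op_multiplier_op[OF admissible_riesz] r_def ..
    have sym: "(\<Sum>l<n-1. b l * (basic_symbol h w * central_symbol l (w * h)))
        = - (1 / h powr \<alpha>) * (frac_symbol \<alpha> (w * h) * p (w * h))" for w
    proof -
      have "(\<Sum>l<n-1. b l * (basic_symbol h w * central_symbol l (w * h))) = basic_symbol h w * p (w * h)"
        unfolding p_def sum_distrib_left by (intro sum.cong refl) (simp only: mult_ac)
      then show ?thesis
        by (simp only: basic_symbol_def mult.assoc)
    qed
    have rr: "rhs_op h n b (basic_approx \<alpha> h f) x
        = multiplier_op U (\<lambda>w. - (1 / h powr \<alpha>) * (frac_symbol \<alpha> (w * h) * p (w * h))) x"
      unfolding basic_approx_eq rhs_op_multiplier_op[OF admissible_basic] sym ..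
    have a2: "admissible U (\<lambda>w. - (1 / h powr \<alpha>) * (frac_symbol \<alpha> (w * h) * p (w * h)))"
      using admissible_rhs[OF admissible_basic, of b h h] unfolding sym .
    have a1: "admissible U (\<lambda>w. - (abs w powr \<alpha>) * r (w * h))"
    proof (rule admissible_mult_bounded[OF admissible_riesz _ rK])
      show "(\<lambda>w. r (w * h)) \<in> borel_measurable borel"
        unfolding r_def by measurable
    qed
    show ?thesis
      unfolding l rr by (rule scheme_multiplier_error[OF h M a1 a2 admissible_top])
  qed
  then show ?thesis by blast
qed

text \<open>Stability plus consistency: \<open>lhs_op_lower_bound\<close> is applied to the
  difference of the exact and the approximate derivative, whose image under the implicit operator is
  the consistency error.\<close>

lemma riesz_approx_error:
  assumes a: "is_sinc_powr_expansion \<alpha> a" and id: "n \<ge> 2 \<Longrightarrow> \<forall>t\<ge>0. coefficient_identity n a b t"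
  shows "\<exists>C. \<forall>h>0. \<forall>x. \<bar>riesz_derivative \<alpha> f x - riesz_approx \<alpha> n b h f x\<bar> \<le> C * h ^ (2 * n)"
proof (cases "n = 1")
  case True
  then show ?thesis
    using basic_error[OF a True] by (simp add: riesz_approx_def)
next
  case False
  then have n2: "n \<ge> 2" using n by simp
  note id = id[OF n2]
  define c where "c = b (n - 1)"
  have q: "\<bar>c\<bar> * 4 ^ (n - 1) < 1"
    unfolding c_def by (rule contraction_constant_less[OF \<alpha> a n2 id])
  obtain C where C: "\<And>h x. h > 0 \<Longrightarrow> \<bar>lhs_op h n c (riesz_derivative \<alpha> f) x - rhs_op h n b (basic_approx \<alpha> h f) x\<bar> \<le> C * h ^ (2 * n)"
    using compact_error[OF a n2 id] unfolding c_def by blast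
  have "\<bar>riesz_derivative \<alpha> f x - riesz_approx \<alpha> n b h f x\<bar> \<le> C / (1 - \<bar>c\<bar> * 4 ^ (n - 1)) * h ^ (2 * n)" if h: "h > 0" for h x
  proof -
    define g where "g = rhs_op h n b (basic_approx \<alpha> h f)"
    define w where "w = riesz_approx \<alpha> n b h f"
    have bij: "lhs_op h n c ` bounded_functions = bounded_functions"
      using lhs_op_bij[OF q] by (simp add: bij_betw_def)
    \<comment> \<open>Membership in the image makes \<open>inv_into\<close> return a genuine bounded
      preimage.\<close>
    have g: "g \<in> lhs_op h n c ` bounded_functions"
      unfolding bij g_def by (rule rhs_bounded)
    have w: "w = inv_into bounded_functions (lhs_op h n c) g"
      using False by (simp add: w_def riesz_approx_def bounded_inverse_def c_def g_def)
    have wb: "w \<in> bounded_functions" and lw: "lhs_op h n c w = g"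
      unfolding w using inv_into_into[OF g] f_inv_into_f[OF g] by auto
    have Rb: "riesz_derivative \<alpha> f \<in> bounded_functions"
      unfolding riesz_derivative_eq by (rule multiplier_op_bounded[OF admissible_riesz])
    obtain B1 where B1: "\<And>x. \<bar>riesz_derivative \<alpha> f x\<bar> \<le> B1"
      using Rb by (metis bounded_functionsE)
    obtain B2 where B2: "\<And>x. \<bar>w x\<bar> \<le> B2"
      using wb by (metis bounded_functionsE)
    have db: "(\<lambda>x. riesz_derivative \<alpha> f x - w x) \<in> bounded_functions"
    proof (rule bounded_functionsI)
      fix x show "\<bar>riesz_derivative \<alpha> f x - w x\<bar> \<le> B1 + B2"
        using B1[of x] B2[of x] by linarith
    qed
    have "\<bar>lhs_op h n c (\<lambda>x. riesz_derivative \<alpha> f x - w x) x\<bar> \<le> C * h ^ (2 * n)" for x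
    proof -
      have "lhs_op h n c (\<lambda>x. riesz_derivative \<alpha> f x - w x) x = lhs_op h n c (riesz_derivative \<alpha> f) x - lhs_op h n c w x"
        by (simp add: lhs_op_def central_diff_diff right_diff_distrib)
      then show ?thesis
        using C[OF h, of x] by (simp add: lw g_def)
    qed
    from lhs_op_lower_bound[OF q db this, of x] show ?thesis
      by (simp add: w_def)
  qed
  then show ?thesis by blast
qed

end

theorem theorem2:
  fixes \<alpha> t :: real and n :: nat and u :: "real \<Rightarrow> real \<Rightarrow> real" and a b :: "nat \<Rightarrow> real"
  assumes "1 < \<alpha>" and "\<alpha> < 2" and "n \<ge> 1"
    and "C_k (nat \<lfloor>\<alpha>\<rfloor> + 2 * n + 1) (\<lambda>x. u x t)"
    and "times_differentiable (nat \<lfloor>\<alpha>\<rfloor> + 2 * n + 2) (\<lambda>x. u x t)"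
    and "\<And>k. k \<le> nat \<lfloor>\<alpha>\<rfloor> + 2 * n + 2 \<Longrightarrow> integrable lborel ((deriv ^^ k) (\<lambda>x. u x t))"
    and "is_sinc_powr_expansion \<alpha> a"
    and "n \<ge> 2 \<Longrightarrow> \<forall>\<theta>\<ge>0. coefficient_identity n a b \<theta>"
  shows "riesz_derivative_exists \<alpha> (\<lambda>x. u x t) \<and>
    (\<forall>h>0. \<forall>x. frac_diff_summable \<alpha> h (\<lambda>x. u x t) x) \<and>
    (n \<ge> 2 \<longrightarrow> (\<forall>h>0.
       bij_betw (lhs_op h n (b (n - 1))) bounded_functions bounded_functions \<and>
       rhs_op h n b (basic_approx \<alpha> h (\<lambda>x. u x t)) \<in> bounded_functions)) \<and>
    (\<forall>x. (\<lambda>h. riesz_derivative \<alpha> (\<lambda>x. u x t) x - riesz_approx \<alpha> n b h (\<lambda>x. u x t) x)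
            \<in> O[at_right 0](\<lambda>h. h ^ (2 * n))) \<and>
    a 0 = 1 \<and> a 1 = - \<alpha> / 24 \<and> a 2 = (1 / 1920 + (\<alpha> - 1) / 1152) * \<alpha> \<and>
    a 3 = - (1 / 322560 + (\<alpha> - 1) / 46080 + (\<alpha> - 1) * (\<alpha> - 2) / 82944) * \<alpha>"
proof -
  have "\<lfloor>\<alpha>\<rfloor> = 1"
    using assms(1,2) by (simp add: floor_eq_iff)
  then have N: "nat \<lfloor>\<alpha>\<rfloor> + 2 * n + 2 = 2 * n + 3"
    by simp
  interpret riesz_scheme \<alpha> "\<lambda>x. u x t" n
    using assms(1-3) assms(5,6)[unfolded N] by unfold_locales
  obtain C where C: "\<And>h x. h > 0 \<Longrightarrow>
      \<bar>riesz_derivative \<alpha> (\<lambda>x. u x t) x - riesz_approx \<alpha> n b h (\<lambda>x. u x t) x\<bar> \<le> C * h ^ (2 * n)"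
    using riesz_approx_error[OF assms(7,8)] by blast
  have "(\<lambda>h. riesz_derivative \<alpha> (\<lambda>x. u x t) x - riesz_approx \<alpha> n b h (\<lambda>x. u x t) x)
            \<in> O[at_right 0](\<lambda>h. h ^ (2 * n))" for x
  proof (rule bigoI)
    show "\<forall>\<^sub>F h in at_right 0. norm (riesz_derivative \<alpha> (\<lambda>x. u x t) x - riesz_approx \<alpha> n b h (\<lambda>x. u x t) x)
        \<le> C * norm (h ^ (2 * n))"
      using eventually_at_right_less[of 0] by eventually_elim (use C in simp)
  qed
  moreover have "bij_betw (lhs_op h n (b (n - 1))) bounded_functions bounded_functions" if "n \<ge> 2" for h
    by (rule lhs_op_bij[OF contraction_constant_less[OF assms(1,2,7) that assms(8)[OF that]]])
  ultimately show ?thesis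
    using riesz_exists frac_summable rhs_bounded sinc_powr_expansion(2)[OF assms(7)] sinc_powr_coeffs[OF assms(7)]
    by blast
qed

end
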